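(* Let $F$ be an almost-bipartite graph that is not a star. If $m$ is sufficiently large and $G$ is an $m$-edge $F$-free graph with maximal spectral radius (among all $m$-edge $F$-free graphs), then $$\lambda(G) = \sqrt{m} + \max_{M \in \mathcal{M}_F} \frac{e(M)}{v(M)} + O(m^{-1/2}).$$ Furthermore, there is a partition $V(G)=A\sqcup C$ such that $G[A]$ is isomorphic to a graph $M \in \mathcal{M}_F$ that achieves the maximum $\max_{M \in \mathcal{M}_F} \frac{e(M)}{v(M)}$, $C$ is an independent set, and all but at most one vertex of $C$ are complete to $A$.
   Context: A graph $F$ is almost-bipartite if it can be made bipartite by removing at most one edge. For an almost-bipartite graph $F$, $\mathcal{A}_F$ is the family of subgraphs of $F$ induced by $V(F)\setminus I$, where $I$ ranges over the maximal independent sets of $F$; $\mathcal{M}_F$ is the family of graphs that do not contain a subgraph isomorphic to any member of $\mathcal{A}_F$ (graphs may have isolated vertices). $\lambda(G)$ denotes the spectral radius (largest adjacency eigenvalue) of $G$; $e(M)$ and $v(M)$ denote the numbers of edges and vertices of $M$. A vertex $v$ is complete to a set $A$ if $v$ is adjacent to all vertices of $A$. Isolated vertices are ignored. *)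

theory Defs
  imports Complex_Main "Jordan_Normal_Form.Char_Poly"
begin

text \<open>A (finite simple) graph with explicit vertex set: (V, E), E a set of 2-element subsets of V.
  Used for the members of the families A_F and M_F, which may have isolated vertices.\<close>
type_synonym 'a graph = "'a set \<times> 'a set set"

definition verts :: "'a graph \<Rightarrow> 'a set" where "verts H = fst H"
definition edgs :: "'a graph \<Rightarrow> 'a set set" where "edgs H = snd H"

definition is_graph :: "'a graph \<Rightarrow> bool" where
  "is_graph H \<longleftrightarrow> finite (verts H) \<and> (\<forall>e\<in>edgs H. card e = 2 \<and> e \<subseteq> verts H)"

text \<open>Graphs whose isolated vertices are ignored are given just by their edge set;
  their vertex set is the union of the edges.\<close>
definition of_edges :: "'a set set \<Rightarrow> 'a graph" where
  "of_edges E = (\<Union>E, E)"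

definition is_edge_set :: "'a set set \<Rightarrow> bool" where
  "is_edge_set E \<longleftrightarrow> finite E \<and> (\<forall>e\<in>E. card e = 2)"

definition induced :: "'a graph \<Rightarrow> 'a set \<Rightarrow> 'a graph" where
  "induced H S = (S, {e\<in>edgs H. e \<subseteq> S})"

definition contains_copy :: "'b graph \<Rightarrow> 'a graph \<Rightarrow> bool" where
  "contains_copy G H \<longleftrightarrow> (\<exists>f. inj_on f (verts H) \<and> f ` verts H \<subseteq> verts G
      \<and> (\<forall>e\<in>edgs H. f ` e \<in> edgs G))"

definition isomorphic :: "'a graph \<Rightarrow> 'b graph \<Rightarrow> bool" where
  "isomorphic H G \<longleftrightarrow> (\<exists>f. bij_betw f (verts H) (verts G)
      \<and> (\<forall>x\<in>verts H. \<forall>y\<in>verts H. {x,y} \<in> edgs H \<longleftrightarrow> {f x, f y} \<in> edgs G))"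

definition independent :: "'a graph \<Rightarrow> 'a set \<Rightarrow> bool" where
  "independent H I \<longleftrightarrow> I \<subseteq> verts H \<and> (\<forall>e\<in>edgs H. \<not> e \<subseteq> I)"

definition maximal_independent :: "'a graph \<Rightarrow> 'a set \<Rightarrow> bool" where
  "maximal_independent H I \<longleftrightarrow> independent H I \<and> (\<forall>J. independent H J \<and> I \<subseteq> J \<longrightarrow> J = I)"

definition bipartite_edges :: "'a set set \<Rightarrow> bool" where
  "bipartite_edges E \<longleftrightarrow> (\<exists>X. \<forall>e\<in>E. card (e \<inter> X) = 1)"

text \<open>Removing at most one edge makes it bipartite (removing a non-edge = removing nothing).\<close>
definition almost_bipartite :: "'a set set \<Rightarrow> bool" where
  "almost_bipartite E \<longleftrightarrow> (\<exists>e0. bipartite_edges (E - {e0}))"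

definition is_star :: "'a set set \<Rightarrow> bool" where
  "is_star E \<longleftrightarrow> (\<exists>c. \<forall>e\<in>E. c \<in> e)"

definition A_fam :: "'a set set \<Rightarrow> 'a graph set" where
  "A_fam EF = {induced (of_edges EF) (\<Union>EF - I) | I. maximal_independent (of_edges EF) I}"

definition M_fam :: "'a set set \<Rightarrow> nat graph set" where
  "M_fam EF = {M. is_graph M \<and> (\<forall>H\<in>A_fam EF. \<not> contains_copy M H)}"

definition ratio :: "'a graph \<Rightarrow> real" where
  "ratio M = real (card (edgs M)) / real (card (verts M))"

definition F_free :: "'a set set \<Rightarrow> nat set set \<Rightarrow> bool" where
  "F_free EF G \<longleftrightarrow> \<not> contains_copy (of_edges G) (of_edges EF)"

definition adj_matrix :: "nat set set \<Rightarrow> real mat" where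
  "adj_matrix G = (let vs = sorted_list_of_set (\<Union>G) in
     mat (length vs) (length vs) (\<lambda>(i,j). if {vs ! i, vs ! j} \<in> G then 1 else 0))"

definition lam :: "nat set set \<Rightarrow> real" where
  "lam G = Max {k. eigenvalue (adj_matrix G) k}"

definition spex :: "'a set set \<Rightarrow> nat \<Rightarrow> nat set set \<Rightarrow> bool" where
  "spex EF m G \<longleftrightarrow> is_edge_set G \<and> card G = m \<and> F_free EF G \<and>
     (\<forall>G'. is_edge_set G' \<and> card G' = m \<and> F_free EF G' \<longrightarrow> lam G' \<le> lam G)"

end

theory Submission
  imports Defs "HOL-Analysis.Function_Topology" "HOL-Analysis.Convex" "Jordan_Normal_Form.Spectral_Radius"
begin

text \<open>
  Let \<open>x\<close> be a Perron vector of an extremal graph with maximal entry \<open>x\<^sub>u = 1\<close> and let \<open>\<rho>\<close> be the spectral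
  radius; \<open>\<rho>\<^sup>2 \<ge> m\<close> because stars are \<open>F\<close>-free. Expanding \<open>\<rho>\<^sup>2 x\<^sub>u\<close> over two-step walks, every edge contributes
  at most 1, except for edges inside the neighbourhood of \<open>u\<close>, whose overshoot is \<open>o(m)\<close> since neighbourhoods contain
  no large complete bipartite graph. So almost every edge contributes almost 1, that is, it joins a neighbour
  of \<open>u\<close> to a vertex of entry close to 1.

  If there are boundedly many vertices of large entry, they form a core \<open>A\<close> with entries \<open>1 - O(1 / \<rho>)\<close>, all other entries
  are \<open>O(1 / \<rho>)\<close>, almost all other vertices are complete to \<open>A\<close>, and so \<open>G[A]\<close> belongs to \<open>M\<^sub>F\<close>. A Rayleigh
  quotient computation gives \<open>\<rho> \<le> \<surd>m + e(A) / v(A) + O(m\<^sup>-\<^sup>1\<^sup>/\<^sup>2)\<close>, and comparison with the join of \<open>G[A]\<close> and an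
  independent set shows that the edges leaving \<open>A\<close> are packed as tightly as possible. Otherwise \<open>G\<close> is close to a complete
  bipartite graph with two large parts; then exceptional vertices only decrease \<open>\<rho>\<^sup>2 - m\<close>, so \<open>G\<close> is
  complete bipartite, \<open>\<rho> = \<surd>m\<close> and the maximal ratio is 0.
\<close>


section \<open>Adjacency, arcs and the Rayleigh characterisation of the spectral radius\<close>

text \<open>Two regimes cannot be avoided: if F is not bipartite, for instance a triangle, complete
  bipartite graphs with both parts growing are F-free and all have radius sqrt(m), so there is no a
  priori bound on the number of large entries. The walk count is powerful because it may be based at
  any vertex of entry close to 1, not only at u: every such vertex is then adjacent to almost all
  relevant neighbours of u, and this is how common neighbourhoods are produced. In the bounded
  regime the estimate of \<rho> up to O(1 / \<rho>) is too coarse to see a single misplaced edge.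
  Exactness comes from integrality, twice. Distinct ratios with bounded denominators differ by a
  constant, so the core attains the maximum. And a non-optimal distribution of the edges leaving the
  core lowers an integer sum of squares by at least a constant times the quantity being
  redistributed, whereas replacing core entries by 1 perturbs that sum only by a relative O(1 /
  \<rho>).\<close>

definition nbr :: "nat set set \<Rightarrow> nat \<Rightarrow> nat set" where
  "nbr G v = {w. {v, w} \<in> G}"

definition arcs :: "nat set set \<Rightarrow> (nat \<times> nat) set" where
  "arcs G = {(v, w). {v, w} \<in> G}"

lemma in_nbr_iff: "w \<in> nbr G v \<longleftrightarrow> {v, w} \<in> G"
  by (simp add: nbr_def)

lemma in_arcs_iff: "(v, w) \<in> arcs G \<longleftrightarrow> {v, w} \<in> G"
  by (simp add: arcs_def)

lemma nbr_sym: "w \<in> nbr G v \<longleftrightarrow> v \<in> nbr G w"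
  by (simp add: nbr_def insert_commute)

lemma no_loop: "is_edge_set G \<Longrightarrow> {v, v} \<notin> G"
  by (force simp: is_edge_set_def)

lemma not_in_nbr_self: "is_edge_set G \<Longrightarrow> v \<notin> nbr G v"
  using no_loop[of G v] by (simp add: nbr_def)

lemma finite_Union_edges: "is_edge_set G \<Longrightarrow> finite (\<Union>G)"
  unfolding is_edge_set_def by (metis card.infinite finite_Union zero_neq_numeral)

lemma nbr_subset: "nbr G v \<subseteq> \<Union>G"
  by (auto simp: nbr_def)

lemma finite_nbr: "is_edge_set G \<Longrightarrow> finite (nbr G v)"
  using finite_Union_edges nbr_subset finite_subset by metis

lemma nbr_empty: "v \<notin> \<Union>G \<Longrightarrow> nbr G v = {}"
  by (auto simp: nbr_def)

lemma arcs_subset: "arcs G \<subseteq> \<Union>G \<times> \<Union>G"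
  by (auto simp: arcs_def)

lemma finite_arcs: "is_edge_set G \<Longrightarrow> finite (arcs G)"
  using arcs_subset[of G] finite_Union_edges[of G] by (meson finite_SigmaI finite_subset)

lemma arcs_eq_Sigma: "arcs G = Sigma (\<Union>G) (nbr G)"
  by (auto simp: arcs_def nbr_def)

lemma edge_cases:
  assumes "is_edge_set G" "e \<in> G"
  obtains v w where "e = {v, w}" "v \<noteq> w"
  using assms unfolding is_edge_set_def by (metis card_2_iff)

lemma Union_ex_nbr:
  assumes "is_edge_set G" "v \<in> \<Union>G"
  obtains w where "w \<in> nbr G v"
proof -
  obtain e where e: "e \<in> G" "v \<in> e" using assms by auto
  obtain a b where "e = {a, b}" using edge_cases[OF assms(1) e(1)] by metis
  then show ?thesis using e that by (auto simp: nbr_def insert_commute)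
qed

lemma sum_arcs:
  assumes "is_edge_set G"
  shows "(\<Sum>p\<in>arcs G. f p) = (\<Sum>v\<in>\<Union>G. \<Sum>w\<in>nbr G v. f (v, w))"
  unfolding arcs_eq_Sigma
  by (subst sum.Sigma) (use finite_Union_edges[OF assms] finite_nbr[OF assms] in auto)

lemma card_arcs:
  assumes "is_edge_set G"
  shows "card (arcs G) = 2 * card G"
proof -
  let ?f = "\<lambda>p::nat \<times> nat. {fst p, snd p}"
  have fin: "finite G" using assms by (simp add: is_edge_set_def)
  have *: "card {p \<in> arcs G. ?f p = e} = 2" if e: "e \<in> G" for e
  proof -
    obtain v w where vw: "e = {v, w}" "v \<noteq> w" using edge_cases[OF assms e] by metis
    have "{p \<in> arcs G. ?f p = e} = {(v, w), (w, v)}"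
      using vw e by (auto simp: arcs_def doubleton_eq_iff insert_commute)
    then show ?thesis using vw by simp
  qed
  have "card (arcs G) = (\<Sum>p\<in>arcs G. 1)" by simp
  also have "\<dots> = (\<Sum>e\<in>G. \<Sum>p\<in>{p \<in> arcs G. ?f p = e}. 1)"
    by (rule sum.group[symmetric]) (use finite_arcs[OF assms] fin in \<open>auto simp: arcs_def\<close>)
  also have "\<dots> = (\<Sum>e\<in>G. 2)" using * by simp
  finally show ?thesis by simp
qed

lemma sum_arcs_swap:
  "(\<Sum>(v, w)\<in>arcs G. f v w) = (\<Sum>(v, w)\<in>arcs G. f w v)"
  by (rule sum.reindex_bij_witness[where i="\<lambda>(v,w). (w,v)" and j="\<lambda>(v,w). (w,v)"])
     (auto simp: arcs_def insert_commute)

lemma card_arcs_swap: "card (arcs G \<inter> P \<times> P') = card (arcs G \<inter> P' \<times> P)"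
proof -
  have "bij_betw (\<lambda>(v, w). (w, v)) (arcs G \<inter> P \<times> P') (arcs G \<inter> P' \<times> P)"
    by (rule bij_betwI[where g="\<lambda>(v, w). (w, v)"]) (auto simp: arcs_def insert_commute)
  then show ?thesis by (rule bij_betw_same_card)
qed

section \<open>The adjacency quadratic form and its maximiser\<close>

definition quad :: "nat set set \<Rightarrow> (nat \<Rightarrow> real) \<Rightarrow> real" where
  "quad G y = (\<Sum>(v, w)\<in>arcs G. y v * y w)"

lemma quad_alt:
  assumes "is_edge_set G"
  shows "quad G y = (\<Sum>v\<in>\<Union>G. y v * (\<Sum>w\<in>nbr G v. y w))"
  unfolding quad_def sum_arcs[OF assms] by (simp add: sum_distrib_left)

text \<open>First variation in one coordinate; there is no term in \<open>t\<^sup>2\<close> because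
  the graph has no loops.\<close>

lemma quad_add_point:
  assumes G: "is_edge_set G" and v: "v \<in> \<Union>G"
  shows "quad G (z(v := z v + t)) = quad G z + 2 * t * (\<Sum>w\<in>nbr G v. z w)"
proof -
  let ?V = "\<Union>G"
  let ?d = "\<lambda>w. if w = v then t else 0"
  have fV: "finite ?V" using finite_Union_edges[OF G] .
  have eq: "z(v := z v + t) = (\<lambda>w. z w + ?d w)" by auto
  have a: "(\<Sum>(a, b)\<in>arcs G. ?d a * z b) = t * (\<Sum>w\<in>nbr G v. z w)"
  proof -
    have "(\<Sum>(a, b)\<in>arcs G. ?d a * z b) = (\<Sum>a\<in>?V. \<Sum>b\<in>nbr G a. ?d a * z b)"
      by (subst sum_arcs[OF G]) simp
    also have "\<dots> = (\<Sum>a\<in>?V. if a = v then t * (\<Sum>b\<in>nbr G a. z b) else 0)"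
      by (intro sum.cong) (auto simp: sum_distrib_left)
    also have "\<dots> = t * (\<Sum>w\<in>nbr G v. z w)" using fV v by simp
    finally show ?thesis .
  qed
  have b: "(\<Sum>(a, b)\<in>arcs G. z a * ?d b) = t * (\<Sum>w\<in>nbr G v. z w)"
    using sum_arcs_swap[of "\<lambda>a b. z a * ?d b" G] a by (simp add: mult.commute)
  have c: "(\<Sum>(a, b)\<in>arcs G. ?d a * ?d b) = 0"
    using no_loop[OF G, of v] by (intro sum.neutral) (auto simp: arcs_def)
  have "quad G (\<lambda>w. z w + ?d w)
      = (\<Sum>(a, b)\<in>arcs G. z a * z b + ?d a * z b + z a * ?d b + ?d a * ?d b)"
    unfolding quad_def by (intro sum.cong) (auto simp: algebra_simps)
  also have "\<dots> = quad G z + (\<Sum>(a, b)\<in>arcs G. ?d a * z b) + (\<Sum>(a, b)\<in>arcs G. z a * ?d b)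
      + (\<Sum>(a, b)\<in>arcs G. ?d a * ?d b)"
    unfolding quad_def by (simp add: sum.distrib case_prod_beta)
  finally show ?thesis unfolding eq a b c by simp
qed

text \<open>Compactness: coordinates off the vertex set are pinned to 0, which neither
  \<open>quad G\<close> nor the norm can see, so that the unit sphere sits in a product of compact
  sets and Tychonoff applies to functions on all naturals.\<close>

lemma quad_max_exists:
  assumes G: "is_edge_set G" and ne: "G \<noteq> {}"
  obtains z where "(\<Sum>v\<in>\<Union>G. (z v)\<^sup>2) = 1"
    "\<And>y. (\<Sum>v\<in>\<Union>G. (y v)\<^sup>2) = 1 \<Longrightarrow> quad G y \<le> quad G z"
proof -
  let ?V = "\<Union>G"
  have fV: "finite ?V" using finite_Union_edges[OF G] .
  obtain e where "e \<in> G" using ne by auto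
  then obtain v0 where v0: "v0 \<in> ?V" using edge_cases[OF G] by blast
  define B2 where "B2 = PiE UNIV (\<lambda>v. if v \<in> ?V then {-1..1} else {0::real})"
  define S where "S = {y \<in> B2. (\<Sum>v\<in>?V. (y v)\<^sup>2) = 1}"
  have cB: "compact B2"
  proof -
    have "compactin (product_topology (\<lambda>_. euclidean) UNIV) B2"
      unfolding B2_def by (subst compactin_PiE) (auto intro: compact_imp_closed)
    then show ?thesis by (simp add: euclidean_product_topology)
  qed
  have cont2: "continuous_on UNIV (\<lambda>y::nat \<Rightarrow> real. \<Sum>v\<in>?V. (y v)\<^sup>2)"
    by (intro continuous_intros continuous_on_product_coordinates)
  have contq: "continuous_on UNIV (quad G)"
    unfolding quad_def case_prod_beta
    by (intro continuous_intros continuous_on_product_coordinates)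
  have "closed {y::nat \<Rightarrow> real. (\<Sum>v\<in>?V. (y v)\<^sup>2) = 1}"
    by (intro closed_Collect_eq cont2 continuous_on_const)
  then have "compact (B2 \<inter> {y. (\<Sum>v\<in>?V. (y v)\<^sup>2) = 1})"
    using cB by (rule compact_Int_closed[rotated])
  then have cS: "compact S" by (simp add: S_def Int_def)
  have neS: "S \<noteq> {}"
  proof -
    have "(\<lambda>v. if v = v0 then 1 else 0) \<in> S"
      using v0 fV by (auto simp: S_def B2_def if_distrib[of "\<lambda>x. x\<^sup>2"] cong: if_cong)
    then show ?thesis by auto
  qed
  obtain z where z: "z \<in> S" "\<And>y. y \<in> S \<Longrightarrow> quad G y \<le> quad G z"
    using continuous_attains_sup[OF cS neS continuous_on_subset[OF contq subset_UNIV]] by blast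
  show ?thesis
  proof
    show "(\<Sum>v\<in>?V. (z v)\<^sup>2) = 1" using z by (simp add: S_def)
    fix y :: "nat \<Rightarrow> real" assume y: "(\<Sum>v\<in>?V. (y v)\<^sup>2) = 1"
    define y' where "y' = (\<lambda>v. if v \<in> ?V then y v else 0)"
    have "quad G y' = quad G y"
      unfolding quad_def y'_def using arcs_subset[of G] by (intro sum.cong refl) (auto dest!: subsetD)
    moreover have "y' \<in> S"
    proof -
      have "\<bar>y v\<bar> \<le> 1" if "v \<in> ?V" for v
      proof -
        have "(y v)\<^sup>2 \<le> (\<Sum>v\<in>?V. (y v)\<^sup>2)" using that fV by (intro member_le_sum) auto
        then show ?thesis using y by (simp add: abs_square_le_1)
      qed
      then have "y' \<in> B2" by (force simp: B2_def y'_def abs_le_iff)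
      moreover have "(\<Sum>v\<in>?V. (y' v)\<^sup>2) = 1" using y by (simp add: y'_def)
      ultimately show ?thesis by (simp add: S_def)
    qed
    ultimately show "quad G y \<le> quad G z" using z(2)[of y'] by simp
  qed
qed

text \<open>Stationarity without limits: \<open>t = c / d\<close> with \<open>2 * d > \<rho>\<close>
  already contradicts the bound when c is nonzero.\<close>

lemma linear_le_quadratic_imp_zero:
  fixes c \<rho> :: real
  assumes "\<And>t. 2 * t * c \<le> \<rho> * t\<^sup>2"
  shows "c = 0"
proof (rule ccontr)
  assume c: "c \<noteq> 0"
  define d where "d = \<bar>\<rho>\<bar> + 1"
  have d: "d > 0" "\<rho> < 2 * d" by (auto simp: d_def)
  have "2 * (c / d) * c \<le> \<rho> * (c / d)\<^sup>2" by (rule assms)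
  then have "2 * c\<^sup>2 / d * d\<^sup>2 \<le> \<rho> * c\<^sup>2"
    using d by (simp add: field_simps power2_eq_square)
  then have "2 * d * c\<^sup>2 \<le> \<rho> * c\<^sup>2" using d by (simp add: power2_eq_square mult_ac)
  then show False using c d by simp
qed

text \<open>Absolute values do not lower the form, so a maximiser may be taken nonnegative.
  Homogeneity turns maximality on the sphere into the Rayleigh bound, and stationarity in each
  coordinate is the eigenvector equation.\<close>

lemma perron_real:
  assumes G: "is_edge_set G" and ne: "G \<noteq> {}"
  obtains z \<rho> where "\<And>v. 0 \<le> z v" "(\<Sum>v\<in>\<Union>G. (z v)\<^sup>2) = 1"
    "\<And>v. v \<in> \<Union>G \<Longrightarrow> (\<Sum>w\<in>nbr G v. z w) = \<rho> * z v"
    "\<And>y. quad G y \<le> \<rho> * (\<Sum>v\<in>\<Union>G. (y v)\<^sup>2)"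
proof -
  let ?V = "\<Union>G"
  have fV: "finite ?V" using finite_Union_edges[OF G] .
  obtain z0 where z0: "(\<Sum>v\<in>?V. (z0 v)\<^sup>2) = 1"
    "\<And>y. (\<Sum>v\<in>?V. (y v)\<^sup>2) = 1 \<Longrightarrow> quad G y \<le> quad G z0"
    using quad_max_exists[OF G ne] by blast
  define z where "z = (\<lambda>v. \<bar>z0 v\<bar>)"
  define \<rho> where "\<rho> = quad G z"
  have z1: "(\<Sum>v\<in>?V. (z v)\<^sup>2) = 1" using z0(1) by (simp add: z_def)
  have "quad G z0 \<le> quad G z"
    unfolding quad_def z_def by (intro sum_mono) (auto simp: abs_mult[symmetric])
  then have zmax: "quad G y \<le> \<rho>" if "(\<Sum>v\<in>?V. (y v)\<^sup>2) = 1" for y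
    using z0(2)[OF that] by (simp add: \<rho>_def)
  have ray: "quad G y \<le> \<rho> * (\<Sum>v\<in>?V. (y v)\<^sup>2)" for y
  proof (cases "(\<Sum>v\<in>?V. (y v)\<^sup>2) = 0")
    case True
    then have "\<forall>v\<in>?V. y v = 0" using fV by (simp add: sum_nonneg_eq_0_iff)
    then have "quad G y = 0" unfolding quad_def using arcs_subset[of G] by (intro sum.neutral) auto
    then show ?thesis using True by simp
  next
    case False
    define c where "c = (\<Sum>v\<in>?V. (y v)\<^sup>2)"
    have c: "c > 0" using False sum_nonneg[of ?V "\<lambda>v. (y v)\<^sup>2"] by (simp add: c_def order_less_le)
    have "(\<Sum>v\<in>?V. (y v / sqrt c)\<^sup>2) = 1"
      using c by (simp add: power_divide sum_divide_distrib[symmetric] c_def[symmetric])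
    then have "quad G (\<lambda>v. y v / sqrt c) \<le> \<rho>" by (rule zmax)
    moreover have "quad G (\<lambda>v. y v / sqrt c) = quad G y / c"
      unfolding quad_def using c by (simp add: sum_divide_distrib case_prod_beta)
    ultimately show ?thesis using c by (simp add: c_def[symmetric] field_simps)
  qed
  have eig: "(\<Sum>w\<in>nbr G v. z w) = \<rho> * z v" if v: "v \<in> ?V" for v
  proof -
    have "2 * t * ((\<Sum>w\<in>nbr G v. z w) - \<rho> * z v) \<le> \<rho> * t\<^sup>2" for t
    proof -
      have "(\<Sum>w\<in>?V. ((z(v := z v + t)) w)\<^sup>2) = (\<Sum>w\<in>?V. (z w)\<^sup>2 + (if w = v then 2 * t * z v + t\<^sup>2 else 0))"
        by (intro sum.cong) (auto simp: power2_sum)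
      also have "\<dots> = 1 + 2 * t * z v + t\<^sup>2" using fV v z1 by (simp add: sum.distrib)
      finally have "quad G (z(v := z v + t)) \<le> \<rho> * (1 + 2 * t * z v + t\<^sup>2)"
        using ray[of "z(v := z v + t)"] by simp
      then show ?thesis using quad_add_point[OF G v, of z t] by (simp add: \<rho>_def[symmetric] algebra_simps)
    qed
    then have "(\<Sum>w\<in>nbr G v. z w) - \<rho> * z v = 0" by (rule linear_le_quadratic_imp_zero)
    then show ?thesis by simp
  qed
  show ?thesis by (rule that[of z \<rho>]) (use z1 eig ray in \<open>auto simp: z_def\<close>)
qed

text \<open>Links the variational \<rho> to \<open>lam\<close>, which is defined by the spectrum of
  a matrix: z is a nonzero eigenvector, and the Rayleigh bound evaluated at any other eigenvector
  caps its eigenvalue. The enumeration \<open>vs\<close> translates between indices and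
  vertices.\<close>

lemma lam_unique:
  assumes G: "is_edge_set G"
    and z: "(\<Sum>v\<in>\<Union>G. (z v)\<^sup>2) = 1"
    and eig: "\<And>v. v \<in> \<Union>G \<Longrightarrow> (\<Sum>w\<in>nbr G v. z w) = \<rho> * z v"
    and ray: "\<And>y. quad G y \<le> \<rho> * (\<Sum>v\<in>\<Union>G. (y v)\<^sup>2)"
  shows "lam G = \<rho>"
proof -
  let ?V = "\<Union>G"
  define vs where "vs = sorted_list_of_set ?V"
  define n where "n = length vs"
  have fV: "finite ?V" using finite_Union_edges[OF G] .
  have vs: "set vs = ?V" "distinct vs" using fV by (auto simp: vs_def)
  have A: "adj_matrix G = mat n n (\<lambda>(i,j). if {vs ! i, vs ! j} \<in> G then 1 else 0)"
    by (simp add: adj_matrix_def vs_def n_def Let_def)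
  have carr: "adj_matrix G \<in> carrier_mat n n" by (simp add: A)
  have bij: "bij_betw (\<lambda>i. vs ! i) {..<n} ?V"
    using vs unfolding n_def by (intro bij_betw_nth) auto
  have sumV: "(\<Sum>v\<in>?V. f v) = (\<Sum>i<n. f (vs ! i))" for f :: "nat \<Rightarrow> real"
    using sum.reindex_bij_betw[OF bij, of f] by simp
  have row: "(adj_matrix G *\<^sub>v vec n (\<lambda>j. y (vs ! j))) $ i = (\<Sum>w\<in>nbr G (vs ! i). y w)"
    if i: "i < n" for i and y :: "nat \<Rightarrow> real"
  proof -
    have "(adj_matrix G *\<^sub>v vec n (\<lambda>j. y (vs ! j))) $ i
        = (\<Sum>j<n. (if {vs ! i, vs ! j} \<in> G then 1 else 0) * y (vs ! j))"
      using i by (simp add: A scalar_prod_def lessThan_atLeast0)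
    also have "\<dots> = (\<Sum>w\<in>?V. (if {vs ! i, w} \<in> G then 1 else 0) * y w)"
      by (rule sumV[symmetric])
    also have "\<dots> = (\<Sum>w\<in>nbr G (vs ! i). y w)"
      using fV nbr_subset[of G "vs ! i"]
      by (intro sum.mono_neutral_cong_right) (auto simp: nbr_def)
    finally show ?thesis .
  qed
  have ev: "eigenvalue (adj_matrix G) \<rho>"
  proof -
    let ?w = "vec n (\<lambda>j. z (vs ! j))"
    have "?w \<noteq> 0\<^sub>v n"
    proof
      assume "?w = 0\<^sub>v n"
      then have "z (vs ! i) = 0" if "i < n" for i
        using that by (metis index_vec index_zero_vec(1))
      then have "(\<Sum>v\<in>?V. (z v)\<^sup>2) = 0" unfolding sumV by simp
      then show False using z by simp
    qed
    moreover have "adj_matrix G *\<^sub>v ?w = \<rho> \<cdot>\<^sub>v ?w"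
    proof (rule eq_vecI)
      fix i assume "i < dim_vec (\<rho> \<cdot>\<^sub>v ?w)"
      then have i: "i < n" by simp
      have "vs ! i \<in> ?V" using i vs unfolding n_def by (metis nth_mem)
      then show "(adj_matrix G *\<^sub>v ?w) $ i = (\<rho> \<cdot>\<^sub>v ?w) $ i" using row[OF i, of z] eig i by simp
    qed (use carr in simp)
    ultimately show ?thesis using carr unfolding eigenvalue_def eigenvector_def
      by (intro exI[of _ ?w]) auto
  qed
  have le: "k \<le> \<rho>" if evk: "eigenvalue (adj_matrix G) k" for k
  proof -
    obtain w where w: "w \<in> carrier_vec n" "w \<noteq> 0\<^sub>v n" "adj_matrix G *\<^sub>v w = k \<cdot>\<^sub>v w"
      using evk carr unfolding eigenvalue_def eigenvector_def by auto
    define y where "y v = w $ (inv_into {..<n} (\<lambda>i. vs ! i) v)" for v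
    have yi: "y (vs ! i) = w $ i" if "i < n" for i
      using bij that by (simp add: y_def bij_betw_def)
    have wy: "w = vec n (\<lambda>j. y (vs ! j))" using w(1) yi by (intro eq_vecI) auto
    have e: "(\<Sum>a\<in>nbr G v. y a) = k * y v" if v: "v \<in> ?V" for v
    proof -
      obtain i where i: "i < n" "v = vs ! i" using v vs unfolding n_def by (metis in_set_conv_nth)
      have "(\<Sum>a\<in>nbr G v. y a) = (k \<cdot>\<^sub>v w) $ i" using row[OF i(1), of y] w(3) i(2) wy by metis
      also have "\<dots> = k * y v" using i w(1) yi by simp
      finally show ?thesis .
    qed
    have "quad G y = k * (\<Sum>v\<in>?V. (y v)\<^sup>2)"
      unfolding quad_alt[OF G] by (simp add: e sum_distrib_left power2_eq_square algebra_simps)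
    moreover have "(\<Sum>v\<in>?V. (y v)\<^sup>2) > 0"
    proof (rule ccontr)
      assume "\<not> ?thesis"
      then have "(\<Sum>v\<in>?V. (y v)\<^sup>2) = 0"
        using sum_nonneg[of ?V "\<lambda>v. (y v)\<^sup>2"] by force
      then have "\<forall>v\<in>?V. y v = 0" using fV by (simp add: sum_nonneg_eq_0_iff)
      then have "y (vs ! i) = 0" if "i < n" for i
        using that vs unfolding n_def by (metis nth_mem)
      then have "w = 0\<^sub>v n" using wy by (metis (mono_tags, lifting) eq_vecI dim_vec index_vec index_zero_vec)
      then show False using w by simp
    qed
    ultimately show ?thesis using ray[of y] by simp
  qed
  have fin: "finite {k. eigenvalue (adj_matrix G) k}"
    using card_finite_spectrum(1)[OF carr] by (simp add: spectrum_def)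
  show ?thesis unfolding lam_def by (rule Max_eqI) (use fin ev le in auto)
qed

section \<open>Rayleigh bound and normalised Perron vector\<close>

lemma lam_rayleigh:
  assumes "is_edge_set G" "G \<noteq> {}"
  shows "quad G y \<le> lam G * (\<Sum>v\<in>\<Union>G. (y v)\<^sup>2)"
proof -
  obtain z \<rho> where "\<And>v. (0::real) \<le> z v" and z: "(\<Sum>v\<in>\<Union>G. (z v)\<^sup>2) = 1"
    "\<And>v. v \<in> \<Union>G \<Longrightarrow> (\<Sum>w\<in>nbr G v. z w) = \<rho> * z v"
    "\<And>y. quad G y \<le> \<rho> * (\<Sum>v\<in>\<Union>G. (y v)\<^sup>2)"
    by (rule perron_real[OF assms], rule that)
  show ?thesis using lam_unique[OF assms(1) z] z(3) by simp
qed

text \<open>The vector is scaled to maximal entry 1 rather than norm 1 and extended by 0, so that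
  the eigenvector equation holds at every natural number.\<close>

lemma lam_perron_vector:
  assumes G: "is_edge_set G" "G \<noteq> {}"
  obtains x u where "\<And>v. 0 \<le> x v" "\<And>v. x v \<le> 1" "u \<in> \<Union>G" "x u = 1"
    "\<And>v. lam G * x v = (\<Sum>w\<in>nbr G v. x w)"
proof -
  let ?V = "\<Union>G"
  have fV: "finite ?V" using finite_Union_edges[OF G(1)] .
  obtain z \<rho> where z: "\<And>v. 0 \<le> z v" "(\<Sum>v\<in>?V. (z v)\<^sup>2) = 1"
    "\<And>v. v \<in> ?V \<Longrightarrow> (\<Sum>w\<in>nbr G v. z w) = \<rho> * z v"
    "\<And>y. quad G y \<le> \<rho> * (\<Sum>v\<in>?V. (y v)\<^sup>2)"
    by (rule perron_real[OF G], rule that)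
  have lam: "lam G = \<rho>" using lam_unique[OF G(1) z(2) z(3) z(4)] by blast
  have neV: "?V \<noteq> {}" using z(2) by (metis sum.empty zero_neq_one)
  define c where "c = Max (z ` ?V)"
  have "c \<in> z ` ?V" unfolding c_def using fV neV by (intro Max_in) auto
  then obtain u where u: "u \<in> ?V" "z u = c" by blast
  have zc: "z v \<le> c" if "v \<in> ?V" for v unfolding c_def using fV that by simp
  have c: "c > 0"
  proof (rule ccontr)
    assume "\<not> c > 0"
    then have "\<forall>v\<in>?V. z v = 0" using zc z(1) by (metis dual_order.trans le_less_linear order_antisym)
    then have "(\<Sum>v\<in>?V. (z v)\<^sup>2) = 0" by (intro sum.neutral) simp
    then show False using z(2) by simp
  qed
  define x where "x v = (if v \<in> ?V then z v / c else 0)" for v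
  show ?thesis
  proof
    show "0 \<le> x v" for v using z(1) c by (simp add: x_def)
    show "x v \<le> 1" for v using zc c by (simp add: x_def)
    show "u \<in> ?V" "x u = 1" using u c by (auto simp: x_def)
    fix v
    have s: "(\<Sum>w\<in>nbr G v. x w) = (\<Sum>w\<in>nbr G v. z w) / c"
      using nbr_subset[of G v] unfolding sum_divide_distrib by (intro sum.cong) (auto simp: x_def)
    show "lam G * x v = (\<Sum>w\<in>nbr G v. x w)"
    proof (cases "v \<in> ?V")
      case True
      then show ?thesis unfolding s using z(3)[OF True] lam by (simp add: x_def)
    next
      case False
      then show ?thesis using nbr_empty[OF False] by (simp add: x_def)
    qed
  qed
qed

section \<open>Losses along two-step walks and sparse neighbourhoods\<close>

text \<open>Kovari--Sos--Turan for a bounded side: classify the vertices of \<open>S\<close> by their neighbourhood in \<open>T\<close>;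
  only \<open>2 ^ card T\<close> classes are available.\<close>

lemma complete_pair_of_dense:
  fixes nb :: "'a \<Rightarrow> 'b set" and k :: nat and c L :: real
  assumes fS: "finite S" and fT: "finite T" and k: "k \<ge> 1"
    and L: "real (card S) \<le> L" and c: "c > 0"
    and deg: "\<And>t. t \<in> T \<Longrightarrow> c * L \<le> real (card (nb t \<inter> S))"
    and q: "2 * real k \<le> real (card T) * c"
    and big: "real k * 2 ^ (card T + 1) \<le> c * L"
  obtains U S' where "U \<subseteq> T" "S' \<subseteq> S" "card U = k" "card S' = k" "\<And>t s. t \<in> U \<Longrightarrow> s \<in> S' \<Longrightarrow> s \<in> nb t"
proof -
  define q where "q = card T"
  have q0: "real q > 0"
  proof (rule ccontr)
    assume "\<not> 0 < real q"
    then have "q = 0" by simp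
    then show False using assms(7) k by (simp add: q_def)
  qed
  define f where "f s = {t\<in>T. s \<in> nb t}" for s
  define S1 where "S1 = {s\<in>S. k \<le> card (f s)}"
  have fS1: "finite S1" using fS by (simp add: S1_def)
  have cf: "card (f s) \<le> q" for s unfolding f_def q_def using fT by (intro card_mono) auto
  have "(\<Sum>t\<in>T. real (card (nb t \<inter> S))) = (\<Sum>t\<in>T. \<Sum>s\<in>S. if s \<in> nb t then 1 else 0)"
    using fS by (intro sum.cong) (auto simp: sum.If_cases Int_commute)
  also have "\<dots> = (\<Sum>s\<in>S. \<Sum>t\<in>T. if s \<in> nb t then 1 else 0)" by (rule sum.swap)
  also have "\<dots> = (\<Sum>s\<in>S. real (card (f s)))"
    using fT by (intro sum.cong) (auto simp: sum.If_cases f_def Int_def)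
  finally have dbl: "(\<Sum>t\<in>T. real (card (nb t \<inter> S))) = (\<Sum>s\<in>S. real (card (f s)))" .
  have "real q * (c * L) \<le> (\<Sum>t\<in>T. real (card (nb t \<inter> S)))"
    using sum_bounded_below[of T "c * L" "\<lambda>t. real (card (nb t \<inter> S))"] deg by (simp add: q_def)
  also have "\<dots> \<le> (\<Sum>s\<in>S. real k + (if s \<in> S1 then real q else 0))"
    unfolding dbl
  proof (rule sum_mono)
    fix s assume "s \<in> S"
    then show "real (card (f s)) \<le> real k + (if s \<in> S1 then real q else 0)"
      using cf[of s] by (auto simp: S1_def)
  qed
  also have "\<dots> = real k * real (card S) + real q * real (card S1)"
  proof -
    have "S \<inter> S1 = S1" by (auto simp: S1_def)
    then show ?thesis using fS by (simp add: sum.distrib sum.If_cases)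
  qed
  also have "\<dots> \<le> real k * L + real q * real (card S1)" using L by (simp add: mult_left_mono)
  finally have 1: "real q * (c * L) \<le> real k * L + real q * real (card S1)" .
  have L0: "L \<ge> 0" using L by (meson of_nat_0_le_iff order_trans)
  \<comment> \<open>The baseline of k per vertex of S accounts for at most half of the incidences,
    so the vertices with at least k neighbours in T carry the other half.\<close>
  have "2 * real k * L \<le> real q * c * L" using q L0 unfolding q_def by (intro mult_right_mono)
  then have "real q * (c * L) \<le> real q * (2 * real (card S1))" using 1 by (simp add: algebra_simps)
  then have "c * L \<le> 2 * real (card S1)" using q0 by simp
  then have "real k * 2 ^ (q + 1) \<le> 2 * real (card S1)" using big unfolding q_def by linarith
  then have "real (k * 2 ^ q) \<le> real (card S1)" by simp
  then have S1: "k * 2 ^ q \<le> card S1" by (simp only: of_nat_le_iff)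
  have "\<exists>U0\<in>Pow T. k \<le> card {s\<in>S1. f s = U0}"
  proof (rule ccontr)
    assume "\<not> ?thesis"
    then have none: "\<forall>U0\<in>Pow T. \<not> k \<le> card {s\<in>S1. f s = U0}" by blast
    have less: "card {s\<in>S1. f s = U0} \<le> k - 1" if "U0 \<in> Pow T" for U0
      using bspec[OF none that] by linarith
    have "card S1 = (\<Sum>U0\<in>Pow T. \<Sum>s\<in>{s\<in>S1. f s = U0}. 1)"
    proof -
      have "f ` S1 \<subseteq> Pow T" by (auto simp: f_def)
      then show ?thesis using sum.group[of S1 "Pow T" f "\<lambda>_. 1::nat"] fS1 fT by simp
    qed
    also have "\<dots> \<le> (\<Sum>U0\<in>Pow T. k - 1)" using less by (intro sum_mono) simp
    also have "\<dots> = 2 ^ q * (k - 1)" using fT by (simp add: card_Pow q_def)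
    also have "\<dots> < k * 2 ^ q" using k by simp
    finally show False using S1 by simp
  qed
  then obtain U0 where U0: "U0 \<subseteq> T" "k \<le> card {s\<in>S1. f s = U0}" by auto
  obtain S' where S': "S' \<subseteq> {s\<in>S1. f s = U0}" "card S' = k"
    using obtain_subset_with_card_n[OF U0(2)] by metis
  have "S' \<noteq> {}" using S' k by auto
  then obtain s0 where "s0 \<in> S'" by auto
  then have "k \<le> card U0" using S'(1) by (auto simp: S1_def)
  then obtain U where U: "U \<subseteq> U0" "card U = k" using obtain_subset_with_card_n by metis
  show ?thesis
    by (rule that[of U S']) (use U U0 S' in \<open>auto simp: S1_def f_def\<close>)
qed

text \<open>No complete bipartite graph with parts of size \<open>k\<close> plus one edge inside a part; for \<open>k = v(F)\<close> this is the
  only consequence of \<open>F\<close>-freeness needed away from the core.\<close>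

definition Kplus_free :: "nat set set \<Rightarrow> nat \<Rightarrow> bool" where
  "Kplus_free G k \<longleftrightarrow> (\<nexists>S T v w. card S = k \<and> card T = k \<and> v \<in> S \<and> w \<in> S \<and> {v, w} \<in> G
     \<and> (\<forall>s\<in>S. \<forall>t\<in>T. {s, t} \<in> G))"

text \<open>Larger parts are trimmed to size exactly k, keeping v and w on their side.\<close>

lemma Kplus_freeD:
  assumes "Kplus_free G k" and G: "is_edge_set G" and k: "2 \<le> k"
    and S: "finite S" "k \<le> card S" and T: "k \<le> card T"
    and vw: "v \<in> S" "w \<in> S" "{v, w} \<in> G" and all: "\<And>s t. s \<in> S \<Longrightarrow> t \<in> T \<Longrightarrow> {s, t} \<in> G"
  shows False
proof -
  have ne: "v \<noteq> w" using vw(3) no_loop[OF G] by auto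
  have "card (S - {v, w}) = card S - 2" using vw ne S by (simp add: card_Diff_subset)
  then have "k - 2 \<le> card (S - {v, w})" using S by simp
  then obtain R where R: "R \<subseteq> S - {v, w}" "card R = k - 2" "finite R"
    using obtain_subset_with_card_n by metis
  have "R \<inter> {v, w} = {}" using R by auto
  then have 1: "card (R \<union> {v, w}) = k" using R ne k by (subst card_Un_disjoint) auto
  obtain T' where T': "T' \<subseteq> T" "card T' = k" using obtain_subset_with_card_n[OF T] by metis
  have "\<forall>s\<in>R \<union> {v, w}. \<forall>t\<in>T'. {s, t} \<in> G" using all R T' vw by blast
  then show False using assms(1) 1 T'(2) vw(3) unfolding Kplus_free_def by blast
qed

text \<open>Extremality enters here only through \<open>rho_sq\<close>; beyond that it returns later
  by comparison with explicit competitors.\<close>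

locale perron_graph =
  fixes G :: "nat set set" and x :: "nat \<Rightarrow> real" and \<rho> :: real and u :: nat
  assumes G: "is_edge_set G" and x0: "\<And>v. 0 \<le> x v" and x1: "\<And>v. x v \<le> 1" and xu: "x u = 1"
    and eig: "\<And>v. \<rho> * x v = (\<Sum>w\<in>nbr G v. x w)"
    and rho_sq: "real (card G) \<le> \<rho>\<^sup>2" and rho0: "0 < \<rho>"
begin

abbreviation "m \<equiv> real (card G)"

lemma finV: "finite (\<Union>G)" by (rule finite_Union_edges[OF G])
lemma finN: "finite (nbr G v)" by (rule finite_nbr[OF G])
lemma finA: "finite (arcs G)" by (rule finite_arcs[OF G])
lemma card_arcs': "real (card (arcs G)) = 2 * m" using card_arcs[OF G] by simp

lemma u_in_V: "u \<in> \<Union>G"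
proof (rule ccontr)
  assume "u \<notin> \<Union>G"
  then show False using eig[of u] nbr_empty[of u G] xu rho0 by simp
qed

lemma x_outside: "v \<notin> \<Union>G \<Longrightarrow> x v = 0"
  using eig[of v] nbr_empty[of v G] rho0 by simp

lemma sum_nbr_le: "(\<Sum>w\<in>nbr G v. x w) \<le> \<rho>"
  unfolding eig[symmetric] using x1[of v] rho0 by (simp add: mult_left_le)

lemma sum_sub_nbr_le: "S \<subseteq> nbr G v \<Longrightarrow> (\<Sum>w\<in>S. x w) \<le> \<rho>"
  using sum_mono2[OF finN, of S v x] x0 sum_nbr_le[of v] by (meson order_trans)

lemma rho_x_le_deg: "\<rho> * x v \<le> real (card (nbr G v))"
  unfolding eig using sum_bounded_above[of "nbr G v" x 1] x1 by simp

text \<open>Counting two-step walks from \<open>w\<close>, an edge \<open>vz\<close> contributes \<open>1 - loss w (v, z)\<close> to \<open>\<rho>\<^sup>2 x\<^sub>w\<close>. The contribution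
  exceeds 1 only for edges inside the neighbourhood of \<open>w\<close>; \<open>excess\<close> is the total overshoot. Sums run over arcs,
  so every edge is counted twice.\<close>

definition loss :: "nat \<Rightarrow> nat \<times> nat \<Rightarrow> real" where
  "loss w p = 1 - (if fst p \<in> nbr G w then x (snd p) else 0) - (if snd p \<in> nbr G w then x (fst p) else 0)"

definition excess :: "nat \<Rightarrow> real" where
  "excess w = (\<Sum>(v, z)\<in>arcs G \<inter> nbr G w \<times> nbr G w. max 0 (x v + x z - 1))"

text \<open>Apply the eigenvector equation twice and index a walk w, v, z by its second arc (v,
  z).\<close>

lemma sum_two_walks:
  "(\<Sum>p\<in>arcs G. if fst p \<in> nbr G w then x (snd p) else 0) = \<rho>\<^sup>2 * x w"
proof -
  have "(\<Sum>p\<in>arcs G. if fst p \<in> nbr G w then x (snd p) else 0)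
      = (\<Sum>v\<in>\<Union>G. \<Sum>z\<in>nbr G v. if v \<in> nbr G w then x z else 0)"
    by (subst sum_arcs[OF G]) (simp only: fst_conv snd_conv)
  also have "\<dots> = (\<Sum>v\<in>\<Union>G. if v \<in> nbr G w then \<rho> * x v else 0)"
    by (intro sum.cong) (auto simp: eig)
  also have "\<dots> = (\<Sum>v\<in>nbr G w. \<rho> * x v)"
    using finV nbr_subset[of G w] by (intro sum.mono_neutral_cong_right) auto
  also have "\<dots> = \<rho>\<^sup>2 * x w"
    by (simp add: sum_distrib_left[symmetric] eig[symmetric] power2_eq_square)
  finally show ?thesis .
qed

lemma sum_loss: "(\<Sum>p\<in>arcs G. loss w p) = 2 * m - 2 * \<rho>\<^sup>2 * x w"
proof -
  have "(\<Sum>p\<in>arcs G. if snd p \<in> nbr G w then x (fst p) else 0)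
      = (\<Sum>p\<in>arcs G. if fst p \<in> nbr G w then x (snd p) else 0)"
    using sum_arcs_swap[of "\<lambda>a b. if b \<in> nbr G w then x a else 0" G] by (simp add: case_prod_beta)
  then have "(\<Sum>p\<in>arcs G. loss w p) = real (card (arcs G)) - \<rho>\<^sup>2 * x w - \<rho>\<^sup>2 * x w"
    unfolding loss_def sum_subtractf using sum_two_walks[of w] by simp
  then show ?thesis using card_arcs' by simp
qed

lemma excess_nonneg: "0 \<le> excess w"
  unfolding excess_def by (intro sum_nonneg) auto

text \<open>Negative losses occur only inside the neighbourhood of w and total exactly
  \<open>- excess w\<close>, so the positive losses total
  \<open>2 * m - 2 * \<rho>\<^sup>2 * x w + excess w\<close>. The later bounds on the number of bad
  arcs come from this.\<close>

lemma budget_sum: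
  assumes T: "T \<subseteq> arcs G" and pos: "\<And>p. p \<in> T \<Longrightarrow> f p \<le> max 0 (loss w p)"
  shows "(\<Sum>p\<in>T. f p) \<le> 2 * m - 2 * \<rho>\<^sup>2 * x w + excess w"
proof -
  have ex: "(\<Sum>p\<in>arcs G. max 0 (- loss w p)) = excess w"
    unfolding excess_def
  proof (rule sum.mono_neutral_cong_right)
    show "\<forall>p\<in>arcs G - arcs G \<inter> nbr G w \<times> nbr G w. max 0 (- loss w p) = 0"
      using x1 by (auto simp: loss_def)
  qed (use finA in \<open>auto simp: loss_def algebra_simps\<close>)
  have "(\<Sum>p\<in>T. f p) \<le> (\<Sum>p\<in>T. max 0 (loss w p))" using pos by (rule sum_mono)
  also have "\<dots> \<le> (\<Sum>p\<in>arcs G. max 0 (loss w p))" using T finA by (intro sum_mono2) auto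
  also have "\<dots> = (\<Sum>p\<in>arcs G. loss w p + max 0 (- loss w p))" by (intro sum.cong) auto
  also have "\<dots> = 2 * m - 2 * \<rho>\<^sup>2 * x w + excess w" by (simp add: sum.distrib sum_loss ex)
  finally show ?thesis .
qed

lemma budget:
  assumes "T \<subseteq> arcs G" and "\<And>p. p \<in> T \<Longrightarrow> c \<le> loss w p"
  shows "c * real (card T) \<le> 2 * m - 2 * \<rho>\<^sup>2 * x w + excess w"
  using budget_sum[OF assms(1), of "\<lambda>_. c" w] assms(2) by (force simp: mult.commute)

lemma budget_u:
  assumes "T \<subseteq> arcs G" and "\<And>p. p \<in> T \<Longrightarrow> c \<le> loss u p"
  shows "c * real (card T) \<le> excess u"
  using budget[OF assms] xu rho_sq by simp

lemma budget_high:
  assumes "T \<subseteq> arcs G" and "\<And>p. p \<in> T \<Longrightarrow> c \<le> loss w p"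
  shows "c * real (card T) \<le> 2 * m * (1 - x w) + excess w"
proof -
  have "m * x w \<le> \<rho>\<^sup>2 * x w" using rho_sq x0 by (intro mult_right_mono)
  then show ?thesis using budget[OF assms] by (simp add: algebra_simps)
qed

text \<open>Markov's inequality, since the entries around w sum to at most \<rho>.\<close>

lemma card_heavy_nbrs:
  assumes "0 < \<tau>"
  shows "real (card {v\<in>nbr G w. \<tau> \<le> x v}) \<le> \<rho> / \<tau>"
proof -
  have "\<tau> * real (card {v\<in>nbr G w. \<tau> \<le> x v}) \<le> (\<Sum>v\<in>{v\<in>nbr G w. \<tau> \<le> x v}. x v)"
    using sum_bounded_below[of "{v\<in>nbr G w. \<tau> \<le> x v}" \<tau> x] by (simp add: mult.commute)
  also have "\<dots> \<le> \<rho>" by (rule sum_sub_nbr_le[where v=w]) auto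
  finally show ?thesis using assms by (simp add: field_simps)
qed

text \<open>The budget of the empty set of arcs is still nonnegative.\<close>

lemma rho_sq_le: "\<rho>\<^sup>2 \<le> m + excess u / 2"
  using budget[of "{}" 0 u] xu by simp

end

section \<open>Excess and heavy neighbourhoods without large complete bipartite graphs\<close>

locale Kfree_perron_graph = perron_graph +
  fixes k :: nat
  assumes Kfree: "Kplus_free G k" and k2: "2 \<le> k"
begin

text \<open>Among q such neighbours of w the pigeonhole lemma finds a complete pair U, S' with both
  parts inside the neighbourhood of w. Adding w to U keeps it complete to S' and creates the
  forbidden edge from w to a member of U.\<close>

lemma few_dense_nbrs:
  assumes S: "S \<subseteq> nbr G w" and L: "real (card S) \<le> L" and c: "c > 0"
    and q: "2 * real k \<le> real q * c" and big: "real k * 2 ^ (q + 1) \<le> c * L"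
  shows "card {t\<in>nbr G w. c * L \<le> real (card (nbr G t \<inter> S))} < q"
proof (rule ccontr)
  assume "\<not> ?thesis"
  then have "q \<le> card {t\<in>nbr G w. c * L \<le> real (card (nbr G t \<inter> S))}" by simp
  then obtain T where T: "T \<subseteq> {t\<in>nbr G w. c * L \<le> real (card (nbr G t \<inter> S))}" "card T = q" "finite T"
    by (rule obtain_subset_with_card_n)
  have fS: "finite S" using S finN finite_subset by metis
  have k1: "1 \<le> k" using k2 by simp
  have deg: "c * L \<le> real (card (nbr G t \<inter> S))" if "t \<in> T" for t using T(1) that by blast
  obtain U S' where U: "U \<subseteq> T" "S' \<subseteq> S" "card U = k" "card S' = k"
    "\<And>t s. t \<in> U \<Longrightarrow> s \<in> S' \<Longrightarrow> s \<in> nbr G t"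
    by (rule complete_pair_of_dense[OF fS T(3) k1 L c deg q[folded T(2)] big[folded T(2)]]) (assumption | rule that)+
  have "U \<noteq> {}" using U k2 by auto
  then obtain t where t: "t \<in> U" by auto
  have fU: "finite U" using U T finite_subset by metis
  have "k \<le> card (insert w U)" using U(3) fU by (simp add: card_insert_if)
  moreover have "{w, t} \<in> G" using t U T by (auto simp: nbr_def)
  moreover have "{s, r} \<in> G" if "s \<in> insert w U" "r \<in> S'" for s r
    using that U S by (auto simp: nbr_def)
  ultimately show False
    using Kplus_freeD[OF Kfree G k2, of "insert w U" S' w t] fU U t by auto
qed

text \<open>Fewer than q vertices are dense to S, and each of them costs at most L; every other z
  costs at most \<open>y z * (c * L)\<close>. The weights are kept general: entries of x for the
  excess, ones for counting arcs.\<close>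

lemma weighted_codegree_le:
  assumes S: "S \<subseteq> nbr G w" and Z: "Z \<subseteq> nbr G w" and L: "real (card S) \<le> L" and c: "c > 0"
    and q: "2 * real k \<le> real q * c" and big: "real k * 2 ^ (q + 1) \<le> c * L"
    and y: "\<And>z. 0 \<le> y z" "\<And>z. y z \<le> 1" and M: "(\<Sum>z\<in>Z. y z) \<le> M"
  shows "(\<Sum>z\<in>Z. y z * real (card (nbr G z \<inter> S))) \<le> M * (c * L) + real q * L"
proof -
  define T where "T = {t\<in>nbr G w. c * L \<le> real (card (nbr G t \<inter> S))}"
  have cT: "card T < q" unfolding T_def by (rule few_dense_nbrs[OF S L c q big])
  have fS: "finite S" and fZ: "finite Z" using S Z finN finite_subset by metis+
  have fT: "finite T" using finN by (simp add: T_def)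
  have L0: "0 \<le> L" using L by (meson of_nat_0_le_iff order_trans)
  have cs: "real (card (nbr G z \<inter> S)) \<le> L" for z
    using card_mono[OF fS, of "nbr G z \<inter> S"] L by simp
  have "(\<Sum>z\<in>Z. y z * real (card (nbr G z \<inter> S))) \<le> (\<Sum>z\<in>Z. y z * (c * L) + (if z \<in> T then L else 0))"
  proof (rule sum_mono)
    fix z assume z: "z \<in> Z"
    show "y z * real (card (nbr G z \<inter> S)) \<le> y z * (c * L) + (if z \<in> T then L else 0)"
    proof (cases "z \<in> T")
      case True
      have "y z * real (card (nbr G z \<inter> S)) \<le> 1 * L" using y cs L0 by (intro mult_mono) auto
      moreover have "0 \<le> y z * (c * L)" using y c L0 by simp
      ultimately show ?thesis using True by simp
    next
      case False
      then have "real (card (nbr G z \<inter> S)) \<le> c * L" using z Z by (auto simp: T_def)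
      then show ?thesis using False y by (simp add: mult_left_mono)
    qed
  qed
  also have "\<dots> = (\<Sum>z\<in>Z. y z) * (c * L) + real (card (Z \<inter> T)) * L"
    using fZ by (simp add: sum.distrib sum_distrib_right sum.If_cases)
  also have "\<dots> \<le> M * (c * L) + real q * L"
  proof (rule add_mono)
    show "(\<Sum>z\<in>Z. y z) * (c * L) \<le> M * (c * L)" using M c L0 by (intro mult_right_mono) auto
    have "card (Z \<inter> T) \<le> q" using card_mono[OF fT, of "Z \<inter> T"] cT by simp
    then show "real (card (Z \<inter> T)) * L \<le> real q * L" using L0 by (intro mult_right_mono) auto
  qed
  finally show ?thesis .
qed

text \<open>An overshooting arc has an end v with entry at least 1/2, and then the overshoot is at
  most the entry of the other end. By Markov there are at most \<open>2 * \<rho>\<close> such v, so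
  the weighted codegree bound applies with this set as S. As c may be chosen arbitrarily small, the
  excess is o(m).\<close>

lemma excess_le:
  assumes c: "c > 0" and q: "2 * real k \<le> real q * c" and big: "real k * 2 ^ (q + 1) \<le> c * (2 * \<rho>)"
  shows "excess w \<le> 4 * c * \<rho>\<^sup>2 + 4 * real q * \<rho>"
proof -
  define S where "S = {v\<in>nbr G w. 1 / 2 \<le> x v}"
  let ?N = "nbr G w"
  have S: "S \<subseteq> ?N" by (auto simp: S_def)
  have fS: "finite S" using finN by (simp add: S_def)
  have L: "real (card S) \<le> 2 * \<rho>" using card_heavy_nbrs[of "1/2" w] by (simp add: S_def)
  have Q: "(\<Sum>z\<in>?N. x z * real (card (nbr G z \<inter> S))) \<le> \<rho> * (c * (2 * \<rho>)) + real q * (2 * \<rho>)"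
    by (rule weighted_codegree_le[OF S subset_refl L c q big x0 x1 sum_nbr_le])
  let ?A = "arcs G \<inter> ?N \<times> ?N"
  have fA: "finite ?A" using finA by simp
  have A_eq: "?A = Sigma ?N (\<lambda>z. nbr G z \<inter> ?N)" by (auto simp: arcs_def nbr_def)
  have Q2: "(\<Sum>(z, v)\<in>?A. if v \<in> S then x z else 0) = (\<Sum>z\<in>?N. x z * real (card (nbr G z \<inter> S)))"
  proof -
    have "(\<Sum>(z, v)\<in>?A. if v \<in> S then x z else 0) = (\<Sum>z\<in>?N. \<Sum>v\<in>nbr G z \<inter> ?N. if v \<in> S then x z else 0)"
      unfolding A_eq by (subst sum.Sigma) (use finN in auto)
    also have "\<dots> = (\<Sum>z\<in>?N. x z * real (card (nbr G z \<inter> S)))"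
    proof (intro sum.cong refl)
      fix z
      have "nbr G z \<inter> ?N \<inter> S = nbr G z \<inter> S" using S by auto
      then show "(\<Sum>v\<in>nbr G z \<inter> ?N. if v \<in> S then x z else 0) = x z * real (card (nbr G z \<inter> S))"
        using finN by (simp add: sum.If_cases)
    qed
    finally show ?thesis .
  qed
  have Q3: "(\<Sum>(v, z)\<in>?A. if v \<in> S then x z else 0) = (\<Sum>(z, v)\<in>?A. if v \<in> S then x z else 0)"
    by (rule sum.reindex_bij_witness[where i="\<lambda>(v,w). (w,v)" and j="\<lambda>(v,w). (w,v)"])
       (auto simp: arcs_def insert_commute)
  have "excess w \<le> (\<Sum>(v, z)\<in>?A. (if v \<in> S then x z else 0) + (if z \<in> S then x v else 0))"
    unfolding excess_def
  proof (intro sum_mono, clarify)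
    fix v z assume "(v, z) \<in> arcs G" "v \<in> ?N" "z \<in> ?N"
    then show "max 0 (x v + x z - 1) \<le> (if v \<in> S then x z else 0) + (if z \<in> S then x v else 0)"
      using x0[of v] x0[of z] x1[of v] x1[of z] by (auto simp: S_def)
  qed
  also have "\<dots> = 2 * (\<Sum>z\<in>?N. x z * real (card (nbr G z \<inter> S)))"
    using Q2 Q3 by (simp add: sum.distrib case_prod_beta)
  finally show ?thesis using Q by (simp add: power2_eq_square algebra_simps)
qed

lemma heavy_nbr_arcs_le:
  fixes w :: nat
  assumes \<epsilon>: "0 < \<epsilon>" and c: "c > 0" and q: "2 * real k \<le> real q * c"
    and big: "real k * 2 ^ (q + 1) \<le> c * (\<rho> / \<epsilon>)"
  defines "N1 \<equiv> {v\<in>nbr G w. \<epsilon> \<le> x v}"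
  shows "real (card (arcs G \<inter> N1 \<times> N1)) \<le> c * (\<rho> / \<epsilon>)\<^sup>2 + real q * (\<rho> / \<epsilon>)"
proof -
  have N1: "N1 \<subseteq> nbr G w" by (auto simp: N1_def)
  have fN1: "finite N1" using finN by (simp add: N1_def)
  have L: "real (card N1) \<le> \<rho> / \<epsilon>" unfolding N1_def by (rule card_heavy_nbrs[OF \<epsilon>])
  have "arcs G \<inter> N1 \<times> N1 = Sigma N1 (\<lambda>z. nbr G z \<inter> N1)" by (auto simp: arcs_def nbr_def)
  then have "real (card (arcs G \<inter> N1 \<times> N1)) = (\<Sum>z\<in>N1. 1 * real (card (nbr G z \<inter> N1)))"
    using fN1 by (simp add: card_SigmaI)
  also have "\<dots> \<le> \<rho> / \<epsilon> * (c * (\<rho> / \<epsilon>)) + real q * (\<rho> / \<epsilon>)"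
    by (rule weighted_codegree_le[OF N1 N1 L c q big]) (use L in auto)
  finally show ?thesis by (simp add: power2_eq_square algebra_simps)
qed

end

section \<open>The families of forbidden and admissible cores\<close>

text \<open>Used to place the one non-bipartite edge of F on a given edge of the host.\<close>

lemma inj_on_prescribed_two:
  assumes fP: "finite P" and fS: "finite S" and le: "card P \<le> card S"
    and ab: "a \<in> P" "b \<in> P" "a \<noteq> b" and vw: "v \<in> S" "w \<in> S" "v \<noteq> w"
  obtains f where "f ` P \<subseteq> S" "inj_on f P" "f a = v" "f b = w"
proof -
  have "card (P - {a, b}) = card P - 2" "card (S - {v, w}) = card S - 2"
    using assms by (simp_all add: card_Diff_subset)
  then have "card (P - {a, b}) \<le> card (S - {v, w})" using le by simp
  then obtain g where g: "g ` (P - {a, b}) \<subseteq> S - {v, w}" "inj_on g (P - {a, b})"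
    using inj_on_iff_card_le[of "P - {a, b}" "S - {v, w}"] fP fS by auto
  define f where "f = g(a := v, b := w)"
  have "f ` P \<subseteq> S" using g(1) vw by (auto simp: f_def image_subset_iff)
  moreover have "inj_on f P"
  proof (rule inj_onI)
    fix p p' assume p: "p \<in> P" "p' \<in> P" "f p = f p'"
    have g': "g z \<noteq> v \<and> g z \<noteq> w" if "z \<in> P" "z \<noteq> a" "z \<noteq> b" for z using g(1) that by auto
    show "p = p'"
      using p g' vw(3) ab(3) inj_onD[OF g(2), of p p'] unfolding f_def
      by (auto split: if_splits; metis)
  qed
  moreover have "f a = v" "f b = w" using ab by (auto simp: f_def)
  ultimately show ?thesis using that by blast
qed

lemma almost_bipartite_parts:
  assumes EF: "is_edge_set EF" and ab: "almost_bipartite EF"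
  obtains P e0 where "P \<subseteq> \<Union>EF"
    "\<And>e. e \<in> EF \<Longrightarrow> e \<noteq> e0 \<Longrightarrow> \<exists>p r. e = {p, r} \<and> p \<in> P \<and> r \<in> \<Union>EF - P"
    "e0 \<in> EF \<Longrightarrow> (\<exists>p r. e0 = {p, r} \<and> p \<in> P \<and> r \<in> \<Union>EF - P) \<or> e0 \<subseteq> P"
proof -
  obtain e0 X where X: "\<And>e. e \<in> EF - {e0} \<Longrightarrow> card (e \<inter> X) = 1"
    using ab unfolding almost_bipartite_def bipartite_edges_def by blast
  \<comment> \<open>If the removed edge avoids X the sides are exchanged, so that an edge inside a
    side always lies in P.\<close>
  define P where "P = (if e0 \<in> EF \<and> e0 \<inter> X = {} then \<Union>EF - X else \<Union>EF \<inter> X)"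
  have split: "\<exists>p r. e = {p, r} \<and> p \<in> X \<and> r \<notin> X \<and> p \<in> \<Union>EF \<and> r \<in> \<Union>EF"
    if e: "e \<in> EF" "card (e \<inter> X) = 1" for e
  proof -
    obtain v w where vw: "e = {v, w}" "v \<noteq> w" using edge_cases[OF EF e(1)] by metis
    have V: "v \<in> \<Union>EF" "w \<in> \<Union>EF" using e vw by auto
    have "\<not> (v \<in> X \<and> w \<in> X)"
    proof
      assume "v \<in> X \<and> w \<in> X"
      then have "e \<inter> X = {v, w}" using vw by auto
      then show False using e(2) vw by simp
    qed
    moreover have "v \<in> X \<or> w \<in> X"
    proof (rule ccontr)
      assume "\<not> ?thesis"
      then have "e \<inter> X = {}" using vw by auto
      then show False using e(2) by simp
    qed
    ultimately consider "v \<in> X" "w \<notin> X" | "w \<in> X" "v \<notin> X" by blast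
    then show ?thesis
    proof cases
      case 1 then show ?thesis using vw V by blast
    next
      case 2
      then have "e = {w, v}" using vw by auto
      then show ?thesis using 2 V by blast
    qed
  qed
  show ?thesis
  proof
    show "P \<subseteq> \<Union>EF" by (auto simp: P_def)
    fix e assume e: "e \<in> EF" "e \<noteq> e0"
    then obtain p r where "e = {p, r}" "p \<in> X" "r \<notin> X" "p \<in> \<Union>EF" "r \<in> \<Union>EF"
      using split[OF e(1)] X by blast
    then have *: "e = {p, r}" "e = {r, p}" "p \<in> X" "r \<notin> X" "p \<in> \<Union>EF" "r \<in> \<Union>EF" by auto
    show "\<exists>p r. e = {p, r} \<and> p \<in> P \<and> r \<in> \<Union>EF - P"
    proof (cases "e0 \<in> EF \<and> e0 \<inter> X = {}")
      case True
      then have "P = \<Union>EF - X" by (simp add: P_def)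
      then show ?thesis using * by blast
    next
      case False
      then have "P = \<Union>EF \<inter> X" by (simp only: P_def if_False)
      then show ?thesis using * by blast
    qed
  next
    assume e0: "e0 \<in> EF"
    obtain v w where vw: "e0 = {v, w}" "v \<noteq> w" using edge_cases[OF EF e0] by metis
    have V: "v \<in> \<Union>EF" "w \<in> \<Union>EF" using e0 vw by auto
    show "(\<exists>p r. e0 = {p, r} \<and> p \<in> P \<and> r \<in> \<Union>EF - P) \<or> e0 \<subseteq> P"
    proof (cases "e0 \<inter> X = {}")
      case True
      then show ?thesis using e0 by (auto simp: P_def)
    next
      case False
      then have P: "P = \<Union>EF \<inter> X" by (auto simp: P_def)
      show ?thesis
      proof (cases "v \<in> X \<and> w \<in> X")
        case True then show ?thesis using P vw V by auto
      next
        case f: False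
        then consider "v \<in> X" "w \<notin> X" | "w \<in> X" "v \<notin> X" using False vw by auto
        then show ?thesis
        proof cases
          case 1 then show ?thesis using P vw V by blast
        next
          case 2
          then have "e0 = {w, v}" using vw by auto
          then show ?thesis using 2 P V by blast
        qed
      qed
    qed
  qed
qed

text \<open>Map the side P of F into S, with its possible inner edge sent to {v, w}, and the other
  side into T; parts of size v(F) leave room for both.\<close>

lemma Kplus_free_of_F_free:
  assumes EF: "is_edge_set EF" and ab: "almost_bipartite EF" and G: "is_edge_set G" and free: "F_free EF G"
  shows "Kplus_free G (card (\<Union>EF))"
  unfolding Kplus_free_def
proof (intro notI, elim exE conjE)
  fix S T v w
  assume S: "card S = card (\<Union>EF)" and T: "card T = card (\<Union>EF)" and vw: "v \<in> S" "w \<in> S" "{v, w} \<in> G"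
    and all: "\<forall>s\<in>S. \<forall>t\<in>T. {s, t} \<in> G"
  let ?U = "\<Union>EF"
  have fU: "finite ?U" by (rule finite_Union_edges[OF EF])
  have vnw: "v \<noteq> w" using vw no_loop[OF G] by auto
  obtain P e0 where P: "P \<subseteq> ?U"
    "\<And>e. e \<in> EF \<Longrightarrow> e \<noteq> e0 \<Longrightarrow> \<exists>p r. e = {p, r} \<and> p \<in> P \<and> r \<in> ?U - P"
    "e0 \<in> EF \<Longrightarrow> (\<exists>p r. e0 = {p, r} \<and> p \<in> P \<and> r \<in> ?U - P) \<or> e0 \<subseteq> P"
    by (rule almost_bipartite_parts[OF EF ab], rule that)
  have fP: "finite P" using P(1) fU finite_subset by metis
  have cP: "card P \<le> card S" "card (?U - P) \<le> card T" unfolding S T using P(1) fU by (auto intro: card_mono)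
  show False
  proof (cases "?U = {}")
    case True
    \<comment> \<open>Without edges, F has the empty map as a copy in every graph, so no graph is
      F-free.\<close>
    then have "F_free EF G \<longleftrightarrow> False"
    proof -
      have "EF = {}" using True edge_cases[OF EF] by blast
      then show ?thesis by (auto simp: F_free_def contains_copy_def of_edges_def verts_def edgs_def)
    qed
    then show False using free by simp
  next
    case False
    have fS: "finite S" "finite T" using S T False fU by (metis card_eq_0_iff card.infinite)+
    have disj: "S \<inter> T = {}" using all no_loop[OF G] by force
    have "\<exists>f. f ` P \<subseteq> S \<and> inj_on f P \<and> (e0 \<in> EF \<and> e0 \<subseteq> P \<longrightarrow> f ` e0 = {v, w})"
    proof (cases "e0 \<in> EF \<and> e0 \<subseteq> P")
      case True
      then obtain a b where "e0 = {a, b}" "a \<noteq> b" using edge_cases[OF EF] by metis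
      then obtain f where "f ` P \<subseteq> S" "inj_on f P" "f a = v" "f b = w"
        using inj_on_prescribed_two[OF fP fS(1) cP(1), of a b v w] True vw vnw by auto
      then show ?thesis using \<open>e0 = {a, b}\<close> by auto
    next
      case False
      then show ?thesis using inj_on_iff_card_le[OF fP fS(1)] cP(1) by auto
    qed
    then obtain f where f: "f ` P \<subseteq> S" "inj_on f P" "e0 \<in> EF \<Longrightarrow> e0 \<subseteq> P \<Longrightarrow> f ` e0 = {v, w}" by blast
    obtain g where g: "g ` (?U - P) \<subseteq> T" "inj_on g (?U - P)"
      using inj_on_iff_card_le[of "?U - P" T] fU fS cP(2) by auto
    define h where "h p = (if p \<in> P then f p else g p)" for p
    have cross: "h ` {p, r} \<in> G" if "p \<in> P" "r \<in> ?U - P" for p r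
    proof -
      have "f p \<in> S" "g r \<in> T" using f(1) g(1) that by blast+
      then have "{f p, g r} \<in> G" using all by blast
      moreover have "h ` {p, r} = {f p, g r}" using that by (simp add: h_def insert_commute)
      ultimately show ?thesis by simp
    qed
    have hG: "h ` e \<in> G" if e: "e \<in> EF" for e
    proof (cases "e = e0 \<and> e0 \<subseteq> P")
      case True
      then have "h ` e = f ` e0" by (intro image_cong) (auto simp: h_def)
      then show ?thesis using f(3) True e vw(3) by auto
    next
      case False
      then obtain p r where "e = {p, r}" "p \<in> P" "r \<in> ?U - P" using P(2)[OF e] P(3) e by blast
      then show ?thesis using cross by simp
    qed
    have inj: "inj_on h ?U"
    proof (rule inj_onI)
      fix p p' assume p: "p \<in> ?U" "p' \<in> ?U" "h p = h p'"
      have hS: "h z \<in> S" if "z \<in> P" for z using f(1) that by (auto simp: h_def)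
      have hT: "h z \<in> T" if "z \<in> ?U" "z \<notin> P" for z using g(1) that by (auto simp: h_def)
      show "p = p'"
      proof (cases "p \<in> P"; cases "p' \<in> P")
        assume "p \<in> P" "p' \<in> P"
        then show ?thesis using p f(2) by (simp add: h_def inj_on_def)
      next
        assume "p \<in> P" "p' \<notin> P"
        then show ?thesis using hS[of p] hT[of p'] p disj by auto
      next
        assume "p \<notin> P" "p' \<in> P"
        then show ?thesis using hS[of p'] hT[of p] p disj by auto
      next
        assume "p \<notin> P" "p' \<notin> P"
        then show ?thesis using p inj_onD[OF g(2), of p p'] by (simp add: h_def)
      qed
    qed
    have "h ` ?U \<subseteq> \<Union>G"
    proof
      fix z assume "z \<in> h ` ?U"
      then obtain e p where "e \<in> EF" "p \<in> e" "z = h p" by auto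
      then show "z \<in> \<Union>G" using hG[of e] by blast
    qed
    then have "contains_copy (of_edges G) (of_edges EF)"
      unfolding contains_copy_def of_edges_def verts_def edgs_def using inj hG by auto
    then show False using free by (simp add: F_free_def)
  qed
qed

section \<open>Members of the two families and the maximal ratio\<close>

lemma ex_maximal_independent:
  assumes EF: "is_edge_set EF" and Y: "independent (of_edges EF) Y"
  obtains I where "maximal_independent (of_edges EF) I" "Y \<subseteq> I"
proof -
  let ?Q = "{I. independent (of_edges EF) I \<and> Y \<subseteq> I}"
  have "?Q \<subseteq> Pow (\<Union>EF)" by (auto simp: independent_def of_edges_def verts_def)
  then have fin: "finite ?Q" using finite_Union_edges[OF EF] by (meson finite_Pow_iff finite_subset)
  have "Y \<in> ?Q" using Y by simp
  then obtain I where I: "I \<in> ?Q" "\<forall>J\<in>?Q. I \<subseteq> J \<longrightarrow> I = J"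
    using finite_has_maximal[OF fin] by blast
  then show ?thesis using that[of I] by (fastforce simp: maximal_independent_def)
qed

lemma A_famI:
  assumes "maximal_independent (of_edges EF) I"
  shows "(\<Union>EF - I, {e\<in>EF. e \<subseteq> \<Union>EF - I}) \<in> A_fam EF"
  using assms unfolding A_fam_def induced_def of_edges_def edgs_def by auto

lemma A_famE:
  assumes "H \<in> A_fam EF"
  obtains I where "maximal_independent (of_edges EF) I" "H = (\<Union>EF - I, {e\<in>EF. e \<subseteq> \<Union>EF - I})"
  using assms unfolding A_fam_def induced_def of_edges_def edgs_def by auto

text \<open>The side opposite to P is independent. Extending it to a maximal independent set leaves
  a subset of P, in which only the removed edge can survive.\<close>

lemma A_fam_one_edge:
  assumes EF: "is_edge_set EF" and ab: "almost_bipartite EF"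
  obtains H e0 where "H \<in> A_fam EF" "edgs H \<subseteq> {e0}" "finite (verts H)" "is_graph H"
proof -
  let ?U = "\<Union>EF"
  obtain P e0 where P: "P \<subseteq> ?U"
    "\<And>e. e \<in> EF \<Longrightarrow> e \<noteq> e0 \<Longrightarrow> \<exists>p r. e = {p, r} \<and> p \<in> P \<and> r \<in> ?U - P"
    "e0 \<in> EF \<Longrightarrow> (\<exists>p r. e0 = {p, r} \<and> p \<in> P \<and> r \<in> ?U - P) \<or> e0 \<subseteq> P"
    by (rule almost_bipartite_parts[OF EF ab], rule that)
  have "independent (of_edges EF) (?U - P)"
    unfolding independent_def of_edges_def verts_def edgs_def
  proof (intro conjI ballI, goal_cases)
    case (2 e)
    then have e: "e \<in> EF" by simp
    have "e \<noteq> {}" using edge_cases[OF EF e] by blast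
    then show ?case using P(2)[OF e] P(3) e by (cases "e = e0") blast+
  qed auto
  then obtain I where I: "maximal_independent (of_edges EF) I" "?U - P \<subseteq> I"
    using ex_maximal_independent[OF EF] by metis
  let ?H = "(?U - I, {e\<in>EF. e \<subseteq> ?U - I})"
  have "edgs ?H \<subseteq> {e0}"
  proof
    fix e assume "e \<in> edgs ?H"
    then have e: "e \<in> EF" "e \<subseteq> ?U - I" by (auto simp: edgs_def)
    show "e \<in> {e0}"
    proof (rule ccontr)
      assume "e \<notin> {e0}"
      then show False using P(2)[OF e(1)] e(2) I(2) by blast
    qed
  qed
  moreover have "is_graph ?H" "finite (verts ?H)"
    using EF finite_Union_edges[OF EF] by (auto simp: is_graph_def verts_def edgs_def is_edge_set_def)
  ultimately show ?thesis using that A_famI[OF I(1)] by blast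
qed

text \<open>A forbidden core H with at most one edge embeds in every graph that has an edge and at
  least v(H) vertices. Hence only cores of bounded size compete for a positive ratio.\<close>

lemma M_fam_large_edgeless:
  assumes H: "H \<in> A_fam EF" "edgs H \<subseteq> {e0}" "is_graph H" and M: "M \<in> M_fam EF"
    and le: "card (verts H) \<le> card (verts M)"
  shows "edgs M = {}"
proof (rule ccontr)
  assume "edgs M \<noteq> {}"
  then obtain e where e: "e \<in> edgs M" by auto
  have gM: "is_graph M" using M by (simp add: M_fam_def)
  have fin: "finite (verts H)" "finite (verts M)" using gM H by (auto simp: is_graph_def)
  obtain v w where vw: "e = {v, w}" "v \<noteq> w" "v \<in> verts M" "w \<in> verts M"
    using e gM unfolding is_graph_def by (metis card_2_iff insert_subset)
  have "contains_copy M H"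
  proof (cases "edgs H = {}")
    case True
    obtain f where "f ` verts H \<subseteq> verts M" "inj_on f (verts H)"
      using inj_on_iff_card_le[OF fin] le by auto
    then show ?thesis using True by (auto simp: contains_copy_def)
  next
    case False
    then have eH: "edgs H = {e0}" using H by auto
    then obtain a b where ab: "e0 = {a, b}" "a \<noteq> b" "a \<in> verts H" "b \<in> verts H"
      using H(3) unfolding is_graph_def by (metis card_2_iff insert_subset singletonI)
    obtain f where "f ` verts H \<subseteq> verts M" "inj_on f (verts H)" "f a = v" "f b = w"
      using inj_on_prescribed_two[OF fin le ab(3,4,2) vw(3,4,2)] by metis
    then show ?thesis using eH ab vw e by (auto simp: contains_copy_def)
  qed
  then show False using M H(1) by (auto simp: M_fam_def)
qed

text \<open>If a member of \<open>A_fam EF\<close> fits into one vertex, the complement of I has at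
  most one vertex; every edge of F leaves I, so all edges share it and F is a star. This makes stars
  admissible competitors, which is the source of \<open>rho_sq\<close>.\<close>

lemma single_vertex_M_fam:
  assumes EF: "is_edge_set EF" and ns: "\<not> is_star EF"
  shows "({v}, {}) \<in> M_fam EF"
  unfolding M_fam_def
proof (intro CollectI conjI ballI notI)
  show "is_graph ({v}, {})" by (simp add: is_graph_def verts_def edgs_def)
  fix H assume H: "H \<in> A_fam EF" "contains_copy ({v}, {}) H"
  obtain I where I: "maximal_independent (of_edges EF) I" "H = (\<Union>EF - I, {e\<in>EF. e \<subseteq> \<Union>EF - I})"
    using A_famE[OF H(1)] by metis
  obtain f where f: "inj_on f (\<Union>EF - I)" "f ` (\<Union>EF - I) \<subseteq> {v}"
    using H(2) I(2) by (auto simp: contains_copy_def verts_def)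
  have ind: "\<not> e \<subseteq> I" if "e \<in> EF" for e
    using I(1) that by (auto simp: maximal_independent_def independent_def of_edges_def edgs_def)
  have eq: "a = b" if "a \<in> \<Union>EF - I" "b \<in> \<Union>EF - I" for a b
    using inj_onD[OF f(1), of a b] f(2) that by (metis image_subset_iff singletonD)
  have "is_star EF"
  proof (cases "EF = {}")
    case True then show ?thesis by (simp add: is_star_def)
  next
    case False
    then obtain e where "e \<in> EF" by auto
    then obtain c where c: "c \<in> e" "c \<notin> I" using ind by blast
    then have cU: "c \<in> \<Union>EF - I" using \<open>e \<in> EF\<close> by auto
    have "c \<in> e'" if e': "e' \<in> EF" for e'
    proof -
      obtain c' where "c' \<in> e'" "c' \<notin> I" using ind[OF e'] by blast
      then show ?thesis using eq[OF cU, of c'] e' by auto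
    qed
    then show ?thesis by (auto simp: is_star_def)
  qed
  then show False using ns by simp
qed

lemma card_edgs_le:
  assumes "is_graph M"
  shows "card (edgs M) \<le> (card (verts M))\<^sup>2"
proof -
  have fin: "finite (verts M)" using assms by (simp add: is_graph_def)
  have "edgs M \<subseteq> (\<lambda>(a, b). {a, b}) ` (verts M \<times> verts M)"
  proof
    fix e assume "e \<in> edgs M"
    then have "card e = 2" "e \<subseteq> verts M" using assms by (auto simp: is_graph_def)
    then obtain a b where "e = {a, b}" "a \<in> verts M" "b \<in> verts M" by (auto simp: card_2_iff)
    then show "e \<in> (\<lambda>(a, b). {a, b}) ` (verts M \<times> verts M)" by auto
  qed
  then have "card (edgs M) \<le> card (verts M \<times> verts M)"
    using fin by (meson card_image_le card_mono finite_SigmaI finite_imageI order_trans)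
  then show ?thesis by (simp add: card_cartesian_product power2_eq_square)
qed

text \<open>The family is infinite, but its ratios are not: members with at least n vertices are
  edgeless and have ratio 0, the others give fractions with bounded numerator and
  denominator.\<close>

lemma max_ratio_exists:
  assumes EF: "is_edge_set EF" and ab: "almost_bipartite EF" and ns: "\<not> is_star EF"
  obtains \<mu> M0 where "M0 \<in> M_fam EF" "verts M0 \<noteq> {}" "ratio M0 = \<mu>"
    "\<And>M. M \<in> M_fam EF \<Longrightarrow> verts M \<noteq> {} \<Longrightarrow> ratio M \<le> \<mu>"
proof -
  obtain H e0 where H: "H \<in> A_fam EF" "edgs H \<subseteq> {e0}" "finite (verts H)" "is_graph H"
    using A_fam_one_edge[OF EF ab] by metis
  define n where "n = card (verts H)"
  let ?R = "ratio ` {M \<in> M_fam EF. verts M \<noteq> {}}"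
  have "?R \<subseteq> insert 0 ((\<lambda>(a, b). real a / real b) ` ({..n\<^sup>2} \<times> {..n}))"
  proof
    fix y assume "y \<in> ?R"
    then obtain M where M: "M \<in> M_fam EF" "y = ratio M" by auto
    have gM: "is_graph M" using M by (simp add: M_fam_def)
    show "y \<in> insert 0 ((\<lambda>(a, b). real a / real b) ` ({..n\<^sup>2} \<times> {..n}))"
    proof (cases "n \<le> card (verts M)")
      case True
      then have "edgs M = {}" using M_fam_large_edgeless[OF H(1,2,4) M(1)] by (simp add: n_def)
      then show ?thesis using M by (simp add: ratio_def)
    next
      case False
      then have 1: "card (verts M) \<le> n" by simp
      then have "(card (verts M))\<^sup>2 \<le> n\<^sup>2" by (simp add: power_mono)
      then have "card (edgs M) \<le> n\<^sup>2" using card_edgs_le[OF gM] by (rule order_trans[rotated])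
      then show ?thesis using 1 M by (auto simp: ratio_def)
    qed
  qed
  then have fin: "finite ?R" by (rule finite_subset) auto
  have "({0}, {}) \<in> {M \<in> M_fam EF. verts M \<noteq> {}}"
    using single_vertex_M_fam[OF EF ns] by (simp add: verts_def)
  then have ne: "?R \<noteq> {}" by blast
  have "Max ?R \<in> ?R" using fin ne by (rule Max_in)
  then obtain M0 where M0: "Max ?R = ratio M0" "M0 \<in> {M \<in> M_fam EF. verts M \<noteq> {}}" by (rule imageE)
  show ?thesis
  proof (rule that)
    show "M0 \<in> M_fam EF" "verts M0 \<noteq> {}" "ratio M0 = Max ?R" using M0 by auto
    fix M assume "M \<in> M_fam EF" "verts M \<noteq> {}"
    then show "ratio M \<le> Max ?R" using fin by (intro Max_ge) auto
  qed
qed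

text \<open>The vertices of F that a copy sends outside M are independent, because every edge of G
  touches M. Enlarge them to a maximal independent set I; the rest of F is then a member of
  \<open>A_fam EF\<close> mapped into M.\<close>

lemma F_free_join:
  assumes EF: "is_edge_set EF" and M: "M \<in> M_fam EF"
    and inA: "\<And>e. e \<in> G \<Longrightarrow> e \<subseteq> verts M \<Longrightarrow> e \<in> edgs M"
    and touch: "\<And>e. e \<in> G \<Longrightarrow> e \<inter> verts M \<noteq> {}"
  shows "F_free EF G"
  unfolding F_free_def
proof
  let ?U = "\<Union>EF"
  assume "contains_copy (of_edges G) (of_edges EF)"
  then obtain f where f: "inj_on f ?U" "\<And>e. e \<in> EF \<Longrightarrow> f ` e \<in> G"
    by (auto simp: contains_copy_def of_edges_def verts_def edgs_def)
  have "independent (of_edges EF) {v\<in>?U. f v \<notin> verts M}"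
    using f(2) touch unfolding independent_def of_edges_def verts_def edgs_def by fastforce
  then obtain I where I: "maximal_independent (of_edges EF) I" "{v\<in>?U. f v \<notin> verts M} \<subseteq> I"
    using ex_maximal_independent[OF EF] by metis
  have sub: "f ` (?U - I) \<subseteq> verts M" using I(2) by auto
  have "contains_copy M (?U - I, {e\<in>EF. e \<subseteq> ?U - I})"
    unfolding contains_copy_def
  proof (intro exI[of _ f] conjI ballI)
    show "inj_on f (verts (?U - I, {e\<in>EF. e \<subseteq> ?U - I}))"
      using f(1) by (auto simp: verts_def intro: inj_on_subset)
    show "f ` verts (?U - I, {e\<in>EF. e \<subseteq> ?U - I}) \<subseteq> verts M" using sub by (simp add: verts_def)
    fix e assume "e \<in> edgs (?U - I, {e\<in>EF. e \<subseteq> ?U - I})"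
    then have e: "e \<in> EF" "e \<subseteq> ?U - I" by (auto simp: edgs_def)
    then show "f ` e \<in> edgs M" using inA f(2) sub by (meson image_mono order_trans)
  qed
  then show False using M A_famI[OF I(1)] by (auto simp: M_fam_def)
qed

text \<open>Converse of the join construction: a copy of a member of \<open>A_fam EF\<close> in A
  extends to a copy of F by sending the deleted independent set I into B, which is complete to A and
  large enough.\<close>

lemma induced_in_M_fam:
  assumes EF: "is_edge_set EF" and G: "is_edge_set G" and free: "F_free EF G"
    and A: "A \<subseteq> \<Union>G" and B: "B \<subseteq> \<Union>G - A" "card (\<Union>EF) \<le> card B"
    and all: "\<And>a b. a \<in> A \<Longrightarrow> b \<in> B \<Longrightarrow> {a, b} \<in> G"
  shows "induced (of_edges G) A \<in> M_fam EF"
  unfolding M_fam_def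
proof (intro CollectI conjI ballI notI)
  have fV: "finite (\<Union>G)" by (rule finite_Union_edges[OF G])
  have fA: "finite A" using A fV finite_subset by metis
  have fB: "finite B" using B fV finite_subset by (metis finite_Diff)
  show "is_graph (induced (of_edges G) A)"
    using G fA by (auto simp: is_graph_def induced_def of_edges_def verts_def edgs_def is_edge_set_def)
  fix H assume H: "H \<in> A_fam EF" "contains_copy (induced (of_edges G) A) H"
  let ?U = "\<Union>EF"
  obtain I where I: "maximal_independent (of_edges EF) I" "H = (?U - I, {e\<in>EF. e \<subseteq> ?U - I})"
    using A_famE[OF H(1)] by metis
  obtain f where f: "inj_on f (?U - I)" "f ` (?U - I) \<subseteq> A"
      "\<And>e. e \<in> EF \<Longrightarrow> e \<subseteq> ?U - I \<Longrightarrow> f ` e \<in> G"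
    using H(2) I(2) by (auto simp: contains_copy_def induced_def of_edges_def verts_def edgs_def)
  have ind: "\<not> e \<subseteq> I" if "e \<in> EF" for e
    using I(1) that by (auto simp: maximal_independent_def independent_def of_edges_def edgs_def)
  have IU: "I \<subseteq> ?U" using I(1) by (auto simp: maximal_independent_def independent_def of_edges_def verts_def)
  have fU: "finite ?U" by (rule finite_Union_edges[OF EF])
  have "card I \<le> card B" using card_mono[OF fU IU] B(2) by simp
  then obtain g where g: "g ` I \<subseteq> B" "inj_on g I"
    using inj_on_iff_card_le[of I B] fB finite_subset[OF IU fU] by auto
  define h where "h p = (if p \<in> I then g p else f p)" for p
  have hA: "h p \<in> A" if "p \<in> ?U" "p \<notin> I" for p using f(2) that by (auto simp: h_def)
  have hB: "h p \<in> B" if "p \<in> I" for p using g(1) that by (auto simp: h_def)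
  have AB: "A \<inter> B = {}" using B by auto
  have inj: "inj_on h ?U"
  proof (rule inj_onI)
    fix p p' assume p: "p \<in> ?U" "p' \<in> ?U" "h p = h p'"
    show "p = p'"
    proof (cases "p \<in> I"; cases "p' \<in> I")
      assume "p \<in> I" "p' \<in> I"
      then show ?thesis using p g(2) by (simp add: h_def inj_on_def)
    next
      assume "p \<in> I" "p' \<notin> I"
      then show ?thesis using hB[of p] hA[of p'] p AB by auto
    next
      assume "p \<notin> I" "p' \<in> I"
      then show ?thesis using hB[of p'] hA[of p] p AB by auto
    next
      assume "p \<notin> I" "p' \<notin> I"
      then show ?thesis using p inj_onD[OF f(1), of p p'] by (simp add: h_def)
    qed
  qed
  have hG: "h ` e \<in> G" if e: "e \<in> EF" for e
  proof (cases "e \<inter> I = {}")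
    case True
    then have "h ` e = f ` e" by (intro image_cong) (auto simp: h_def)
    moreover have "e \<subseteq> ?U - I" using True e by auto
    ultimately show ?thesis using f(3)[OF e] by simp
  next
    case False
    then obtain p where p: "p \<in> e" "p \<in> I" by auto
    obtain r where r: "r \<in> e" "r \<notin> I" using ind[OF e] by auto
    obtain a b where "e = {a, b}" "a \<noteq> b" using edge_cases[OF EF e] by metis
    then have "e = {r, p}" using p r by auto
    moreover have "{h r, h p} \<in> G" using all hA[of r] hB[of p] p r e by blast
    ultimately show ?thesis by simp
  qed
  have "h ` ?U \<subseteq> \<Union>G"
  proof
    fix z assume "z \<in> h ` ?U"
    then obtain e p where "e \<in> EF" "p \<in> e" "z = h p" by auto
    then show "z \<in> \<Union>G" using hG[of e] by blast
  qed
  then have "contains_copy (of_edges G) (of_edges EF)"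
    unfolding contains_copy_def of_edges_def verts_def edgs_def using inj hG by auto
  then show False using free by (simp add: F_free_def)
qed

section \<open>Join competitors of an extremal graph\<close>

definition bip :: "nat set \<Rightarrow> nat set \<Rightarrow> nat set set" where
  "bip A C = (\<lambda>(a, c). {a, c}) ` (A \<times> C)"

lemma bip_mem: "e \<in> bip A C \<longleftrightarrow> (\<exists>a\<in>A. \<exists>c\<in>C. e = {a, c})"
  by (auto simp: bip_def)

lemma card_bip:
  assumes "A \<inter> C = {}"
  shows "card (bip A C) = card A * card C"
proof -
  have "inj_on (\<lambda>(a, c). {a, c}) (A \<times> C)"
    using assms by (auto simp: inj_on_def doubleton_eq_iff)
  then show ?thesis unfolding bip_def by (simp add: card_image card_cartesian_product)
qed

lemma is_edge_set_bip:
  assumes "finite A" "finite C" "A \<inter> C = {}"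
  shows "is_edge_set (bip A C)"
proof -
  have "card e = 2" if "e \<in> bip A C" for e
    using that assms(3) unfolding bip_mem by (metis card_2_iff disjoint_iff)
  moreover have "finite (bip A C)" using assms by (simp add: bip_def)
  ultimately show ?thesis by (simp add: is_edge_set_def)
qed

lemma quad_bip:
  assumes "finite A" "finite C" "A \<inter> C = {}"
  shows "quad (bip A C) y = 2 * (\<Sum>a\<in>A. y a) * (\<Sum>c\<in>C. y c)"
proof -
  have arcs: "arcs (bip A C) = A \<times> C \<union> C \<times> A"
    by (auto simp: arcs_def bip_mem doubleton_eq_iff)
  have "A \<times> C \<inter> C \<times> A = {}" using assms(3) by auto
  then have "quad (bip A C) y = (\<Sum>(a, c)\<in>A \<times> C. y a * y c) + (\<Sum>(c, a)\<in>C \<times> A. y c * y a)"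
    unfolding quad_def arcs by (subst sum.union_disjoint) (use assms in auto)
  also have "\<dots> = (\<Sum>a\<in>A. y a) * (\<Sum>c\<in>C. y c) + (\<Sum>c\<in>C. y c) * (\<Sum>a\<in>A. y a)"
    by (simp add: sum_product sum.cartesian_product)
  finally show ?thesis by simp
qed

lemma is_edge_set_Un: "is_edge_set E \<Longrightarrow> is_edge_set E' \<Longrightarrow> is_edge_set (E \<union> E')"
  by (auto simp: is_edge_set_def)

lemma quad_Un:
  assumes "is_edge_set E" "is_edge_set E'" "E \<inter> E' = {}"
  shows "quad (E \<union> E') y = quad E y + quad E' y"
proof -
  have "arcs (E \<union> E') = arcs E \<union> arcs E'" "arcs E \<inter> arcs E' = {}" using assms(3) by (auto simp: arcs_def)
  then show ?thesis unfolding quad_def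
    using finite_arcs[OF assms(1)] finite_arcs[OF assms(2)] by (simp add: sum.union_disjoint)
qed

text \<open>The competitor joins M to t fresh independent vertices and uses the remaining edges at
  one further vertex attached to R, which gives exactly n edges. The trial values y, b and b' stay
  free because the bound is used twice: with constants for the lower bound on \<open>lam G\<close>,
  and with Perron entries for the fine structure.\<close>

lemma spex_join_bound:
  assumes EF: "is_edge_set EF" and M: "M \<in> M_fam EF" and spex: "spex EF n G"
    and n: "n = card (edgs M) + card (verts M) * t + card R" and R: "R \<subseteq> verts M" and t: "0 < t"
    and ne: "verts M \<noteq> {}"
  shows "quad (edgs M) y + 2 * real t * b * (\<Sum>a\<in>verts M. y a) + 2 * b' * (\<Sum>a\<in>R. y a)
    \<le> lam G * ((\<Sum>a\<in>verts M. (y a)\<^sup>2) + real t * b\<^sup>2 + b'\<^sup>2)"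
proof -
  define A where "A = verts M"
  have gM: "is_graph M" using M by (simp add: M_fam_def)
  have fA: "finite A" using gM by (simp add: is_graph_def A_def)
  have fR: "finite R" using R fA finite_subset by (metis A_def)
  define c where "c i = Suc (Max A) + i" for i
  have cA: "c i \<notin> A" for i using Max_ge[OF fA, of "c i"] by (auto simp: c_def)
  have injc: "inj c" by (auto simp: inj_def c_def)
  define C where "C = c ` {..<t}"
  have C: "finite C" "card C = t" "A \<inter> C = {}" "c t \<notin> C"
    using cA injc by (auto simp: C_def card_image inj_on_subset dest: injD)
  have fe: "finite (edgs M)"
  proof -
    have "edgs M \<subseteq> Pow A" using gM by (auto simp: is_graph_def A_def)
    then show ?thesis using fA by (meson finite_Pow_iff finite_subset)
  qed
  have E1: "is_edge_set (edgs M)" using gM fe by (simp add: is_edge_set_def is_graph_def)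
  have E2: "is_edge_set (bip A C)" using is_edge_set_bip[OF fA C(1,3)] .
  have RC: "R \<inter> {c t} = {}" using R cA by (auto simp: A_def)
  have E3: "is_edge_set (bip R {c t})" using is_edge_set_bip[OF fR _ RC] by simp
  have d12: "edgs M \<inter> bip A C = {}"
    using gM C(3) unfolding is_graph_def bip_mem A_def[symmetric] by (fastforce simp: bip_mem)
  have d3: "(edgs M \<union> bip A C) \<inter> bip R {c t} = {}"
  proof -
    have "e \<notin> bip R {c t}" if "e \<in> edgs M" for e
      using that gM cA[of t] unfolding is_graph_def A_def[symmetric] by (auto simp: bip_mem)
    moreover have "e \<notin> bip R {c t}" if "e \<in> bip A C" for e
      using that cA[of t] C(4) by (auto simp: bip_mem doubleton_eq_iff)
    ultimately show ?thesis by blast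
  qed
  define G' where "G' = edgs M \<union> bip A C \<union> bip R {c t}"
  have E': "is_edge_set G'" unfolding G'_def using E1 E2 E3 by (intro is_edge_set_Un)
  have card: "card G' = n"
  proof -
    have "card G' = card (edgs M \<union> bip A C) + card (bip R {c t})"
      unfolding G'_def by (rule card_Un_disjoint) (use d3 E1 E2 E3 in \<open>auto simp: is_edge_set_def\<close>)
    also have "card (edgs M \<union> bip A C) = card (edgs M) + card (bip A C)"
      by (rule card_Un_disjoint) (use d12 E1 E2 in \<open>auto simp: is_edge_set_def\<close>)
    finally show ?thesis using card_bip[OF C(3)] card_bip[OF RC] C(2) n by (simp add: A_def)
  qed
  have touch: "e \<inter> A \<noteq> {}" if "e \<in> G'" for e
  proof -
    have "e \<in> edgs M \<Longrightarrow> e \<inter> A \<noteq> {}" using gM unfolding is_graph_def A_def[symmetric]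
      by (metis Int_absorb2 card.empty zero_neq_numeral)
    then show ?thesis using that R unfolding G'_def by (auto simp: bip_mem A_def)
  qed
  have inA: "e \<in> edgs M" if "e \<in> G'" "e \<subseteq> A" for e
    using that C(3) cA[of t] unfolding G'_def by (auto simp: bip_mem)
  have "F_free EF G'"
    by (rule F_free_join[OF EF M]) (use touch inA in \<open>auto simp: A_def\<close>)
  then have le: "lam G' \<le> lam G" using spex E' card by (auto simp: spex_def)
  have A0: "A \<noteq> {}" using ne by (simp add: A_def)
  have neG': "G' \<noteq> {}"
  proof -
    obtain a where "a \<in> A" using A0 by auto
    then have "{a, c 0} \<in> bip A C" using t by (auto simp: bip_mem C_def)
    then show ?thesis by (auto simp: G'_def)
  qed
  have UG': "\<Union>G' \<subseteq> A \<union> C \<union> {c t}"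
    using gM R unfolding G'_def is_graph_def by (auto simp: bip_mem A_def)
  \<comment> \<open>Needed below to enlarge the vertex set in the norm: \<open>c t\<close> is
    isolated when R is empty, and then its square may only be added because the radius is
    nonnegative.\<close>
  have lam0: "0 \<le> lam G'"
  proof -
    have 1: "0 \<le> quad G' (\<lambda>_. 1)" unfolding quad_def by (intro sum_nonneg) auto
    have "0 \<le> lam G' * real (card (\<Union>G'))" using 1 lam_rayleigh[OF E' neG', of "\<lambda>_. 1"] by simp
    moreover have "card (\<Union>G') > 0"
    proof -
      obtain e where "e \<in> G'" using neG' by auto
      then have "\<Union>G' \<noteq> {}" using touch[of e] by auto
      then show ?thesis using finite_Union_edges[OF E'] by (simp add: card_gt_0_iff)
    qed
    ultimately show ?thesis by (simp add: zero_le_mult_iff)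
  qed
  define z where "z v = (if v \<in> A then y v else if v \<in> C then b else b')" for v
  have zA: "(\<Sum>a\<in>A. f (z a)) = (\<Sum>a\<in>A. f (y a))" for f :: "real \<Rightarrow> real"
    by (intro sum.cong) (auto simp: z_def)
  have zC: "(\<Sum>a\<in>C. f (z a)) = real t * f b" for f :: "real \<Rightarrow> real"
  proof -
    have "(\<Sum>a\<in>C. f (z a)) = (\<Sum>a\<in>C. f b)" using C(3) by (intro sum.cong) (auto simp: z_def)
    then show ?thesis using C(2) by simp
  qed
  have zt: "z (c t) = b'" using cA C(4) by (simp add: z_def)
  have "quad G' z = quad (edgs M) z + quad (bip A C) z + quad (bip R {c t}) z"
    unfolding G'_def using quad_Un[OF E1 E2 d12] quad_Un[OF is_edge_set_Un[OF E1 E2] E3 d3] by simp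
  moreover have "quad (edgs M) z = quad (edgs M) y"
    unfolding quad_def
  proof (intro sum.cong refl)
    fix p assume p: "p \<in> arcs (edgs M)"
    obtain v w where vw: "p = (v, w)" by (cases p)
    have "{v, w} \<subseteq> A" using p vw gM by (auto simp: arcs_def is_graph_def A_def)
    then show "(case p of (v, w) \<Rightarrow> z v * z w) = (case p of (v, w) \<Rightarrow> y v * y w)"
      using vw by (simp add: z_def)
  qed
  moreover have "quad (bip A C) z = 2 * (\<Sum>a\<in>A. y a) * (real t * b)"
    using quad_bip[OF fA C(1,3)] zA[of "\<lambda>x. x"] zC[of "\<lambda>x. x"] by simp
  moreover have "quad (bip R {c t}) z = 2 * (\<Sum>a\<in>R. y a) * b'"
  proof -
    have "(\<Sum>a\<in>R. z a) = (\<Sum>a\<in>R. y a)" using R by (intro sum.cong) (auto simp: z_def A_def)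
    then show ?thesis using quad_bip[OF fR _ RC, of z] zt by simp
  qed
  ultimately have "quad (edgs M) y + 2 * real t * b * (\<Sum>a\<in>A. y a) + 2 * b' * (\<Sum>a\<in>R. y a) = quad G' z"
    by (simp add: algebra_simps)
  also have "\<dots> \<le> lam G' * (\<Sum>v\<in>\<Union>G'. (z v)\<^sup>2)" by (rule lam_rayleigh[OF E' neG'])
  also have "\<dots> \<le> lam G' * (\<Sum>v\<in>A \<union> C \<union> {c t}. (z v)\<^sup>2)"
    using lam0 UG' fA C(1) by (intro mult_left_mono sum_mono2) auto
  also have "(\<Sum>v\<in>A \<union> C \<union> {c t}. (z v)\<^sup>2) = (\<Sum>v\<in>A. (z v)\<^sup>2) + (\<Sum>v\<in>C. (z v)\<^sup>2) + (z (c t))\<^sup>2"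
    using fA C cA by (simp add: sum.union_disjoint)
  also have "\<dots> = (\<Sum>a\<in>A. (y a)\<^sup>2) + real t * b\<^sup>2 + b'\<^sup>2"
    using zA[of "\<lambda>x. x\<^sup>2"] zC[of "\<lambda>x. x\<^sup>2"] zt by simp
  also have "lam G' * \<dots> \<le> lam G * \<dots>"
    using le by (intro mult_right_mono add_nonneg_nonneg sum_nonneg) auto
  finally show ?thesis by (simp add: A_def)
qed

lemma spex_lam_lower:
  assumes EF: "is_edge_set EF" and M: "M \<in> M_fam EF" and spex: "spex EF n G"
    and ne: "verts M \<noteq> {}" and n: "card (edgs M) + card (verts M) \<le> n"
  shows "ratio M + sqrt (real n - real (card (edgs M)) - real (card (verts M))) \<le> lam G"
    and "card (verts M) = 1 \<Longrightarrow> edgs M = {} \<Longrightarrow> sqrt (real n) \<le> lam G"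
proof -
  define s where "s = card (verts M)"
  define e where "e = card (edgs M)"
  define t where "t = (n - e) div s"
  define r where "r = (n - e) mod s"
  have gM: "is_graph M" using M by (simp add: M_fam_def)
  have fA: "finite (verts M)" using gM by (simp add: is_graph_def)
  have s: "s > 0" using ne fA by (simp add: s_def card_gt_0_iff)
  have rs: "r < s" using s by (simp add: r_def)
  have nn: "n = e + s * t + r" using n unfolding t_def r_def e_def s_def by simp
  have t: "t > 0" using n s unfolding t_def by (simp add: div_greater_zero_iff e_def s_def)
  obtain R where R: "R \<subseteq> verts M" "card R = r"
    using obtain_subset_with_card_n[of r "verts M"] rs by (metis less_imp_le s_def)
  have E1: "is_edge_set (edgs M)"
  proof -
    have "edgs M \<subseteq> Pow (verts M)" using gM by (auto simp: is_graph_def)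
    then have "finite (edgs M)" using fA by (meson finite_Pow_iff finite_subset)
    then show ?thesis using gM by (simp add: is_edge_set_def is_graph_def)
  qed
  have q: "quad (edgs M) (\<lambda>_. 1) = 2 * real e"
    unfolding quad_def using card_arcs[OF E1] by (simp add: e_def)
  \<comment> \<open>The balance \<open>t * b\<^sup>2 = s\<close> gives both sides of the join equal
    mass, so that the Rayleigh quotient becomes \<open>e / s + sqrt (s * t)\<close>. The last vertex
    gets weight 0: its fewer than s edges cost only O(1) under the root.\<close>
  define b where "b = sqrt (real s / real t)"
  have b2: "real t * b\<^sup>2 = real s" using t by (simp add: b_def)
  have tb: "real t * b = sqrt (real s * real t)"
  proof -
    have "real t * b = sqrt ((real t)\<^sup>2) * b" by simp
    also have "\<dots> = sqrt ((real t)\<^sup>2 * (real s / real t))" unfolding b_def by (rule real_sqrt_mult[symmetric])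
    also have "(real t)\<^sup>2 * (real s / real t) = real s * real t" using t by (simp add: power2_eq_square)
    finally show ?thesis .
  qed
  have "quad (edgs M) (\<lambda>_. 1) + 2 * real t * b * (\<Sum>a\<in>verts M. 1) + 2 * 0 * (\<Sum>a\<in>R. 1)
    \<le> lam G * ((\<Sum>a\<in>verts M. 1\<^sup>2) + real t * b\<^sup>2 + 0\<^sup>2)"
    by (rule spex_join_bound[OF EF M spex _ R(1) t ne]) (use nn R in \<open>auto simp: e_def s_def\<close>)
  then have "2 * real e + 2 * (real t * b) * real s \<le> lam G * (2 * real s)"
    unfolding q b2 by (simp add: s_def[symmetric])
  then have "real e / real s + real t * b \<le> lam G" using s by (simp add: field_simps)
  then have main: "ratio M + sqrt (real s * real t) \<le> lam G" by (simp add: tb ratio_def e_def s_def)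
  have "real n = real e + real s * real t + real r" using nn by (metis of_nat_add of_nat_mult)
  then have "real n - real e - real s \<le> real s * real t" using rs by simp
  then have "sqrt (real n - real e - real s) \<le> sqrt (real s * real t)" by simp
  then show "ratio M + sqrt (real n - real (card (edgs M)) - real (card (verts M))) \<le> lam G"
    using main unfolding e_def s_def by linarith
  \<comment> \<open>For a star nothing is left over after division by s = 1, so the bound is
    sharp.\<close>
  assume "card (verts M) = 1" "edgs M = {}"
  then have "n = t" "ratio M = 0" "s = 1" using nn rs by (auto simp: e_def s_def ratio_def)
  then show "sqrt (real n) \<le> lam G" using main by simp
qed

section \<open>Graphs with a bounded core\<close>

lemma sum_sq_le_card:
  fixes f :: "'c \<Rightarrow> real"
  shows "(\<Sum>i\<in>I. f i)\<^sup>2 \<le> real (card I) * (\<Sum>i\<in>I. (f i)\<^sup>2)"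
  using Cauchy_Schwarz_ineq_sum[of "\<lambda>_. 1" f I] by simp

text \<open>The largest sum of squares of parts of size at most \<open>s\<close> with total \<open>n\<close>: it measures how much the spectral radius gains
  when the edges between core and the rest are packed into as few outer vertices as possible.\<close>

definition sq_pack :: "nat \<Rightarrow> nat \<Rightarrow> nat" where
  "sq_pack s n = (n div s) * s\<^sup>2 + (n mod s)\<^sup>2"

text \<open>Only the remainder r of n matters. If r + d stays below s, merging gains 2rd. Otherwise
  a full part s and a rest y arise, and with a = s - r the gain is 2a(r - y), which is
  positive.\<close>

lemma sq_pack_add:
  assumes "d < s"
  shows "sq_pack s n + d\<^sup>2 \<le> sq_pack s (n + d)"
    and "0 < n mod s \<Longrightarrow> 0 < d \<Longrightarrow> sq_pack s n + d\<^sup>2 < sq_pack s (n + d)"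
proof -
  define q where "q = n div s"
  define r where "r = n mod s"
  have s: "0 < s" using assms by simp
  have r: "r < s" using s by (simp add: r_def)
  have n: "n + d = q * s + (r + d)" by (simp add: q_def r_def)
  have div: "(n + d) div s = q + (r + d) div s" "(n + d) mod s = (r + d) mod s"
    unfolding n using s by simp_all
  have *: "r\<^sup>2 + d\<^sup>2 \<le> ((r + d) div s) * s\<^sup>2 + ((r + d) mod s)\<^sup>2 \<and>
     (0 < r \<longrightarrow> 0 < d \<longrightarrow> r\<^sup>2 + d\<^sup>2 < ((r + d) div s) * s\<^sup>2 + ((r + d) mod s)\<^sup>2)"
  proof (cases "r + d < s")
    case True
    then show ?thesis by (simp add: power2_sum)
  next
    case False
    define y where "y = r + d - s"
    define a where "a = s - r"
    have d: "d = y + a" and sa: "s = r + a" and yr: "y < r" and a0: "0 < a"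
      using False r assms by (auto simp: y_def a_def)
    have "(r + d) div s = 1" "(r + d) mod s = y"
      using False r assms by (auto simp: y_def le_div_geq le_mod_geq)
    moreover have "r\<^sup>2 + d\<^sup>2 < s\<^sup>2 + y\<^sup>2"
    proof -
      have "2 * y * a < 2 * r * a" using yr a0 by simp
      then show ?thesis unfolding d sa power2_sum by linarith
    qed
    ultimately show ?thesis by simp
  qed
  show "sq_pack s n + d\<^sup>2 \<le> sq_pack s (n + d)"
    unfolding sq_pack_def div using * by (simp add: q_def[symmetric] r_def[symmetric] add_mult_distrib)
  show "0 < n mod s \<Longrightarrow> 0 < d \<Longrightarrow> sq_pack s n + d\<^sup>2 < sq_pack s (n + d)"
    unfolding sq_pack_def div using * by (simp add: q_def[symmetric] r_def[symmetric] add_mult_distrib)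
qed

lemma sq_pack_add_sum:
  assumes "finite Q" "\<And>v. v \<in> Q \<Longrightarrow> d v < s"
  shows "sq_pack s n + (\<Sum>v\<in>Q. (d v)\<^sup>2) \<le> sq_pack s (n + (\<Sum>v\<in>Q. d v))"
  using assms
proof (induction Q)
  case (insert v Q)
  have "sq_pack s n + (\<Sum>v\<in>Q. (d v)\<^sup>2) + (d v)\<^sup>2 \<le> sq_pack s (n + (\<Sum>v\<in>Q. d v)) + (d v)\<^sup>2"
    using insert by simp
  also have "\<dots> \<le> sq_pack s (n + (\<Sum>v\<in>Q. d v) + d v)" using insert by (intro sq_pack_add) auto
  finally show ?case using insert by (simp add: ac_simps)
qed simp

lemma sq_pack_add_units:
  assumes "0 < s"
  shows "sq_pack s n + h \<le> sq_pack s (n + h)"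
proof (cases "s = 1")
  case True then show ?thesis by (simp add: sq_pack_def)
next
  case False
  then have s: "1 < s" using assms by simp
  show ?thesis
  proof (induction h)
    case (Suc h)
    have "sq_pack s (n + h) + 1\<^sup>2 \<le> sq_pack s (n + h + 1)" using s by (rule sq_pack_add)
    then show ?case using Suc by simp
  qed simp
qed

text \<open>The defect g of the sum of squares satisfies three bounds: g is at least 1 by
  integrality and strictness, at least h because an unpacked unit is worth at least 1, and at least
  \<open>q - s\<^sup>2\<close> because parts below s have squares at most s - 1 times their size.
  Together they make g grow linearly in q + h, which is what beats an error of order (q + h + 1) /
  \<rho>.\<close>

lemma sq_pack_gap:
  assumes Q: "finite Q" "\<And>v. v \<in> Q \<Longrightarrow> 1 \<le> d v \<and> d v < s" and s: "0 < s" and r: "r < s"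
    and eq: "(\<Sum>v\<in>Q. d v) + h = q * s + r" and bad: "0 < h \<or> 2 \<le> card Q"
  shows "real q + real h + 1 \<le> ((real s)\<^sup>2 + 3) * (real q * (real s)\<^sup>2 + (real r)\<^sup>2 - (\<Sum>v\<in>Q. (real (d v))\<^sup>2))"
proof -
  define g where "g = real q * (real s)\<^sup>2 + (real r)\<^sup>2 - (\<Sum>v\<in>Q. (real (d v))\<^sup>2)"
  have pk: "sq_pack s (q * s + r) = q * s\<^sup>2 + r\<^sup>2" using r s by (simp add: sq_pack_def)
  have pk0: "sq_pack s 0 = 0" by (simp add: sq_pack_def)
  have "(\<Sum>v\<in>Q. (d v)\<^sup>2) \<le> sq_pack s (\<Sum>v\<in>Q. d v)"
    using sq_pack_add_sum[of Q d s 0] Q pk0 by simp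
  also have "\<dots> + h \<le> sq_pack s (q * s + r)" using sq_pack_add_units[OF s, of "\<Sum>v\<in>Q. d v" h] eq by simp
  finally have h: "(\<Sum>v\<in>Q. (d v)\<^sup>2) + h \<le> q * s\<^sup>2 + r\<^sup>2" using pk by simp
  have strict: "(\<Sum>v\<in>Q. (d v)\<^sup>2) + 1 \<le> q * s\<^sup>2 + r\<^sup>2"
  proof (cases "0 < h")
    case True then show ?thesis using h by simp
  next
    case False
    then have c2: "2 \<le> card Q" and h0: "h = 0" using bad by auto
    obtain T where T: "T \<subseteq> Q" "card T = 2" using obtain_subset_with_card_n[OF c2] by metis
    obtain a b where ab: "T = {a, b}" "a \<noteq> b" using T(2) by (auto simp: card_2_iff)
    have abQ: "a \<in> Q" "b \<in> Q" using ab T by auto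
    define Q' where "Q' = Q - {a, b}"
    have Qe: "Q = insert a (insert b Q')" "a \<notin> insert b Q'" "b \<notin> Q'" "finite Q'"
      using abQ ab Q(1) by (auto simp: Q'_def)
    have "sq_pack s (d a) + (d b)\<^sup>2 < sq_pack s (d a + d b)"
      using Q(2)[OF abQ(1)] Q(2)[OF abQ(2)] by (intro sq_pack_add) auto
    moreover have "sq_pack s (d a) = (d a)\<^sup>2" using Q(2)[OF abQ(1)] by (simp add: sq_pack_def)
    moreover have "sq_pack s (d a + d b) + (\<Sum>v\<in>Q'. (d v)\<^sup>2) \<le> sq_pack s (d a + d b + (\<Sum>v\<in>Q'. d v))"
      using Qe Q by (intro sq_pack_add_sum) auto
    moreover have "d a + d b + (\<Sum>v\<in>Q'. d v) = q * s + r" using eq h0 Qe by simp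
    moreover have "(\<Sum>v\<in>Q. (d v)\<^sup>2) = (d a)\<^sup>2 + (d b)\<^sup>2 + (\<Sum>v\<in>Q'. (d v)\<^sup>2)" using Qe by simp
    ultimately show ?thesis using pk by simp
  qed
  have g1: "1 \<le> g"
  proof -
    have "real ((\<Sum>v\<in>Q. (d v)\<^sup>2) + 1) \<le> real (q * s\<^sup>2 + r\<^sup>2)" using strict by (rule of_nat_mono)
    then show ?thesis by (simp add: g_def)
  qed
  have gh: "real h \<le> g"
  proof -
    have "real ((\<Sum>v\<in>Q. (d v)\<^sup>2) + h) \<le> real (q * s\<^sup>2 + r\<^sup>2)" using h by (rule of_nat_mono)
    then show ?thesis by (simp add: g_def)
  qed
  have gq: "real q - (real s)\<^sup>2 \<le> g"
  proof -
    have s1: "1 \<le> real s" using s by simp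
    have "(\<Sum>v\<in>Q. (real (d v))\<^sup>2) \<le> (\<Sum>v\<in>Q. (real s - 1) * real (d v))"
    proof (rule sum_mono)
      fix v assume "v \<in> Q"
      then have "real (d v) \<le> real s - 1" using Q(2)[of v] by linarith
      then show "(real (d v))\<^sup>2 \<le> (real s - 1) * real (d v)" unfolding power2_eq_square by (intro mult_right_mono) auto
    qed
    also have "\<dots> = (real s - 1) * real (\<Sum>v\<in>Q. d v)" by (simp add: sum_distrib_left)
    also have "\<dots> \<le> (real s - 1) * (real q * real s + real r)"
    proof (rule mult_left_mono)
      have "(\<Sum>v\<in>Q. d v) \<le> q * s + r" using eq by simp
      then show "real (\<Sum>v\<in>Q. d v) \<le> real q * real s + real r" by (metis of_nat_mono of_nat_add of_nat_mult)
    qed (use s1 in simp)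
    finally have "real q * real s - (real s - 1) * real r + (real r)\<^sup>2 \<le> g"
      by (simp add: g_def algebra_simps power2_eq_square)
    moreover have "real q * 1 \<le> real q * real s" using s1 by (intro mult_left_mono) auto
    moreover have "(real s - 1) * real r \<le> real s * real s" using s1 r by (intro mult_mono) auto
    ultimately show ?thesis using zero_le_power2[of "real r"] unfolding power2_eq_square by linarith
  qed
  have "(real s)\<^sup>2 * 1 \<le> (real s)\<^sup>2 * g" using g1 by (intro mult_left_mono) auto
  then have "real q + real h + 1 \<le> ((real s)\<^sup>2 + 3) * g" using g1 gh gq by (simp add: algebra_simps)
  then show ?thesis by (simp add: g_def)
qed

section \<open>Entries outside a small set covering most edges\<close>

context perron_graph
begin

lemma loss_ge: "1 - x (snd p) - x (fst p) \<le> loss w p"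
  unfolding loss_def using x0 by (intro diff_mono) auto

lemma loss_ge_snd: "snd p \<notin> nbr G w \<Longrightarrow> 1 - x (snd p) \<le> loss w p"
  unfolding loss_def using x0[of "snd p"] by auto


text \<open>Let \<eta> be the largest entry off A0. In the two-step expansion each visit to A0
  contributes at most k0, and walks avoiding A0 are counted by D, so
  \<open>\<rho>\<^sup>2 * \<eta> \<le> k0 * (\<rho> + D) + \<eta> * D\<close>; solve for
  \<eta>.\<close>

lemma off_set_bound:
  fixes A0 :: "nat set" and D k0 :: real
  assumes fin: "finite A0" and k0: "real (card A0) \<le> k0"
    and D: "real (card (arcs G \<inter> (- A0) \<times> (- A0))) \<le> D" and small: "D < \<rho>\<^sup>2" and v: "v \<notin> A0"
  shows "x v \<le> k0 * (\<rho> + D) / (\<rho>\<^sup>2 - D)"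
proof -
  let ?A = "arcs G \<inter> (- A0) \<times> (- A0)"
  have k00: "0 \<le> k0" using k0 by (meson of_nat_0_le_iff order_trans)
  have D0: "0 \<le> D" using D by (meson of_nat_0_le_iff order_trans)
  have in_A0: "(\<Sum>w\<in>nbr G z \<inter> A0. x w) \<le> k0" for z
  proof -
    have "(\<Sum>w\<in>nbr G z \<inter> A0. x w) \<le> real (card (nbr G z \<inter> A0))"
      using sum_bounded_above[of "nbr G z \<inter> A0" x 1] x1 by simp
    also have "\<dots> \<le> real (card A0)" using fin by (simp add: card_mono)
    finally show ?thesis using k0 by simp
  qed
  have split: "\<rho> * x z = (\<Sum>w\<in>nbr G z \<inter> A0. x w) + (\<Sum>w\<in>nbr G z - A0. x w)" for z
    unfolding eig using finN[of z] by (subst sum.Int_Diff[of _ _ A0]) auto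
  have main: "\<rho>\<^sup>2 * x v \<le> k0 * (\<rho> + D) + \<eta> * D"
    if \<eta>: "0 \<le> \<eta>" "\<And>z. z \<notin> A0 \<Longrightarrow> x z \<le> \<eta>" and v: "v \<notin> A0" for \<eta> v
  proof -
    have z: "\<rho> * x z \<le> k0 + \<eta> * real (card (nbr G z - A0))" for z
    proof -
      have "(\<Sum>w\<in>nbr G z - A0. x w) \<le> real (card (nbr G z - A0)) * \<eta>"
        using \<eta>(2) by (intro sum_bounded_above) auto
      then show ?thesis using split[of z] in_A0[of z] by (simp add: mult.commute)
    qed
    have sub1: "Pair v ` (nbr G v - A0) \<subseteq> ?A" using v by (auto simp: arcs_def nbr_def)
    have c1: "real (card (nbr G v - A0)) \<le> D"
    proof -
      have "card (nbr G v - A0) = card (Pair v ` (nbr G v - A0))" by (simp add: card_image inj_on_def)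
      also have "\<dots> \<le> card ?A" using sub1 finA by (intro card_mono) auto
      finally show ?thesis using D by linarith
    qed
    have c2: "(\<Sum>w\<in>nbr G v - A0. real (card (nbr G w - A0))) \<le> D"
    proof -
      have "(\<Sum>w\<in>nbr G v - A0. real (card (nbr G w - A0))) = real (card (Sigma (nbr G v - A0) (\<lambda>w. nbr G w - A0)))"
        using finN by (subst card_SigmaI) auto
      moreover have "card (Sigma (nbr G v - A0) (\<lambda>w. nbr G w - A0)) \<le> card ?A"
        using finA by (intro card_mono) (auto simp: arcs_def nbr_def)
      ultimately show ?thesis using D by linarith
    qed
    have "\<rho>\<^sup>2 * x v = \<rho> * (\<Sum>w\<in>nbr G v \<inter> A0. x w) + (\<Sum>w\<in>nbr G v - A0. \<rho> * x w)"
      using split[of v] by (simp add: power2_eq_square sum_distrib_left algebra_simps)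
    also have "\<dots> \<le> \<rho> * k0 + (\<Sum>w\<in>nbr G v - A0. k0 + \<eta> * real (card (nbr G w - A0)))"
      using in_A0 z rho0 by (intro add_mono sum_mono mult_left_mono) auto
    also have "\<dots> = \<rho> * k0 + k0 * real (card (nbr G v - A0)) + \<eta> * (\<Sum>w\<in>nbr G v - A0. real (card (nbr G w - A0)))"
      by (simp add: sum.distrib sum_distrib_left mult.commute)
    also have "\<dots> \<le> \<rho> * k0 + k0 * D + \<eta> * D"
      using mult_left_mono[OF c1 k00] mult_left_mono[OF c2 \<eta>(1)] by linarith
    finally show ?thesis by (simp add: algebra_simps)
  qed
  \<comment> \<open>The vertex v is inserted because it need not lie in the graph; this keeps the
    set nonempty.\<close>
  let ?R = "x ` (insert v (\<Union>G) - A0)"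
  define \<eta> where "\<eta> = Max ?R"
  have fR: "finite ?R" using finV by auto
  have neR: "?R \<noteq> {}" using v by auto
  have "\<eta> \<in> ?R" unfolding \<eta>_def using fR neR by (rule Max_in)
  then obtain v1 where v1: "\<eta> = x v1" "v1 \<notin> A0" by auto
  have \<eta>0: "0 \<le> \<eta>" using v1 x0 by simp
  have le: "x z \<le> \<eta>" if "z \<notin> A0" for z
  proof (cases "z \<in> \<Union>G")
    case True
    then have "x z \<in> ?R" using that by auto
    then show ?thesis unfolding \<eta>_def using fR by (rule Max_ge[rotated])
  next
    case False
    then show ?thesis using x_outside \<eta>0 by simp
  qed
  have "\<rho>\<^sup>2 * \<eta> \<le> k0 * (\<rho> + D) + \<eta> * D" using main[OF \<eta>0 le v1(2)] v1(1) by simp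
  then have "\<eta> \<le> k0 * (\<rho> + D) / (\<rho>\<^sup>2 - D)" using small by (simp add: field_simps)
  then show ?thesis using le[OF v] by linarith
qed

text \<open>With D at most \<open>\<rho>\<^sup>2 / (32 * k0)\<close> all entries off A0 are at most
  1/16 + 1/16. Thus the set of entries at least 1/4, which depends on x alone, inherits the size
  bound of any cover A0.\<close>

lemma core_subset_cover:
  fixes A0 :: "nat set" and k0 :: real
  assumes fin: "finite A0" and k0: "real (card A0) \<le> k0" and k01: "1 \<le> k0"
    and D: "32 * k0 * real (card (arcs G \<inter> (- A0) \<times> (- A0))) \<le> m" and big: "32 * k0 \<le> \<rho>"
  shows "{v. 1 / 4 \<le> x v} \<subseteq> A0"
proof
  fix v assume v: "v \<in> {v. 1 / 4 \<le> x v}"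
  show "v \<in> A0"
  proof (rule ccontr)
    assume nv: "v \<notin> A0"
    let ?D = "\<rho>\<^sup>2 / (32 * k0)"
    have rp: "0 < \<rho>\<^sup>2" using rho0 by simp
    have kp: "0 < k0" using k01 by simp
    have 1: "real (card (arcs G \<inter> (- A0) \<times> (- A0))) \<le> ?D"
      using D rho_sq kp by (simp add: field_simps)
    have d32: "?D \<le> \<rho>\<^sup>2 / 32" using k01 rp by (simp add: field_simps)
    then have 2: "?D < \<rho>\<^sup>2" using rp by linarith
    have "x v \<le> k0 * (\<rho> + ?D) / (\<rho>\<^sup>2 - ?D)" by (rule off_set_bound[OF fin k0 1 2 nv])
    also have "\<dots> \<le> k0 * (\<rho> + ?D) / (\<rho>\<^sup>2 / 2)"
    proof (rule divide_left_mono)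
      show "\<rho>\<^sup>2 / 2 \<le> \<rho>\<^sup>2 - ?D" using d32 rp by linarith
      show "0 \<le> k0 * (\<rho> + ?D)" using kp rho0 by (intro mult_nonneg_nonneg add_nonneg_nonneg) auto
      show "0 < (\<rho>\<^sup>2 - ?D) * (\<rho>\<^sup>2 / 2)" using 2 rp by (intro mult_pos_pos) auto
    qed
    also have "\<dots> = 2 * k0 / \<rho> + 1 / 16" using rho0 kp by (simp add: field_simps power2_eq_square)
    also have "\<dots> \<le> 1 / 16 + 1 / 16" using big rho0 by (simp add: field_simps)
    finally show False using v by simp
  qed
qed

end

text \<open>The threshold \<open>1 / 4\<close> is arbitrary: entries turn out to be either \<open>1 - O(1 / \<rho>)\<close> or \<open>O(1 / \<rho>)\<close>.\<close>

locale core_graph = perron_graph +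
  fixes k0 :: real and A :: "nat set"
  assumes A_eq: "A = {v. 1 / 4 \<le> x v}" and cardA: "real (card A) \<le> k0" and k01: "1 \<le> k0"
    and big: "6000 * k0 ^ 5 \<le> \<rho>"
begin

abbreviation "K2 \<equiv> 10 * k0\<^sup>2"
abbreviation "K3 \<equiv> 330 * k0 ^ 3"

section \<open>Entries on and off the core\<close>

lemma k0_pows: "1 \<le> k0 ^ n"
  using k01 by (rule one_le_power)

lemma rho_ge: "6000 * k0 ^ 3 \<le> \<rho>" "6000 * k0\<^sup>2 \<le> \<rho>" "6000 * k0 \<le> \<rho>" "6000 \<le> \<rho>"
proof -
  have "k0 ^ 3 \<le> k0 ^ 5" "k0\<^sup>2 \<le> k0 ^ 5" "k0 ^ 1 \<le> k0 ^ 5" "1 \<le> k0 ^ 5"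
    using k01 power_increasing[of 3 5 k0] power_increasing[of 2 5 k0] power_increasing[of 1 5 k0]
      power_increasing[of 0 5 k0] by (simp_all del: power_one_right)
  then show "6000 * k0 ^ 3 \<le> \<rho>" "6000 * k0\<^sup>2 \<le> \<rho>" "6000 * k0 \<le> \<rho>" "6000 \<le> \<rho>" using big by simp_all
qed

lemma A_sub: "A \<subseteq> \<Union>G"
  using x_outside by (force simp: A_eq)

lemma finAA: "finite A" using A_sub finV finite_subset by metis

lemma u_in_A: "u \<in> A" using xu by (simp add: A_eq)

lemma cardA1: "1 \<le> card A" using u_in_A finAA by (metis One_nat_def Suc_leI card_gt_0_iff empty_iff)

lemma off_A: "v \<notin> A \<Longrightarrow> x v < 1 / 4" by (simp add: A_eq)

text \<open>Two entries below 1/4 never overshoot, so each overshooting arc has an end in A, and the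
  entries seen from a vertex of A sum to at most \<rho>. This improves the excess from o(m) to
  O(\<rho>).\<close>

lemma excess_core: "excess w \<le> 2 * k0 * \<rho>"
proof -
  let ?N = "nbr G w"
  let ?f = "\<lambda>v z. if v \<in> A then x z else 0"
  have "excess w \<le> (\<Sum>(v, z)\<in>arcs G \<inter> ?N \<times> ?N. ?f v z + ?f z v)"
    unfolding excess_def
  proof (intro sum_mono, clarify)
    fix v z assume "(v, z) \<in> arcs G"
    show "max 0 (x v + x z - 1) \<le> ?f v z + ?f z v"
      using x0[of v] x0[of z] x1[of v] x1[of z] off_A[of v] off_A[of z] by auto
  qed
  also have "\<dots> \<le> (\<Sum>(v, z)\<in>arcs G. ?f v z + ?f z v)"
    using finA x0 by (intro sum_mono2) auto
  also have "\<dots> = 2 * (\<Sum>(v, z)\<in>arcs G. ?f v z)"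
    using sum_arcs_swap[of ?f G] by (simp add: sum.distrib case_prod_beta)
  also have "(\<Sum>(v, z)\<in>arcs G. ?f v z) = (\<Sum>v\<in>\<Union>G. if v \<in> A then \<rho> * x v else 0)"
  proof -
    have "(\<Sum>(v, z)\<in>arcs G. ?f v z) = (\<Sum>v\<in>\<Union>G. \<Sum>z\<in>nbr G v. ?f v z)"
      by (subst sum_arcs[OF G]) (simp only: case_prod_conv)
    also have "\<dots> = (\<Sum>v\<in>\<Union>G. if v \<in> A then \<rho> * x v else 0)"
      by (intro sum.cong) (auto simp: eig)
    finally show ?thesis .
  qed
  also have "\<dots> = (\<Sum>v\<in>A. \<rho> * x v)"
    using finV A_sub by (intro sum.mono_neutral_cong_right) auto
  also have "\<dots> \<le> (\<Sum>v\<in>A. \<rho>)" using x1 rho0 by (intro sum_mono) (simp add: mult_left_le)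
  also have "\<dots> = real (card A) * \<rho>" by simp
  also have "\<dots> \<le> k0 * \<rho>" using cardA rho0 by (intro mult_right_mono) auto
  finally show ?thesis by simp
qed

lemma m_ge: "\<rho>\<^sup>2 / 2 \<le> m"
proof -
  have "\<rho>\<^sup>2 \<le> m + k0 * \<rho>" using rho_sq_le excess_core[of u] by simp
  moreover have "k0 * \<rho> \<le> (\<rho> / 2) * \<rho>" using rho_ge(3) k01 rho0 by (intro mult_right_mono) auto
  ultimately show ?thesis by (simp add: power2_eq_square)
qed

lemma off_arcs: "real (card (arcs G \<inter> (- A) \<times> (- A))) \<le> 4 * k0 * \<rho>"
proof -
  have "1 / 2 * real (card (arcs G \<inter> (- A) \<times> (- A))) \<le> excess u"
  proof (rule budget_u)
    fix p assume "p \<in> arcs G \<inter> (- A) \<times> (- A)"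
    then have "x (fst p) < 1 / 4" "x (snd p) < 1 / 4" using off_A by auto
    then show "1 / 2 \<le> loss u p" using loss_ge[of p u] by linarith
  qed auto
  then show ?thesis using excess_core[of u] by simp
qed

text \<open>Bootstrap: the improved excess leaves only O(\<rho>) arcs off A, and
  \<open>off_set_bound\<close> with this D lowers the threshold 1/4 to O(1 / \<rho>).\<close>

lemma x_off_le:
  assumes "v \<notin> A"
  shows "x v \<le> K2 / \<rho>"
proof -
  have s: "4 * k0 * \<rho> \<le> \<rho>\<^sup>2 / 2"
    using rho_ge(3) rho0 k01 by (simp add: power2_eq_square)
  have p: "0 < \<rho>\<^sup>2" using rho0 by simp
  have "x v \<le> k0 * (\<rho> + 4 * k0 * \<rho>) / (\<rho>\<^sup>2 - 4 * k0 * \<rho>)"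
  proof (rule off_set_bound[OF finAA cardA off_arcs])
    show "4 * k0 * \<rho> < \<rho>\<^sup>2" using s p by linarith
  qed (rule assms)
  also have "\<dots> \<le> k0 * (\<rho> + 4 * k0 * \<rho>) / (\<rho>\<^sup>2 / 2)"
  proof (rule divide_left_mono)
    show "\<rho>\<^sup>2 / 2 \<le> \<rho>\<^sup>2 - 4 * k0 * \<rho>" using s by linarith
    show "0 \<le> k0 * (\<rho> + 4 * k0 * \<rho>)" using k01 rho0 by (intro mult_nonneg_nonneg add_nonneg_nonneg) auto
    have "0 < \<rho>\<^sup>2 - 4 * k0 * \<rho>" using s p by linarith
    then show "0 < (\<rho>\<^sup>2 - 4 * k0 * \<rho>) * (\<rho>\<^sup>2 / 2)" using p by (intro mult_pos_pos) auto
  qed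
  also have "\<dots> = 2 * k0 * (1 + 4 * k0) / \<rho>" using rho0 by (simp add: field_simps power2_eq_square)
  also have "\<dots> \<le> K2 / \<rho>"
  proof -
    have "k0 * 1 \<le> k0 * k0" using k01 by (intro mult_left_mono) auto
    then have "2 * k0 * (1 + 4 * k0) \<le> K2" by (simp add: power2_eq_square algebra_simps)
    then show ?thesis using rho0 by (intro divide_right_mono) auto
  qed
  finally show ?thesis .
qed

lemma sum_in_A_le: "(\<Sum>w\<in>nbr G z \<inter> A. x w) \<le> real (card (nbr G z \<inter> A))"
  using sum_bounded_above[of "nbr G z \<inter> A" x 1] x1 by simp

lemma card_in_A_le: "real (card (nbr G z \<inter> A)) \<le> k0"
  using card_mono[OF finAA, of "nbr G z \<inter> A"] cardA by simp

lemma eig_split: "\<rho> * x z = (\<Sum>w\<in>nbr G z \<inter> A. x w) + (\<Sum>w\<in>nbr G z - A. x w)"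
  unfolding eig using finN[of z] by (subst sum.Int_Diff[of _ _ A]) auto

text \<open>At least \<rho> / 4 must be collected around a; the core supplies at most k0 and every
  other neighbour O(1 / \<rho>), so order \<open>\<rho>\<^sup>2\<close> neighbours are
  required.\<close>

lemma deg_off_ge:
  assumes "a \<in> A"
  shows "\<rho>\<^sup>2 / (8 * K2) \<le> real (card (nbr G a - A))"
proof -
  have K2p: "0 < K2" using k01 by simp
  have "(\<Sum>w\<in>nbr G a - A. x w) \<le> real (card (nbr G a - A)) * (K2 / \<rho>)"
    using x_off_le by (intro sum_bounded_above) auto
  moreover have "(\<Sum>w\<in>nbr G a \<inter> A. x w) \<le> k0" using sum_in_A_le[of a] card_in_A_le[of a] by linarith
  moreover have "\<rho> * (1 / 4) \<le> \<rho> * x a" using assms rho0 by (intro mult_left_mono) (auto simp: A_eq)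
  ultimately have "\<rho> / 4 - k0 \<le> real (card (nbr G a - A)) * (K2 / \<rho>)" using eig_split[of a] by linarith
  moreover have "\<rho> / 8 \<le> \<rho> / 4 - k0" using rho_ge(3) k01 by simp
  ultimately have "\<rho> / 8 \<le> real (card (nbr G a - A)) * (K2 / \<rho>)" by linarith
  then have "\<rho> / 8 * \<rho> \<le> real (card (nbr G a - A)) * K2" using rho0 by (simp add: field_simps)
  then show ?thesis using K2p by (simp add: field_simps power2_eq_square)
qed

text \<open>Seen from u, an arc from a to a vertex off A loses at least 1/2 if that vertex is not
  adjacent to u, and at least c otherwise. The budget is O(\<rho>) while a has order
  \<open>\<rho>\<^sup>2\<close> such arcs, so c is O(1 / \<rho>).\<close>

lemma x_on_ge:
  assumes a: "a \<in> A"
  shows "1 - K3 / \<rho> \<le> x a"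
proof -
  have K2p: "0 < K2" using k01 by simp
  define c where "c = 1 - x a - K2 / \<rho>"
  let ?T1 = "Pair a ` ((nbr G a - A) - nbr G u)"
  let ?T2 = "Pair a ` ((nbr G a - A) \<inter> nbr G u)"
  have c1: "card ?T1 = card ((nbr G a - A) - nbr G u)" and c2: "card ?T2 = card ((nbr G a - A) \<inter> nbr G u)"
    by (simp_all add: card_image inj_on_def)
  have "1 / 2 * real (card ?T1) \<le> excess u"
  proof (rule budget_u)
    show "?T1 \<subseteq> arcs G" by (auto simp: arcs_def nbr_def)
    fix p assume "p \<in> ?T1"
    then obtain v where v: "p = (a, v)" "v \<notin> A" "v \<notin> nbr G u" by auto
    then show "1 / 2 \<le> loss u p" using off_A[of v] loss_ge_snd[of p u] by simp
  qed
  then have T1: "real (card ?T1) \<le> 4 * k0 * \<rho>" using excess_core[of u] by simp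
  have "c * real (card ?T2) \<le> excess u"
  proof (rule budget_u)
    show "?T2 \<subseteq> arcs G" by (auto simp: arcs_def nbr_def)
    fix p assume "p \<in> ?T2"
    then obtain v where v: "p = (a, v)" "v \<notin> A" "v \<in> nbr G u" by auto
    then show "c \<le> loss u p" using x_off_le[of v] loss_ge[of p u] unfolding c_def by simp
  qed
  then have T2: "c * real (card ?T2) \<le> 2 * k0 * \<rho>" using excess_core[of u] by simp
  have "card (nbr G a - A) = card ((nbr G a - A) \<inter> nbr G u) + card ((nbr G a - A) - nbr G u)"
    using finN[of a] by (intro card_Int_Diff) auto
  then have sum: "real (card (nbr G a - A)) = real (card ?T2) + real (card ?T1)" unfolding c1 c2 by simp
  have "4 * k0 * \<rho> \<le> \<rho>\<^sup>2 / (16 * K2)"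
  proof -
    have "640 * k0 ^ 3 \<le> \<rho>" using rho_ge(1) k0_pows[of 3] by linarith
    then have "640 * k0 ^ 3 * \<rho> \<le> \<rho> * \<rho>" using rho0 by (intro mult_right_mono) auto
    then show ?thesis using K2p by (simp add: field_simps power2_eq_square power3_eq_cube)
  qed
  then have ge: "\<rho>\<^sup>2 / (16 * K2) \<le> real (card ?T2)"
    using deg_off_ge[OF a] sum T1 by (simp add: field_simps)
  have "c \<le> 32 * k0 * K2 / \<rho>"
  proof (cases "0 \<le> c")
    case True
    have "c * (\<rho>\<^sup>2 / (16 * K2)) \<le> c * real (card ?T2)" using ge True by (rule mult_left_mono)
    then have "c * (\<rho>\<^sup>2 / (16 * K2)) \<le> 2 * k0 * \<rho>" using T2 by linarith
    then have "c * \<rho>\<^sup>2 \<le> 2 * k0 * \<rho> * (16 * K2)" using K2p by (simp add: field_simps)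
    then have "c * \<rho> \<le> 2 * k0 * (16 * K2)" using rho0 by (simp add: power2_eq_square)
    then show ?thesis using rho0 by (simp add: field_simps)
  next
    case False
    moreover have "0 \<le> 32 * k0 * K2 / \<rho>"
      using rho0 k01 by (intro divide_nonneg_pos mult_nonneg_nonneg) auto
    ultimately show ?thesis by linarith
  qed
  then have "1 - x a \<le> (32 * k0 * K2 + K2) / \<rho>" by (simp add: c_def add_divide_distrib)
  also have "\<dots> \<le> K3 / \<rho>"
  proof -
    have "k0\<^sup>2 \<le> k0 ^ 3" using k01 by (auto intro: power_increasing)
    then have "32 * k0 * K2 + K2 \<le> K3" by (simp add: power2_eq_square power3_eq_cube)
    then show ?thesis using rho0 by (intro divide_right_mono) auto
  qed
  finally show ?thesis by simp
qed

section \<open>Edge counts around the core\<close>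

definition R :: "nat set" where "R = \<Union>G - A"
definition B :: "nat set" where "B = {v\<in>R. A \<subseteq> nbr G v}"
text \<open>The exceptional outer vertices, attached to the core only in part. A vertex of R with no
  neighbour in A belongs to neither B nor Q; its edges are counted by \<open>hR\<close>
  alone.\<close>

definition Q :: "nat set" where "Q = {v\<in>R. nbr G v \<inter> A \<noteq> {} \<and> \<not> A \<subseteq> nbr G v}"
definition dA :: "nat \<Rightarrow> nat" where "dA v = card (nbr G v \<inter> A)"
definition eA :: nat where "eA = card {e\<in>G. e \<subseteq> A}"
definition hR :: nat where "hR = card {e\<in>G. e \<inter> A = {}}"

lemma finR: "finite R" "finite B" "finite Q"
proof -
  show R: "finite R" unfolding R_def using finV by (rule finite_Diff)
  show "finite B" "finite Q" using R by (simp_all add: B_def Q_def)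
qed

lemma sub_edge: "is_edge_set {e\<in>G. P e}" using G by (auto simp: is_edge_set_def)

lemma arcs_AA: "arcs {e\<in>G. e \<subseteq> A} = arcs G \<inter> A \<times> A" by (auto simp: arcs_def)
lemma arcs_RR: "arcs {e\<in>G. e \<inter> A = {}} = arcs G \<inter> (- A) \<times> (- A)" by (auto simp: arcs_def)

lemma card_arcs_AA: "card (arcs G \<inter> A \<times> A) = 2 * eA"
  using card_arcs[OF sub_edge, of "\<lambda>e. e \<subseteq> A"] by (simp add: arcs_AA eA_def)

lemma card_arcs_RR: "card (arcs G \<inter> (- A) \<times> (- A)) = 2 * hR"
  using card_arcs[OF sub_edge, of "\<lambda>e. e \<inter> A = {}"] by (simp add: arcs_RR hR_def)

lemma edge_count: "card G = eA + hR + (\<Sum>v\<in>R. dA v)"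
proof -
  let ?RA = "arcs G \<inter> (- A) \<times> A" and ?AR = "arcs G \<inter> A \<times> (- A)"
  have RA: "?RA = Sigma R (\<lambda>v. nbr G v \<inter> A)" by (auto simp: arcs_def nbr_def R_def)
  have cRA: "card ?RA = (\<Sum>v\<in>R. dA v)" unfolding RA dA_def using finR finN by (subst card_SigmaI) auto
  have "bij_betw (\<lambda>(v, w). (w, v)) ?RA ?AR"
    by (rule bij_betwI[where g="\<lambda>(v, w). (w, v)"]) (auto simp: arcs_def insert_commute)
  then have cAR: "card ?AR = card ?RA" by (simp add: bij_betw_same_card)
  have "arcs G = (arcs G \<inter> A \<times> A \<union> arcs G \<inter> (- A) \<times> (- A)) \<union> (?RA \<union> ?AR)" by auto
  then have "card (arcs G) = card (arcs G \<inter> A \<times> A \<union> arcs G \<inter> (- A) \<times> (- A)) + card (?RA \<union> ?AR)"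
    using finA by (subst card_Un_disjoint[symmetric]) auto
  also have "card (arcs G \<inter> A \<times> A \<union> arcs G \<inter> (- A) \<times> (- A)) = 2 * eA + 2 * hR"
    using finA card_arcs_AA card_arcs_RR by (subst card_Un_disjoint) auto
  also have "card (?RA \<union> ?AR) = 2 * (\<Sum>v\<in>R. dA v)"
    using finA cRA cAR by (subst card_Un_disjoint) auto
  finally show ?thesis using card_arcs[OF G] by simp
qed

lemma dA_B: "v \<in> B \<Longrightarrow> dA v = card A"
  by (simp add: B_def dA_def Int_absorb1)

lemma dA_Q: "v \<in> Q \<Longrightarrow> 1 \<le> dA v \<and> dA v < card A"
proof -
  assume v: "v \<in> Q"
  have "nbr G v \<inter> A \<subset> A" using v by (auto simp: Q_def)
  then have "dA v < card A" unfolding dA_def by (rule psubset_card_mono[OF finAA])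
  moreover have "dA v > 0" using v finAA by (simp add: Q_def dA_def card_gt_0_iff)
  ultimately show "1 \<le> dA v \<and> dA v < card A" by simp
qed

lemma R_sum:
  fixes f :: "nat \<Rightarrow> 'c::comm_monoid_add"
  assumes "\<And>v. v \<in> R \<Longrightarrow> nbr G v \<inter> A = {} \<Longrightarrow> f v = 0"
  shows "(\<Sum>v\<in>R. f v) = (\<Sum>v\<in>B. f v) + (\<Sum>v\<in>Q. f v)"
proof -
  have "A \<noteq> {}" using u_in_A by auto
  have "(\<Sum>v\<in>R. f v) = (\<Sum>v\<in>B \<union> Q. f v)"
    using assms finR by (intro sum.mono_neutral_right) (auto simp: B_def Q_def)
  also have "\<dots> = (\<Sum>v\<in>B. f v) + (\<Sum>v\<in>Q. f v)"
    using finR by (intro sum.union_disjoint) (auto simp: B_def Q_def)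
  finally show ?thesis .
qed

text \<open>Each v in Q has a neighbour in A and misses some w in A, and the arc between them loses
  at least 1/2 at base w. Since x w is 1 - O(1 / \<rho>), the budget at w is O(\<rho>).\<close>

lemma card_Q_le: "real (card Q) \<le> k0 * (1324 * k0 ^ 3 * \<rho>)"
proof -
  define T where "T w = arcs G \<inter> A \<times> (- A - nbr G w)" for w
  have T: "real (card (T w)) \<le> 1324 * k0 ^ 3 * \<rho>" if w: "w \<in> A" for w
  proof -
    have "1 / 2 * real (card (T w)) \<le> 2 * m * (1 - x w) + excess w"
    proof (rule budget_high)
      fix p assume "p \<in> T w"
      then have "snd p \<notin> A" "snd p \<notin> nbr G w" by (auto simp: T_def)
      then show "1 / 2 \<le> loss w p" using off_A[of "snd p"] loss_ge_snd[of p w] by linarith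
    qed (auto simp: T_def)
    also have "2 * m * (1 - x w) \<le> 2 * \<rho>\<^sup>2 * (K3 / \<rho>)"
      using rho_sq x_on_ge[OF w] x1[of w] by (intro mult_mono) auto
    also have "2 * \<rho>\<^sup>2 * (K3 / \<rho>) = 660 * k0 ^ 3 * \<rho>" using rho0 by (simp add: field_simps power2_eq_square)
    also have "excess w \<le> 2 * k0 ^ 3 * \<rho>"
    proof -
      have "k0 ^ 1 \<le> k0 ^ 3" using k01 by (intro power_increasing) auto
      then have "k0 * \<rho> \<le> k0 ^ 3 * \<rho>" using rho0 by (intro mult_right_mono) auto
      then show ?thesis using excess_core[of w] by simp
    qed
    finally show ?thesis by (simp add: mult.commute mult.left_commute)
  qed
  have fT: "finite (T w)" for w using finA by (simp add: T_def)
  have "Q \<subseteq> (\<Union>w\<in>A. snd ` T w)"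
  proof
    fix v assume v: "v \<in> Q"
    then obtain a w where aw: "a \<in> A" "a \<in> nbr G v" "w \<in> A" "w \<notin> nbr G v" by (auto simp: Q_def)
    then have "(a, v) \<in> T w" using v by (auto simp: T_def arcs_def Q_def R_def nbr_def insert_commute)
    then show "v \<in> (\<Union>w\<in>A. snd ` T w)" using aw(3) by force
  qed
  then have "card Q \<le> card (\<Union>w\<in>A. snd ` T w)" using finAA fT by (intro card_mono) auto
  also have "\<dots> \<le> (\<Sum>w\<in>A. card (snd ` T w))" using finAA by (rule card_UN_le)
  also have "\<dots> \<le> (\<Sum>w\<in>A. card (T w))" using fT by (intro sum_mono card_image_le)
  finally have "real (card Q) \<le> (\<Sum>w\<in>A. real (card (T w)))" by (metis of_nat_mono of_nat_sum)
  also have "\<dots> \<le> real (card A) * (1324 * k0 ^ 3 * \<rho>)" using T by (intro sum_bounded_above) auto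
  also have "\<dots> \<le> k0 * (1324 * k0 ^ 3 * \<rho>)" using cardA rho0 k01 by (intro mult_right_mono) auto
  finally show ?thesis .
qed

lemma eA_le: "real eA \<le> k0\<^sup>2"
proof -
  have "card (arcs G \<inter> A \<times> A) \<le> card (A \<times> A)" using finAA by (intro card_mono) auto
  then have "2 * eA \<le> card A * card A" by (simp add: card_arcs_AA card_cartesian_product)
  then have "real (2 * eA) \<le> real (card A) * real (card A)" by (metis of_nat_mono of_nat_mult)
  moreover have "real (card A) * real (card A) \<le> k0 * k0" using cardA k01 by (intro mult_mono) auto
  ultimately show ?thesis by (simp add: power2_eq_square)
qed

text \<open>All edges other than those between A and B number O(\<rho>), against
  \<open>m \<ge> \<rho>\<^sup>2 / 2\<close>. This supplies the v(F) common neighbours of A that put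
  the induced core into \<open>M_fam\<close>.\<close>

lemma card_B_ge:
  assumes "4 * k0 * n \<le> \<rho>"
  shows "n \<le> real (card B)"
proof -
  have "real (\<Sum>v\<in>R. dA v) = real (card B) * real (card A) + real (\<Sum>v\<in>Q. dA v)"
    using R_sum[of dA] by (simp add: dA_def dA_B[unfolded dA_def])
  moreover have "(\<Sum>v\<in>Q. dA v) \<le> card Q * card A"
    using sum_bounded_above[of Q dA "card A"] dA_Q by force
  then have "real (\<Sum>v\<in>Q. dA v) \<le> real (card Q) * real (card A)" by (metis of_nat_mono of_nat_mult)
  moreover have "real (card Q) * real (card A) \<le> k0 * (1324 * k0 ^ 3 * \<rho>) * k0"
    using card_Q_le cardA rho0 k01 by (intro mult_mono) auto
  moreover have "real (card B) * real (card A) \<le> real (card B) * k0" using cardA by (intro mult_left_mono) auto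
  moreover have "real hR \<le> 2 * k0 * \<rho>" using off_arcs unfolding card_arcs_RR by (simp add: mult_ac)
  ultimately have "m \<le> k0\<^sup>2 + 2 * k0 * \<rho> + real (card B) * k0 + k0 * (1324 * k0 ^ 3 * \<rho>) * k0"
    using edge_count eA_le by simp
  then have 1: "\<rho>\<^sup>2 / 2 \<le> k0\<^sup>2 + 2 * k0 * \<rho> + real (card B) * k0 + 1324 * k0 ^ 5 * \<rho>"
    using m_ge by (simp add: algebra_simps power2_eq_square eval_nat_numeral)
  have k5: "k0 ^ 1 \<le> k0 ^ 5" using k01 by (intro power_increasing) auto
  have "k0\<^sup>2 \<le> k0 * \<rho>" using rho_ge(3) k01 unfolding power2_eq_square by (intro mult_left_mono) auto
  moreover have "k0 * \<rho> \<le> k0 ^ 5 * \<rho>" using k5 rho0 by (intro mult_right_mono) auto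
  ultimately have half: "\<rho>\<^sup>2 / 2 \<le> real (card B) * k0 + 1327 * (k0 ^ 5 * \<rho>)" using 1 by linarith
  have "6000 * k0 ^ 5 * \<rho> \<le> \<rho> * \<rho>" using big rho0 by (intro mult_right_mono) auto
  moreover have "0 \<le> k0 ^ 5 * \<rho>" using k01 rho0 by simp
  ultimately have "1327 * (k0 ^ 5 * \<rho>) \<le> \<rho>\<^sup>2 / 4" unfolding power2_eq_square by linarith
  then have "\<rho>\<^sup>2 / 4 \<le> real (card B) * k0" using half by linarith
  moreover have "4 * k0 * n \<le> \<rho>\<^sup>2"
  proof -
    have "\<rho> * 1 \<le> \<rho> * \<rho>" using rho_ge(4) rho0 by (intro mult_left_mono) auto
    then show ?thesis using assms by (simp add: power2_eq_square)
  qed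
  ultimately have "k0 * n \<le> k0 * real (card B)" by (simp add: mult_ac)
  then show ?thesis using k01 by simp
qed

section \<open>The eigenvector equation summed over the core\<close>

definition S :: "nat \<Rightarrow> real" where "S v = (\<Sum>w\<in>nbr G v \<inter> A. x w)"
definition XA :: real where "XA = (\<Sum>a\<in>A. (x a)\<^sup>2)"

lemma S_bounds: "0 \<le> S v" "S v \<le> real (dA v)"
  using x0 sum_in_A_le[of v] by (auto simp: S_def dA_def intro: sum_nonneg)

text \<open>Eliminates the outer entries. Summing the eigenvector equation over A with weights x
  gives the sum of \<open>x v * S v\<close> over R; then \<rho> times x v is S v plus the
  contribution of edges inside R, and each of their arcs costs at most
  \<open>K2\<^sup>2 / \<rho>\<close>.\<close>

lemma core_identity:
  "\<rho> * (\<rho> * XA - quad {e\<in>G. e \<subseteq> A} x) \<le> (\<Sum>v\<in>R. (S v)\<^sup>2) + 2 * real hR * (K2\<^sup>2 / \<rho>)"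
proof -
  have q: "quad {e\<in>G. e \<subseteq> A} x = (\<Sum>a\<in>A. x a * (\<Sum>b\<in>nbr G a \<inter> A. x b))"
  proof -
    have "arcs G \<inter> A \<times> A = Sigma A (\<lambda>a. nbr G a \<inter> A)" by (auto simp: arcs_def nbr_def)
    then have "quad {e\<in>G. e \<subseteq> A} x = (\<Sum>a\<in>A. \<Sum>b\<in>nbr G a \<inter> A. x a * x b)"
      unfolding quad_def arcs_AA using finAA finN by (simp add: sum.Sigma)
    then show ?thesis by (simp add: sum_distrib_left)
  qed
  have "\<rho> * XA - quad {e\<in>G. e \<subseteq> A} x = (\<Sum>a\<in>A. x a * (\<rho> * x a - (\<Sum>b\<in>nbr G a \<inter> A. x b)))"
    unfolding q XA_def by (simp add: sum_subtractf sum_distrib_left power2_eq_square algebra_simps)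
  also have "\<dots> = (\<Sum>a\<in>A. \<Sum>v\<in>nbr G a - A. x a * x v)"
  proof (intro sum.cong refl)
    fix a
    have "\<rho> * x a - (\<Sum>b\<in>nbr G a \<inter> A. x b) = (\<Sum>w\<in>nbr G a - A. x w)" using eig_split[of a] by simp
    then show "x a * (\<rho> * x a - (\<Sum>b\<in>nbr G a \<inter> A. x b)) = (\<Sum>v\<in>nbr G a - A. x a * x v)"
      by (simp add: sum_distrib_left)
  qed
  also have "\<dots> = (\<Sum>(a, v)\<in>Sigma A (\<lambda>a. nbr G a - A). x a * x v)"
    using finAA finN by (simp add: sum.Sigma)
  also have "\<dots> = (\<Sum>(v, a)\<in>Sigma R (\<lambda>v. nbr G v \<inter> A). x v * x a)"
    by (rule sum.reindex_bij_witness[where i="\<lambda>(v,w). (w,v)" and j="\<lambda>(v,w). (w,v)"])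
       (auto simp: R_def nbr_def insert_commute)
  also have "\<dots> = (\<Sum>v\<in>R. \<Sum>a\<in>nbr G v \<inter> A. x v * x a)"
    using finR finN by (simp add: sum.Sigma)
  also have "\<dots> = (\<Sum>v\<in>R. x v * S v)" by (simp add: S_def sum_distrib_left)
  finally have 1: "\<rho> * XA - quad {e\<in>G. e \<subseteq> A} x = (\<Sum>v\<in>R. x v * S v)" .
  have K: "0 \<le> K2" by simp
  have 2: "\<rho> * (x v * S v) \<le> (S v)\<^sup>2 + real (card (nbr G v - A)) * (K2\<^sup>2 / \<rho>)" if v: "v \<in> R" for v
  proof -
    let ?r = "\<Sum>w\<in>nbr G v - A. x w"
    have vA: "v \<notin> A" using v by (simp add: R_def)
    have r0: "0 \<le> ?r" using x0 by (intro sum_nonneg)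
    have r: "?r \<le> real (card (nbr G v - A)) * (K2 / \<rho>)" using x_off_le by (intro sum_bounded_above) auto
    have e: "\<rho> * x v = S v + ?r" using eig_split[of v] by (simp add: S_def)
    have "\<rho> * x v \<le> K2" using x_off_le[OF vA] rho0 by (simp add: field_simps)
    then have S: "S v \<le> K2" using e r0 by simp
    have "\<rho> * (x v * S v) = (S v)\<^sup>2 + ?r * S v"
      using e by (metis mult.assoc distrib_right power2_eq_square)
    also have "?r * S v \<le> (real (card (nbr G v - A)) * (K2 / \<rho>)) * K2"
      using r S S_bounds r0 rho0 by (intro mult_mono) auto
    finally show ?thesis by (simp add: power2_eq_square mult_ac)
  qed
  have 3: "(\<Sum>v\<in>R. real (card (nbr G v - A))) = 2 * real hR"
  proof -
    have "arcs G \<inter> (- A) \<times> (- A) = Sigma R (\<lambda>v. nbr G v - A)" by (auto simp: arcs_def nbr_def R_def)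
    then have "card (arcs G \<inter> (- A) \<times> (- A)) = (\<Sum>v\<in>R. card (nbr G v - A))"
      using finR finN by simp
    then have "(\<Sum>v\<in>R. card (nbr G v - A)) = 2 * hR" using card_arcs_RR by simp
    then show ?thesis by (metis of_nat_sum of_nat_mult of_nat_numeral)
  qed
  have "\<rho> * (\<Sum>v\<in>R. x v * S v) \<le> (\<Sum>v\<in>R. (S v)\<^sup>2 + real (card (nbr G v - A)) * (K2\<^sup>2 / \<rho>))"
    unfolding sum_distrib_left using 2 by (rule sum_mono)
  also have "\<dots> = (\<Sum>v\<in>R. (S v)\<^sup>2) + (\<Sum>v\<in>R. real (card (nbr G v - A))) * (K2\<^sup>2 / \<rho>)"
    by (simp only: sum.distrib sum_distrib_right)
  finally show ?thesis unfolding 1 3 by simp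
qed

lemma XA_ge: "real (card A) * (1 - 2 * K3 / \<rho>) \<le> XA"
proof -
  have "1 - 2 * K3 / \<rho> \<le> (x a)\<^sup>2" if "a \<in> A" for a
  proof -
    have p: "0 \<le> 1 - K3 / \<rho>"
      using rho_ge(1) k0_pows[of 3] rho0 by (simp add: field_simps)
    have "1 - 2 * K3 / \<rho> \<le> (1 - K3 / \<rho>)\<^sup>2" by (simp add: power2_diff)
    also have "\<dots> \<le> (x a)\<^sup>2" using x_on_ge[OF that] p by (intro power_mono)
    finally show ?thesis .
  qed
  then show ?thesis unfolding XA_def
    using sum_bounded_below[of A "1 - 2 * K3 / \<rho>" "\<lambda>a. (x a)\<^sup>2"] by simp
qed

lemma quad_A_le: "quad {e\<in>G. e \<subseteq> A} x \<le> 2 * real eA"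
proof -
  have "quad {e\<in>G. e \<subseteq> A} x \<le> (\<Sum>p\<in>arcs G \<inter> A \<times> A. 1)"
    unfolding quad_def arcs_AA using x0 x1 by (intro sum_mono) (auto intro: mult_le_one)
  then show ?thesis by (simp add: card_arcs_AA)
qed

text \<open>Cauchy-Schwarz at each outer vertex gives \<open>dA v * XA\<close>, and the outer
  degrees into A sum to at most m.\<close>

lemma sum_S_sq_le: "(\<Sum>v\<in>R. (S v)\<^sup>2) \<le> m * XA"
proof -
  have XA0: "0 \<le> XA" by (auto simp: XA_def intro: sum_nonneg)
  have "(S v)\<^sup>2 \<le> real (dA v) * XA" for v
  proof -
    have "(S v)\<^sup>2 \<le> real (card (nbr G v \<inter> A)) * (\<Sum>w\<in>nbr G v \<inter> A. (x w)\<^sup>2)"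
      unfolding S_def by (rule sum_sq_le_card)
    also have "(\<Sum>w\<in>nbr G v \<inter> A. (x w)\<^sup>2) \<le> XA"
      unfolding XA_def using finAA by (intro sum_mono2) auto
    finally show ?thesis by (simp add: dA_def mult_left_mono)
  qed
  then have "(\<Sum>v\<in>R. (S v)\<^sup>2) \<le> (\<Sum>v\<in>R. real (dA v) * XA)" by (intro sum_mono)
  also have "\<dots> = real (\<Sum>v\<in>R. dA v) * XA" by (simp add: sum_distrib_right)
  also have "\<dots> \<le> m * XA" using edge_count XA0 by (intro mult_right_mono) auto
  finally show ?thesis .
qed

text \<open>Dividing the core identity by XA, which is close to card A, gives
  \<open>\<rho>\<^sup>2 \<le> m + 2 * \<rho> * y + O(1)\<close> with y the ratio of the core;
  completing the square moves y outside the root.\<close>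

lemma rho_upper: "\<rho> \<le> sqrt (m + 3500 * k0 ^ 5) + real eA / real (card A)"
proof -
  let ?s = "real (card A)"
  define y where "y = real eA / ?s"
  have s: "1 \<le> ?s" using cardA1 by simp
  have y0: "0 \<le> y" by (simp add: y_def)
  have yk: "y \<le> k0\<^sup>2"
  proof -
    have "y \<le> real eA / 1" unfolding y_def using s by (intro divide_left_mono) auto
    then show ?thesis using eA_le by simp
  qed
  have half: "2 * K3 / \<rho> \<le> 1 / 2" using rho_ge(1) k0_pows[of 3] rho0 by (simp add: field_simps)
  have XAp: "?s / 2 \<le> XA"
  proof -
    have "?s * (1 / 2) \<le> ?s * (1 - 2 * K3 / \<rho>)" using half s by (intro mult_left_mono) auto
    then show ?thesis using XA_ge by linarith
  qed
  then have XA0: "0 < XA" using s by linarith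
  have "\<rho>\<^sup>2 * XA \<le> \<rho> * quad {e\<in>G. e \<subseteq> A} x + m * XA + 2 * real hR * (K2\<^sup>2 / \<rho>)"
    using core_identity sum_S_sq_le by (simp add: algebra_simps power2_eq_square)
  also have "\<rho> * quad {e\<in>G. e \<subseteq> A} x \<le> \<rho> * (2 * real eA)" using quad_A_le rho0 by (intro mult_left_mono) auto
  also have "2 * real hR * (K2\<^sup>2 / \<rho>) \<le> 4 * k0 * \<rho> * (K2\<^sup>2 / \<rho>)"
    using off_arcs rho0 by (intro mult_right_mono) (auto simp: card_arcs_RR)
  also have "4 * k0 * \<rho> * (K2\<^sup>2 / \<rho>) = 400 * k0 ^ 5" using rho0 by (simp add: eval_nat_numeral)
  finally have 1: "\<rho>\<^sup>2 * XA \<le> \<rho> * (2 * real eA) + m * XA + 400 * k0 ^ 5" by simp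
  \<comment> \<open>Replacing card A by XA costs a factor 1 / (1 - O(1 / \<rho>)); after
    multiplication by \<rho> the overshoot is still bounded.\<close>
  have e: "\<rho> * real eA \<le> (\<rho> * y + 2 * K3 * y / (1 - 2 * K3 / \<rho>)) * XA"
  proof -
    have d: "0 < 1 - 2 * K3 / \<rho>" using half by simp
    have "\<rho> * real eA = \<rho> * y * ?s" using s by (simp add: y_def)
    also have "\<dots> = (\<rho> * y / (1 - 2 * K3 / \<rho>)) * (?s * (1 - 2 * K3 / \<rho>))"
    proof -
      have "a * b = (a / d) * (b * d)" if "0 < d" for a b d :: real using that by simp
      from this[OF d] show ?thesis .
    qed
    also have "\<dots> \<le> (\<rho> * y / (1 - 2 * K3 / \<rho>)) * XA"
      using XA_ge rho0 y0 d by (intro mult_left_mono) auto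
    also have "\<rho> * y / (1 - 2 * K3 / \<rho>) = \<rho> * y + 2 * K3 * y / (1 - 2 * K3 / \<rho>)"
    proof -
      have "\<rho> * y = (\<rho> * y + 2 * K3 * y / (1 - 2 * K3 / \<rho>)) * (1 - 2 * K3 / \<rho>)"
        using d rho0 by (simp add: field_simps)
      then show ?thesis using d by (metis nonzero_eq_divide_eq less_irrefl)
    qed
    finally show ?thesis .
  qed
  have f: "2 * K3 * y / (1 - 2 * K3 / \<rho>) \<le> 1320 * k0 ^ 5"
  proof -
    have "2 * K3 * y / (1 - 2 * K3 / \<rho>) \<le> 2 * K3 * y / (1 / 2)"
      using half y0 k01 by (intro divide_left_mono) auto
    also have "\<dots> \<le> 2 * K3 * k0\<^sup>2 / (1 / 2)" using yk k01 by (intro divide_right_mono mult_left_mono) auto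
    finally show ?thesis by (simp add: eval_nat_numeral)
  qed
  have "400 * k0 ^ 5 * 1 \<le> 400 * k0 ^ 5 * (2 * XA)"
    using XAp s k01 by (intro mult_left_mono) auto
  then have "400 * k0 ^ 5 \<le> 400 * k0 ^ 5 * (2 * XA)" by simp
  moreover have "(\<rho> * y + 2 * K3 * y / (1 - 2 * K3 / \<rho>)) * XA \<le> (\<rho> * y + 1320 * k0 ^ 5) * XA"
    using f XA0 by (intro mult_right_mono) auto
  ultimately have "\<rho>\<^sup>2 * XA \<le> (2 * (\<rho> * y + 1320 * k0 ^ 5) + m + 800 * k0 ^ 5) * XA"
    using 1 e by (simp add: algebra_simps)
  then have "\<rho>\<^sup>2 \<le> 2 * (\<rho> * y + 1320 * k0 ^ 5) + m + 800 * k0 ^ 5" using XA0 by simp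
  then have "(\<rho> - y)\<^sup>2 \<le> m + 3440 * k0 ^ 5 + y\<^sup>2" by (simp add: power2_diff algebra_simps)
  moreover have "y\<^sup>2 \<le> k0 ^ 5"
  proof -
    have "y\<^sup>2 \<le> (k0\<^sup>2)\<^sup>2" using y0 yk by (intro power_mono) auto
    also have "\<dots> = k0 ^ 4" by (simp add: power_mult[symmetric])
    also have "\<dots> \<le> k0 ^ 5" using k01 by (intro power_increasing) auto
    finally show ?thesis .
  qed
  ultimately have "(\<rho> - y)\<^sup>2 \<le> m + 3500 * k0 ^ 5" using k0_pows[of 5] by linarith
  then have "\<rho> - y \<le> sqrt (m + 3500 * k0 ^ 5)" by (rule real_le_rsqrt)
  then show ?thesis by (simp add: y_def)
qed

text \<open>The competitor attaches t vertices to all of A and one to r of its vertices. Against it,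
  the defect of the degrees in Q from tight packing is at most O((q + hR + 1) / \<rho>), whereas
  \<open>sq_pack_gap\<close> makes it at least a constant times q + hR + 1 unless hR = 0 and Q has
  at most one vertex.\<close>

lemma core_exact:
  assumes cnt: "card G = eA + card A * t + r" and r: "r < card A" and T: "T \<subseteq> A" "card T = r"
    and join: "real t * (\<Sum>a\<in>A. x a)\<^sup>2 + (\<Sum>a\<in>T. x a)\<^sup>2 \<le> \<rho> * (\<rho> * XA - quad {e\<in>G. e \<subseteq> A} x)"
    and big2: "(k0\<^sup>2 + 3) * k0\<^sup>2 * (2 * K3 + 2 * K2\<^sup>2) < \<rho>"
  shows "hR = 0 \<and> card Q \<le> 1"
proof (rule ccontr)
  assume neg: "\<not> ?thesis"
  let ?s = "card A"
  define q where "q = t - card B"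
  define \<kappa> where "\<kappa> = 2 * K3 / \<rho>"
  have s: "0 < ?s" using cardA1 by simp
  have sumR: "(\<Sum>v\<in>R. dA v) = card B * ?s + (\<Sum>v\<in>Q. dA v)"
    using R_sum[of dA] by (simp add: dA_def dA_B[unfolded dA_def])
  have eq0: "card B * ?s + (\<Sum>v\<in>Q. dA v) + hR = ?s * t + r" using cnt edge_count sumR by simp
  have tB: "card B \<le> t"
  proof (rule ccontr)
    assume "\<not> card B \<le> t"
    then have "?s * (t + 1) \<le> ?s * card B" by (intro mult_left_mono) auto
    then have "?s * t + ?s \<le> ?s * t + r" using eq0 by (simp add: mult.commute)
    then show False using r by simp
  qed
  have tq: "t = card B + q" using tB by (simp add: q_def)
  have eq: "(\<Sum>v\<in>Q. dA v) + hR = q * ?s + r" using eq0 unfolding tq by (simp add: algebra_simps)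
  define g where "g = real q * (real ?s)\<^sup>2 + (real r)\<^sup>2 - (\<Sum>v\<in>Q. (real (dA v))\<^sup>2)"
  have gap: "real q + real hR + 1 \<le> ((real ?s)\<^sup>2 + 3) * g"
    unfolding g_def by (rule sq_pack_gap[OF finR(3) dA_Q s r eq]) (use neg in auto)
  have SB: "S v = (\<Sum>a\<in>A. x a)" if "v \<in> B" for v
    using that by (simp add: B_def S_def Int_absorb1)
  have "(\<Sum>v\<in>R. (S v)\<^sup>2) = (\<Sum>v\<in>B. (S v)\<^sup>2) + (\<Sum>v\<in>Q. (S v)\<^sup>2)"
    by (rule R_sum) (simp add: S_def)
  also have "(\<Sum>v\<in>B. (S v)\<^sup>2) = real (card B) * (\<Sum>a\<in>A. x a)\<^sup>2" using SB by simp
  also have "(\<Sum>v\<in>Q. (S v)\<^sup>2) \<le> (\<Sum>v\<in>Q. (real (dA v))\<^sup>2)"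
    using S_bounds by (intro sum_mono power_mono) auto
  finally have 1: "real t * (\<Sum>a\<in>A. x a)\<^sup>2 + (\<Sum>a\<in>T. x a)\<^sup>2
      \<le> real (card B) * (\<Sum>a\<in>A. x a)\<^sup>2 + (\<Sum>v\<in>Q. (real (dA v))\<^sup>2) + 2 * real hR * (K2\<^sup>2 / \<rho>)"
    using join core_identity by linarith
  \<comment> \<open>Vertices of B carry the same weight on both sides and cancel; q full vertices
    and one of degree r remain to be compared with Q.\<close>
  have 2: "real q * (\<Sum>a\<in>A. x a)\<^sup>2 + (\<Sum>a\<in>T. x a)\<^sup>2 \<le> (\<Sum>v\<in>Q. (real (dA v))\<^sup>2) + 2 * real hR * (K2\<^sup>2 / \<rho>)"
    using 1 unfolding tq by (simp add: algebra_simps)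
  have p: "0 \<le> 1 - K3 / \<rho>" using rho_ge(1) k0_pows[of 3] rho0 by (simp add: field_simps)
  have low: "(real (card U))\<^sup>2 * (1 - \<kappa>) \<le> (\<Sum>a\<in>U. x a)\<^sup>2" if U: "U \<subseteq> A" for U
  proof -
    have "real (card U) * (1 - K3 / \<rho>) \<le> (\<Sum>a\<in>U. x a)"
      using x_on_ge U by (intro sum_bounded_below) auto
    then have "(real (card U) * (1 - K3 / \<rho>))\<^sup>2 \<le> (\<Sum>a\<in>U. x a)\<^sup>2" using p by (intro power_mono) auto
    moreover have "1 - \<kappa> \<le> (1 - K3 / \<rho>)\<^sup>2" by (simp add: power2_diff \<kappa>_def)
    then have "(real (card U))\<^sup>2 * (1 - \<kappa>) \<le> (real (card U))\<^sup>2 * (1 - K3 / \<rho>)\<^sup>2" by (intro mult_left_mono) auto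
    ultimately show ?thesis by (simp add: power_mult_distrib)
  qed
  have "real q * ((real ?s)\<^sup>2 * (1 - \<kappa>)) \<le> real q * (\<Sum>a\<in>A. x a)\<^sup>2" using low[of A] by (intro mult_left_mono) auto
  then have "real q * ((real ?s)\<^sup>2 * (1 - \<kappa>)) + (real r)\<^sup>2 * (1 - \<kappa>)
      \<le> (\<Sum>v\<in>Q. (real (dA v))\<^sup>2) + 2 * real hR * (K2\<^sup>2 / \<rho>)" using 2 low[OF T(1)] T(2) by simp
  then have 3: "g \<le> (real q * (real ?s)\<^sup>2 + (real r)\<^sup>2) * \<kappa> + 2 * real hR * (K2\<^sup>2 / \<rho>)"
    unfolding g_def by (simp add: algebra_simps)
  have \<kappa>0: "0 \<le> \<kappa>" using rho0 k01 by (simp add: \<kappa>_def)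
  have sk: "(real ?s)\<^sup>2 \<le> k0\<^sup>2" using cardA by (intro power_mono) auto
  have rk: "(real r)\<^sup>2 \<le> k0\<^sup>2" using cardA r by (intro power_mono) auto
  have k2: "1 \<le> k0\<^sup>2" by (rule k0_pows)
  define N where "N = real q + real hR + 1"
  have N: "1 \<le> N" by (simp add: N_def)
  have "(real q * (real ?s)\<^sup>2 + (real r)\<^sup>2) \<le> N * k0\<^sup>2"
  proof -
    have "real q * (real ?s)\<^sup>2 \<le> real q * k0\<^sup>2" using sk by (intro mult_left_mono) auto
    moreover have "0 \<le> real hR * k0\<^sup>2" by simp
    moreover have "N * k0\<^sup>2 = real q * k0\<^sup>2 + real hR * k0\<^sup>2 + k0\<^sup>2" by (simp add: N_def algebra_simps)
    ultimately show ?thesis using rk by linarith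
  qed
  then have a: "(real q * (real ?s)\<^sup>2 + (real r)\<^sup>2) * \<kappa> \<le> N * k0\<^sup>2 * \<kappa>" using \<kappa>0 by (intro mult_right_mono)
  have b: "2 * real hR * (K2\<^sup>2 / \<rho>) \<le> N * k0\<^sup>2 * (2 * K2\<^sup>2 / \<rho>)"
  proof -
    have "real hR * 1 \<le> N * k0\<^sup>2" using k2 N by (intro mult_mono) (auto simp: N_def)
    then have "real hR * (2 * K2\<^sup>2 / \<rho>) \<le> N * k0\<^sup>2 * (2 * K2\<^sup>2 / \<rho>)" using rho0 by (intro mult_right_mono) auto
    moreover have "2 * real hR * (K2\<^sup>2 / \<rho>) = real hR * (2 * K2\<^sup>2 / \<rho>)" by simp
    ultimately show ?thesis by metis
  qed
  have "g \<le> N * k0\<^sup>2 * ((2 * K3 + 2 * K2\<^sup>2) / \<rho>)"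
    using 3 a b by (simp add: \<kappa>_def add_divide_distrib distrib_left)
  then have "((real ?s)\<^sup>2 + 3) * g \<le> ((real ?s)\<^sup>2 + 3) * (N * k0\<^sup>2 * ((2 * K3 + 2 * K2\<^sup>2) / \<rho>))"
    by (intro mult_left_mono) auto
  also have "\<dots> \<le> (k0\<^sup>2 + 3) * (N * k0\<^sup>2 * ((2 * K3 + 2 * K2\<^sup>2) / \<rho>))"
    using sk N rho0 k01 by (intro mult_right_mono) auto
  finally have "N \<le> (k0\<^sup>2 + 3) * (N * k0\<^sup>2 * ((2 * K3 + 2 * K2\<^sup>2) / \<rho>))" using gap by (simp add: N_def)
  also have "\<dots> = N * ((k0\<^sup>2 + 3) * k0\<^sup>2 * (2 * K3 + 2 * K2\<^sup>2) / \<rho>)" by simp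
  also have "\<dots> < N * 1"
  proof (rule mult_strict_left_mono)
    show "(k0\<^sup>2 + 3) * k0\<^sup>2 * (2 * K3 + 2 * K2\<^sup>2) / \<rho> < 1" using big2 rho0 by (simp add: divide_less_eq)
  qed (use N in simp)
  finally show False by simp
qed

end

section \<open>Near-complete bipartite graphs\<close>

context perron_graph
begin

definition arc_weight :: "nat set \<Rightarrow> nat set \<Rightarrow> real" where
  "arc_weight P P' = (\<Sum>(v, w)\<in>arcs G \<inter> P \<times> P'. x v * x w)"

lemma arc_weight_nonneg: "0 \<le> arc_weight P P'"
  unfolding arc_weight_def using x0 by (intro sum_nonneg) auto

lemma arc_weight_sym: "arc_weight P P' = arc_weight P' P"
  unfolding arc_weight_def
  by (rule sum.reindex_bij_witness[where i="\<lambda>(v,w). (w,v)" and j="\<lambda>(v,w). (w,v)"])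
     (auto simp: arcs_def insert_commute)

lemma arc_weight_Un: "P' \<inter> P'' = {} \<Longrightarrow> arc_weight P (P' \<union> P'') = arc_weight P P' + arc_weight P P''"
  unfolding arc_weight_def Sigma_Un_distrib2 Int_Un_distrib
  using finA by (intro sum.union_disjoint) auto

lemma arc_weight_Un_left: "P' \<inter> P'' = {} \<Longrightarrow> arc_weight (P' \<union> P'') P = arc_weight P' P + arc_weight P'' P"
  using arc_weight_Un[of P' P'' P] arc_weight_sym by simp

lemma arc_weight_row:
  assumes "P \<subseteq> \<Union>G"
  shows "arc_weight P (\<Union>G) = \<rho> * (\<Sum>v\<in>P. (x v)\<^sup>2)"
proof -
  have fP: "finite P" using assms finV finite_subset by metis
  have "arcs G \<inter> P \<times> \<Union>G = Sigma P (nbr G)" by (auto simp: arcs_def nbr_def)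
  then have "arc_weight P (\<Union>G) = (\<Sum>v\<in>P. \<Sum>w\<in>nbr G v. x v * x w)"
    unfolding arc_weight_def using fP finN by (simp add: sum.Sigma)
  also have "\<dots> = (\<Sum>v\<in>P. x v * (\<rho> * x v))" by (simp add: sum_distrib_left eig)
  also have "\<dots> = \<rho> * (\<Sum>v\<in>P. (x v)\<^sup>2)" by (simp add: sum_distrib_left power2_eq_square mult_ac)
  finally show ?thesis .
qed

lemma arc_weight_indep: "(\<And>v w. v \<in> P \<Longrightarrow> w \<in> P \<Longrightarrow> {v, w} \<notin> G) \<Longrightarrow> arc_weight P P = 0"
  unfolding arc_weight_def by (intro sum.neutral) (auto simp: arcs_def)

text \<open>The two sides of a bipartite graph carry equal eigenvector mass. Here the arcs from I
  lead to J or Z, and by symmetry their weights are bounded by the rows of J and Z.\<close>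

lemma indep_mass:
  assumes V: "\<Union>G = I \<union> J \<union> Z" and disj: "I \<inter> J = {}" "Z \<inter> (I \<union> J) = {}"
    and ind: "\<And>v w. v \<in> I \<Longrightarrow> w \<in> I \<Longrightarrow> {v, w} \<notin> G"
      "\<And>v w. v \<in> J \<Longrightarrow> w \<in> J \<Longrightarrow> {v, w} \<notin> G"
  shows "(\<Sum>v\<in>I. (x v)\<^sup>2) \<le> (\<Sum>v\<in>J. (x v)\<^sup>2) + (\<Sum>v\<in>Z. (x v)\<^sup>2)"
proof -
  have e: "arc_weight P (\<Union>G) = arc_weight P I + arc_weight P J + arc_weight P Z" for P
  proof -
    have "(I \<union> J) \<inter> Z = {}" using disj by auto
    then show ?thesis unfolding V using arc_weight_Un disj(1) by simp
  qed
  have sub: "I \<subseteq> \<Union>G" "J \<subseteq> \<Union>G" "Z \<subseteq> \<Union>G" using V by auto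
  have "arc_weight I I = 0" using arc_weight_indep ind(1) by blast
  then have "\<rho> * (\<Sum>v\<in>I. (x v)\<^sup>2) = arc_weight I J + arc_weight I Z"
    using arc_weight_row[OF sub(1)] e[of I] by linarith
  also have "\<dots> \<le> \<rho> * (\<Sum>v\<in>J. (x v)\<^sup>2) + \<rho> * (\<Sum>v\<in>Z. (x v)\<^sup>2)"
  proof (rule add_mono)
    show "arc_weight I J \<le> \<rho> * (\<Sum>v\<in>J. (x v)\<^sup>2)"
      using arc_weight_row[OF sub(2)] e[of J] arc_weight_sym[of I J] arc_weight_nonneg[of J J] arc_weight_nonneg[of J Z] by linarith
    show "arc_weight I Z \<le> \<rho> * (\<Sum>v\<in>Z. (x v)\<^sup>2)"
      using arc_weight_row[OF sub(3)] e[of Z] arc_weight_sym[of I Z] arc_weight_nonneg[of Z J] arc_weight_nonneg[of Z Z] by linarith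
  qed
  finally have "\<rho> * (\<Sum>v\<in>I. (x v)\<^sup>2) \<le> \<rho> * ((\<Sum>v\<in>J. (x v)\<^sup>2) + (\<Sum>v\<in>Z. (x v)\<^sup>2))"
    by (simp add: distrib_left)
  then show ?thesis using rho0 by simp
qed

end

text \<open>Deleting the exceptional set \<open>Z\<close> costs less in \<open>\<rho>\<^sup>2\<close> than the number of deleted edges, while the remaining
  bipartite graph satisfies \<open>\<rho>\<^sup>2 \<le> m\<close>; hence \<open>Z\<close> must be empty.\<close>

locale split_graph = perron_graph +
  fixes AA NN Z A1 :: "nat set" and \<delta> s n \<delta>1 :: real
  assumes V: "\<Union>G = AA \<union> NN \<union> Z" and disj: "AA \<inter> NN = {}" "Z \<inter> (AA \<union> NN) = {}"
    and indA: "\<And>v w. v \<in> AA \<Longrightarrow> w \<in> AA \<Longrightarrow> {v, w} \<notin> G"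
    and indN: "\<And>v w. v \<in> NN \<Longrightarrow> w \<in> NN \<Longrightarrow> {v, w} \<notin> G"
    and A1: "A1 \<subseteq> AA" and \<delta>: "0 < \<delta>" "\<delta> \<le> 1 / 100" and s: "0 < s" and n: "n = real (card NN)"
    and xN: "\<And>a. a \<in> NN \<Longrightarrow> (1 - 2 * \<delta>) * s / \<rho> \<le> x a"
    and xA: "\<And>b. b \<in> A1 \<Longrightarrow> 1 - \<delta> \<le> (x b)\<^sup>2"
    and cAA: "real (card AA) \<le> (1 + 4 * \<delta>) * s"
    and cA1: "(1 - \<delta> / 2) * s \<le> real (card A1)"
    and ns: "(1 - \<delta>) * \<rho>\<^sup>2 \<le> n * s"
    and missN: "\<And>v. v \<in> Z \<Longrightarrow> real (card (nbr G v \<inter> NN)) \<le> (1 - \<delta>) * n"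
    and missA: "\<And>v. v \<in> Z \<Longrightarrow> \<delta> / 2 * s \<le> real (card (A1 - nbr G v))"
    and bothN: "\<And>v. v \<in> Z \<Longrightarrow> nbr G v \<inter> NN \<noteq> {} \<Longrightarrow> nbr G v \<inter> AA \<noteq> {} \<Longrightarrow> real (card (nbr G v \<inter> NN)) \<le> n / 50"
    and bothA: "\<And>v. v \<in> Z \<Longrightarrow> nbr G v \<inter> NN \<noteq> {} \<Longrightarrow> nbr G v \<inter> AA \<noteq> {} \<Longrightarrow> real (card (nbr G v \<inter> A1)) \<le> s / 50"
    and few: "real (card (arcs G \<inter> Z \<times> \<Union>G)) \<le> \<delta>1 * m" and \<delta>1: "0 \<le> \<delta>1" "\<delta>1 \<le> \<delta>\<^sup>2 / 500"
begin

abbreviation "X \<equiv> \<Sum>v\<in>\<Union>G. (x v)\<^sup>2"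
abbreviation "XA \<equiv> \<Sum>v\<in>AA. (x v)\<^sup>2"
abbreviation "XN \<equiv> \<Sum>v\<in>NN. (x v)\<^sup>2"
abbreviation "XZ \<equiv> \<Sum>v\<in>Z. (x v)\<^sup>2"

section \<open>Mass estimates in the split graph\<close>

lemma fins: "finite AA" "finite NN" "finite Z" "finite A1"
  using finV V A1 by (auto intro: finite_subset)

lemma X_split: "X = XA + XN + XZ"
proof -
  have "(AA \<union> NN) \<inter> Z = {}" using disj by auto
  then show ?thesis unfolding V using fins disj(1) by (simp add: sum.union_disjoint)
qed

lemma mass_nonneg: "0 \<le> XA" "0 \<le> XN" "0 \<le> XZ" by (auto intro: sum_nonneg)

lemma X_pos: "1 \<le> X"
proof -
  have "(x u)\<^sup>2 \<le> X" using u_in_V finV by (intro member_le_sum) auto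
  then show ?thesis using xu by simp
qed

lemma XN_le: "XN \<le> XA + XZ"
  by (rule indep_mass[of NN AA Z]) (use V disj indA indN in auto)

lemma XA_le: "XA \<le> XN + XZ"
  by (rule indep_mass[of AA NN Z]) (use V disj indA indN in auto)

lemma half: "XN \<le> X / 2" "XA \<le> X / 2"
  using XN_le XA_le X_split by linarith+

lemma \<delta>1': "\<delta>1 \<le> \<delta> / 50000" "\<delta>1 \<le> 1 / 100"
proof -
  have "\<delta>\<^sup>2 \<le> \<delta> * (1 / 100)" unfolding power2_eq_square using \<delta> by (intro mult_left_mono) auto
  then show "\<delta>1 \<le> \<delta> / 50000" "\<delta>1 \<le> 1 / 100" using \<delta>1 \<delta> by linarith+
qed

lemma arcs_Z: "real (card (arcs G \<inter> Z \<times> \<Union>G)) \<le> \<delta>1 * \<rho>\<^sup>2"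
  using few mult_left_mono[OF rho_sq \<delta>1(1)] by linarith

lemma card_arcs_Z: "(\<Sum>v\<in>Z. real (card (nbr G v))) = real (card (arcs G \<inter> Z \<times> \<Union>G))"
proof -
  have "arcs G \<inter> Z \<times> \<Union>G = Sigma Z (nbr G)" by (auto simp: arcs_def nbr_def)
  then show ?thesis using fins finN by simp
qed

text \<open>Crude form: Cauchy-Schwarz in each row and the small degree sum of Z. It is sharpened in
  \<open>XZ_main\<close>.\<close>

lemma XZ_le: "XZ \<le> \<delta>1 * X"
proof -
  have "(\<rho> * x v)\<^sup>2 \<le> real (card (nbr G v)) * X" for v
  proof -
    have "(\<rho> * x v)\<^sup>2 \<le> real (card (nbr G v)) * (\<Sum>w\<in>nbr G v. (x w)\<^sup>2)" unfolding eig by (rule sum_sq_le_card)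
    also have "\<dots> \<le> real (card (nbr G v)) * X"
      using finV nbr_subset[of G v] by (intro mult_left_mono sum_mono2) auto
    finally show ?thesis .
  qed
  then have "(\<Sum>v\<in>Z. (\<rho> * x v)\<^sup>2) \<le> (\<Sum>v\<in>Z. real (card (nbr G v)) * X)" by (rule sum_mono)
  then have "\<rho>\<^sup>2 * XZ \<le> real (card (arcs G \<inter> Z \<times> \<Union>G)) * X"
    by (simp add: power_mult_distrib sum_distrib_left[symmetric] sum_distrib_right[symmetric] card_arcs_Z)
  also have "\<dots> \<le> \<delta>1 * \<rho>\<^sup>2 * X" using arcs_Z X_pos by (intro mult_right_mono) auto
  finally have "\<rho>\<^sup>2 * XZ \<le> \<rho>\<^sup>2 * (\<delta>1 * X)" by (simp add: mult_ac)
  then show ?thesis using rho0 by simp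
qed

lemma X_le: "X \<le> 5 / 2 * s"
proof -
  have "XA \<le> (\<Sum>v\<in>AA. 1)" using x0 x1 by (intro sum_mono) (simp add: power_le_one)
  then have "XA \<le> (1 + 4 * \<delta>) * s" using cAA by simp
  also have "\<dots> \<le> 26 / 25 * s" using \<delta> s by (intro mult_right_mono) auto
  finally have a: "XA \<le> 26 / 25 * s" .
  have "\<delta>1 * X \<le> 1 / 100 * X" using \<delta>1' X_pos by (intro mult_right_mono) auto
  then have "XZ \<le> 1 / 100 * X" using XZ_le by linarith
  then have "X \<le> 2 * (26 / 25 * s) + 1 / 50 * X" using X_split XN_le a by linarith
  then show ?thesis using s by linarith
qed

text \<open>Each missed vertex of NN takes away mass about \<open>(s / \<rho>)\<^sup>2\<close>, and
  \<open>n * s\<close> is about \<open>\<rho>\<^sup>2\<close>, so missing a fraction c of NN costs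
  nearly c * s out of at most half the total mass.\<close>

lemma massN:
  assumes "c * n \<le> real (card (NN - nbr G v))" "0 \<le> c"
  shows "(\<Sum>w\<in>nbr G v \<inter> NN. (x w)\<^sup>2) \<le> X / 2 - c * (47 / 50 * s)"
proof -
  have sp: "XN = (\<Sum>w\<in>nbr G v \<inter> NN. (x w)\<^sup>2) + (\<Sum>w\<in>NN - nbr G v. (x w)\<^sup>2)"
    using fins sum.Int_Diff[of NN "\<lambda>w. (x w)\<^sup>2" "nbr G v"] by (simp add: Int_commute)
  have low: "(24 / 25) * (s / \<rho>)\<^sup>2 \<le> (x w)\<^sup>2" if "w \<in> NN" for w
  proof -
    have "(24 / 25) * (s / \<rho>)\<^sup>2 \<le> (1 - 2 * \<delta>)\<^sup>2 * (s / \<rho>)\<^sup>2"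
    proof (rule mult_right_mono)
      have "1 - 4 * \<delta> \<le> (1 - 2 * \<delta>)\<^sup>2" by (simp add: power2_diff)
      then show "24 / 25 \<le> (1 - 2 * \<delta>)\<^sup>2" using \<delta> by linarith
    qed simp
    also have "\<dots> = ((1 - 2 * \<delta>) * s / \<rho>)\<^sup>2" by (simp add: power_mult_distrib power_divide)
    also have "\<dots> \<le> (x w)\<^sup>2"
      using xN[OF that] \<delta> s rho0 by (intro power_mono divide_nonneg_pos mult_nonneg_nonneg) auto
    finally show ?thesis .
  qed
  have "c * (47 / 50 * s) \<le> c * n * ((24 / 25) * (s / \<rho>)\<^sup>2)"
  proof -
    have "47 / 50 * \<rho>\<^sup>2 * s \<le> 24 / 25 * ((1 - \<delta>) * \<rho>\<^sup>2) * s"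
    proof -
      have "47 / 50 * (\<rho>\<^sup>2 * s) \<le> 24 / 25 * (1 - \<delta>) * (\<rho>\<^sup>2 * s)" using \<delta> s by (intro mult_right_mono) auto
      then show ?thesis by (simp add: algebra_simps)
    qed
    also have "\<dots> \<le> 24 / 25 * (n * s) * s" using ns s by (intro mult_right_mono mult_left_mono) auto
    finally have "47 / 50 * s * \<rho>\<^sup>2 \<le> n * (24 / 25 * s\<^sup>2)" by (simp add: power2_eq_square mult_ac)
    then have "47 / 50 * s \<le> n * (24 / 25 * (s / \<rho>)\<^sup>2)" using rho0 by (simp add: power_divide field_simps)
    then have "c * (47 / 50 * s) \<le> c * (n * (24 / 25 * (s / \<rho>)\<^sup>2))" using assms(2) by (intro mult_left_mono)
    then show ?thesis by (simp add: mult_ac)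
  qed
  also have "\<dots> \<le> real (card (NN - nbr G v)) * ((24 / 25) * (s / \<rho>)\<^sup>2)"
    using assms(1) by (intro mult_right_mono) auto
  also have "\<dots> \<le> (\<Sum>w\<in>NN - nbr G v. (x w)\<^sup>2)" using low by (intro sum_bounded_below) auto
  finally show ?thesis using sp half by linarith
qed

lemma massA:
  assumes "c \<le> real (card (A1 - nbr G v))" "0 \<le> c"
  shows "(\<Sum>w\<in>nbr G v \<inter> AA. (x w)\<^sup>2) \<le> X / 2 - c * (99 / 100)"
proof -
  have sp: "XA = (\<Sum>w\<in>nbr G v \<inter> AA. (x w)\<^sup>2) + (\<Sum>w\<in>AA - nbr G v. (x w)\<^sup>2)"
    using fins sum.Int_Diff[of AA "\<lambda>w. (x w)\<^sup>2" "nbr G v"] by (simp add: Int_commute)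
  have "c * (99 / 100) \<le> real (card (A1 - nbr G v)) * (99 / 100)" using assms by simp
  also have "\<dots> \<le> (\<Sum>w\<in>A1 - nbr G v. (x w)\<^sup>2)"
  proof (rule sum_bounded_below)
    fix w assume "w \<in> A1 - nbr G v"
    then show "99 / 100 \<le> (x w)\<^sup>2" using xA[of w] \<delta> by auto
  qed
  also have "\<dots> \<le> (\<Sum>w\<in>AA - nbr G v. (x w)\<^sup>2)" using fins A1 by (intro sum_mono2) auto
  finally show ?thesis using sp half by linarith
qed

definition cN :: "nat \<Rightarrow> real" where "cN v = (\<Sum>w\<in>nbr G v \<inter> NN. x w)"
definition cA :: "nat \<Rightarrow> real" where "cA v = (\<Sum>w\<in>nbr G v \<inter> AA. x w)"
definition cZ :: "nat \<Rightarrow> real" where "cZ v = (\<Sum>w\<in>nbr G v \<inter> Z. x w)"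
definition dNA :: "nat \<Rightarrow> real" where "dNA v = real (card (nbr G v \<inter> NN)) + real (card (nbr G v \<inter> AA))"

lemma row_split: "\<rho> * x v = cN v + cA v + cZ v"
proof -
  have "nbr G v = (nbr G v \<inter> NN \<union> nbr G v \<inter> AA) \<union> nbr G v \<inter> Z" using nbr_subset[of G v] V by auto
  then have "(\<Sum>w\<in>nbr G v. x w) = (\<Sum>w\<in>(nbr G v \<inter> NN \<union> nbr G v \<inter> AA) \<union> nbr G v \<inter> Z. x w)" by simp
  also have "\<dots> = (\<Sum>w\<in>nbr G v \<inter> NN \<union> nbr G v \<inter> AA. x w) + cZ v"
    unfolding cZ_def using fins disj by (intro sum.union_disjoint) auto
  also have "(\<Sum>w\<in>nbr G v \<inter> NN \<union> nbr G v \<inter> AA. x w) = cN v + cA v"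
    unfolding cN_def cA_def using fins disj by (intro sum.union_disjoint) auto
  finally show ?thesis by (simp add: eig)
qed

text \<open>Cauchy-Schwarz alone would give the factor X / 2 for one side. A vertex of Z attached to
  one side misses a proportion \<delta> of it or more than a third of that of its large entries,
  which saves \<delta> / 5. A vertex attached to both sides sees little of each.\<close>

lemma main_row:
  assumes v: "v \<in> Z"
  shows "(cN v + cA v)\<^sup>2 \<le> (1 - \<delta> / 5) * (X / 2) * dNA v"
proof -
  let ?dN = "real (card (nbr G v \<inter> NN))" and ?dA = "real (card (nbr G v \<inter> AA))"
  let ?MN = "\<Sum>w\<in>nbr G v \<inter> NN. (x w)\<^sup>2" and ?MA = "\<Sum>w\<in>nbr G v \<inter> AA. (x w)\<^sup>2"
  have N2: "(cN v)\<^sup>2 \<le> ?dN * ?MN" unfolding cN_def by (rule sum_sq_le_card)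
  have A2: "(cA v)\<^sup>2 \<le> ?dA * ?MA" unfolding cA_def by (rule sum_sq_le_card)
  have missN': "n - ?dN = real (card (NN - nbr G v))"
    using card_Int_Diff[OF fins(2), of "nbr G v"] n by (simp add: Int_commute)
  have X0: "0 < X" using X_pos by linarith
  show ?thesis
  proof (cases "nbr G v \<inter> NN = {} \<or> nbr G v \<inter> AA = {}")
    case True
    have "\<delta> * n \<le> real (card (NN - nbr G v))" using missN[OF v] missN' by (simp add: algebra_simps)
    then have "?MN \<le> X / 2 - \<delta> * (47 / 50 * s)" using \<delta> by (intro massN) auto
    moreover have "\<delta> * X \<le> \<delta> * (5 / 2 * s)" using X_le \<delta> by (intro mult_left_mono) auto
    moreover have "0 \<le> \<delta> * s" using \<delta> s by simp
    ultimately have MN: "?MN \<le> (1 - \<delta> / 5) * (X / 2)" by (simp add: algebra_simps)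
    have "?MA \<le> X / 2 - \<delta> / 2 * s * (99 / 100)" using missA[OF v] \<delta> s by (intro massA) auto
    moreover have "\<delta> * X \<le> \<delta> * (5 / 2 * s)" using X_le \<delta> by (intro mult_left_mono) auto
    moreover have "0 \<le> \<delta> * s" using \<delta> s by simp
    ultimately have MA: "?MA \<le> (1 - \<delta> / 5) * (X / 2)" by (simp add: algebra_simps)
    show ?thesis
    proof (cases "nbr G v \<inter> NN = {}")
      case True
      then have "cN v = 0" "dNA v = ?dA" by (simp_all add: cN_def dNA_def)
      moreover have "?dA * ?MA \<le> ?dA * ((1 - \<delta> / 5) * (X / 2))" using MA by (intro mult_left_mono) auto
      ultimately show ?thesis using A2 by (simp add: mult_ac)
    next
      case False
      then have "cA v = 0" "dNA v = ?dN" using \<open>_ \<or> _\<close> by (simp_all add: cA_def dNA_def)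
      moreover have "?dN * ?MN \<le> ?dN * ((1 - \<delta> / 5) * (X / 2))" using MN by (intro mult_left_mono) auto
      ultimately show ?thesis using N2 by (simp add: mult_ac)
    qed
  next
    case False
    have n0: "0 \<le> n" using n by simp
    have "49 / 50 * n \<le> real (card (NN - nbr G v))" using bothN[OF v] False missN' by simp
    then have "?MN \<le> X / 2 - 49 / 50 * (47 / 50 * s)" by (intro massN) auto
    then have MN: "?MN \<le> 7 / 50 * X" using X_le s by linarith
    have "real (card A1) = real (card (nbr G v \<inter> A1)) + real (card (A1 - nbr G v))"
      using card_Int_Diff[OF fins(4), of "nbr G v"] by (simp add: Int_commute)
    moreover have "real (card (nbr G v \<inter> A1)) \<le> s / 50" using bothA[OF v] False by simp
    moreover have "199 / 200 * s \<le> (1 - \<delta> / 2) * s" using \<delta> s by (intro mult_right_mono) auto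
    ultimately have "95 / 100 * s \<le> real (card (A1 - nbr G v))" using cA1 s by linarith
    then have "?MA \<le> X / 2 - 95 / 100 * s * (99 / 100)" using s by (intro massA) auto
    then have MA: "?MA \<le> 7 / 50 * X" using X_le s by linarith
    \<comment> \<open>With both masses at most 7/50 of X even the lossy factor 2 leaves 14/25 of X /
      2.\<close>
    have "(cN v + cA v)\<^sup>2 \<le> 2 * (cN v)\<^sup>2 + 2 * (cA v)\<^sup>2"
      using zero_le_power2[of "cN v - cA v"] by (simp add: power2_sum power2_diff)
    also have "\<dots> \<le> 2 * (?dN * (7 / 50 * X)) + 2 * (?dA * (7 / 50 * X))"
      using N2 A2 mult_left_mono[OF MN, of ?dN] mult_left_mono[OF MA, of ?dA] by simp
    also have "\<dots> = 14 / 25 * (X / 2) * dNA v" by (simp add: dNA_def algebra_simps)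
    also have "\<dots> \<le> (1 - \<delta> / 5) * (X / 2) * dNA v"
      using \<delta> X0 by (intro mult_right_mono) (auto simp: dNA_def)
    finally show ?thesis .
  qed
qed

definition gg :: real where "gg = real (card (arcs G \<inter> Z \<times> (NN \<union> AA)))"
definition zz :: real where "zz = real (card (arcs G \<inter> Z \<times> Z))"

lemma sum_dNA: "(\<Sum>v\<in>Z. dNA v) = gg"
proof -
  have "arcs G \<inter> Z \<times> (NN \<union> AA) = Sigma Z (\<lambda>v. nbr G v \<inter> NN \<union> nbr G v \<inter> AA)"
    by (auto simp: arcs_def nbr_def)
  then have "gg = (\<Sum>v\<in>Z. real (card (nbr G v \<inter> NN \<union> nbr G v \<inter> AA)))" unfolding gg_def using fins by simp
  also have "\<dots> = (\<Sum>v\<in>Z. dNA v)"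
  proof (intro sum.cong refl)
    fix v
    have "card (nbr G v \<inter> NN \<union> nbr G v \<inter> AA) = card (nbr G v \<inter> NN) + card (nbr G v \<inter> AA)"
      using fins disj by (intro card_Un_disjoint) auto
    then show "real (card (nbr G v \<inter> NN \<union> nbr G v \<inter> AA)) = dNA v" by (simp add: dNA_def)
  qed
  finally show ?thesis by simp
qed

lemma gg_zz: "gg + zz = real (card (arcs G \<inter> Z \<times> \<Union>G))" "0 \<le> gg" "0 \<le> zz"
proof -
  have "arcs G \<inter> Z \<times> \<Union>G = arcs G \<inter> Z \<times> (NN \<union> AA) \<union> arcs G \<inter> Z \<times> Z" using V by auto
  moreover have "card (arcs G \<inter> Z \<times> (NN \<union> AA) \<union> arcs G \<inter> Z \<times> Z)
      = card (arcs G \<inter> Z \<times> (NN \<union> AA)) + card (arcs G \<inter> Z \<times> Z)"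
    using finA disj by (intro card_Un_disjoint) auto
  ultimately show "gg + zz = real (card (arcs G \<inter> Z \<times> \<Union>G))" by (simp add: gg_def zz_def)
qed (simp_all add: gg_def zz_def)

lemma sum_cZ: "(\<Sum>v\<in>Z. (cZ v)\<^sup>2) \<le> \<delta>1 * \<rho>\<^sup>2 * XZ"
proof -
  have "(cZ v)\<^sup>2 \<le> real (card (nbr G v)) * XZ" for v
  proof -
    have "(cZ v)\<^sup>2 \<le> real (card (nbr G v \<inter> Z)) * (\<Sum>w\<in>nbr G v \<inter> Z. (x w)\<^sup>2)" unfolding cZ_def by (rule sum_sq_le_card)
    also have "\<dots> \<le> real (card (nbr G v)) * XZ"
      using fins finN[of v] by (intro mult_mono sum_mono2) (auto intro: card_mono sum_nonneg)
    finally show ?thesis .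
  qed
  then have "(\<Sum>v\<in>Z. (cZ v)\<^sup>2) \<le> (\<Sum>v\<in>Z. real (card (nbr G v)) * XZ)" by (rule sum_mono)
  also have "\<dots> = real (card (arcs G \<inter> Z \<times> \<Union>G)) * XZ" by (simp add: sum_distrib_right[symmetric] card_arcs_Z)
  also have "\<dots> \<le> \<delta>1 * \<rho>\<^sup>2 * XZ" using arcs_Z mass_nonneg by (intro mult_right_mono) auto
  finally show ?thesis .
qed

text \<open>Edges inside Z are split off by a weighted inequality with parameter \<delta> / 20. Its
  large factor, of order 1 / \<delta>, meets \<open>\<delta>1 \<le> \<delta>\<^sup>2 / 500\<close>,
  so this part is absorbed on the left and a saving of \<delta> / 10 survives.\<close>

lemma XZ_main: "\<rho>\<^sup>2 * XZ \<le> (1 - \<delta> / 10) * (X / 2) * gg"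
proof -
  define \<omega> where "\<omega> = \<delta> / 20"
  have \<omega>: "0 < \<omega>" using \<delta> by (simp add: \<omega>_def)
  have yy: "(a + b)\<^sup>2 \<le> (1 + \<omega>) * a\<^sup>2 + (1 + 1 / \<omega>) * b\<^sup>2" for a b :: real
  proof -
    have "0 \<le> (\<omega> * a - b)\<^sup>2 / \<omega>" using \<omega> by simp
    also have "(\<omega> * a - b)\<^sup>2 / \<omega> = \<omega> * a\<^sup>2 - 2 * a * b + b\<^sup>2 / \<omega>"
      using \<omega> by (simp add: field_simps power2_eq_square)
    finally show ?thesis by (simp add: power2_sum algebra_simps)
  qed
  have "\<rho>\<^sup>2 * XZ = (\<Sum>v\<in>Z. (cN v + cA v + cZ v)\<^sup>2)"
    unfolding sum_distrib_left by (intro sum.cong refl) (simp add: row_split[symmetric] power_mult_distrib)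
  also have "\<dots> \<le> (\<Sum>v\<in>Z. (1 + \<omega>) * (cN v + cA v)\<^sup>2 + (1 + 1 / \<omega>) * (cZ v)\<^sup>2)" by (intro sum_mono yy)
  also have "\<dots> = (1 + \<omega>) * (\<Sum>v\<in>Z. (cN v + cA v)\<^sup>2) + (1 + 1 / \<omega>) * (\<Sum>v\<in>Z. (cZ v)\<^sup>2)"
    by (simp only: sum.distrib sum_distrib_left)
  also have "(\<Sum>v\<in>Z. (cN v + cA v)\<^sup>2) \<le> (\<Sum>v\<in>Z. (1 - \<delta> / 5) * (X / 2) * dNA v)" using main_row by (rule sum_mono)
  also have "\<dots> = (1 - \<delta> / 5) * (X / 2) * gg" by (simp only: sum_distrib_left[symmetric] sum_dNA)
  finally have 1: "\<rho>\<^sup>2 * XZ \<le> (1 + \<omega>) * ((1 - \<delta> / 5) * (X / 2) * gg) + (1 + 1 / \<omega>) * (\<Sum>v\<in>Z. (cZ v)\<^sup>2)"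
    using \<omega> by simp
  have "(1 + 1 / \<omega>) * (\<Sum>v\<in>Z. (cZ v)\<^sup>2) \<le> (1 + 1 / \<omega>) * (\<delta>1 * \<rho>\<^sup>2 * XZ)"
    using sum_cZ \<omega> by (intro mult_left_mono) auto
  also have "\<dots> \<le> (21 / \<delta>) * (\<delta>\<^sup>2 / 500 * \<rho>\<^sup>2 * XZ)"
  proof (rule mult_mono)
    show "1 + 1 / \<omega> \<le> 21 / \<delta>" using \<delta> by (simp add: \<omega>_def field_simps)
    show "\<delta>1 * \<rho>\<^sup>2 * XZ \<le> \<delta>\<^sup>2 / 500 * \<rho>\<^sup>2 * XZ" using \<delta>1 mass_nonneg by (intro mult_right_mono) auto
  qed (use \<delta> \<delta>1 mass_nonneg in auto)
  also have "\<dots> = 21 / 500 * \<delta> * (\<rho>\<^sup>2 * XZ)" using \<delta> by (simp add: power2_eq_square)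
  finally have 2: "(1 + 1 / \<omega>) * (\<Sum>v\<in>Z. (cZ v)\<^sup>2) \<le> 21 / 500 * \<delta> * (\<rho>\<^sup>2 * XZ)" .
  have Xg: "0 \<le> X / 2 * gg" using X_pos gg_zz by (intro mult_nonneg_nonneg) auto
  have 3: "(1 - 21 / 500 * \<delta>) * (\<rho>\<^sup>2 * XZ) \<le> (1 + \<omega>) * (1 - \<delta> / 5) * (X / 2 * gg)"
  proof -
    have "(1 - 21 / 500 * \<delta>) * (\<rho>\<^sup>2 * XZ) = \<rho>\<^sup>2 * XZ - 21 / 500 * \<delta> * (\<rho>\<^sup>2 * XZ)"
      by (simp only: left_diff_distrib mult_1)
    moreover have "(1 + \<omega>) * ((1 - \<delta> / 5) * (X / 2) * gg) = (1 + \<omega>) * (1 - \<delta> / 5) * (X / 2 * gg)"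
      by (simp only: mult.assoc)
    ultimately show ?thesis using 1 2 by linarith
  qed
  have "(1 + \<omega>) * (1 - \<delta> / 5) \<le> (1 - 21 / 500 * \<delta>) * (1 - \<delta> / 10)"
  proof -
    have "(1 + \<omega>) * (1 - \<delta> / 5) = 1 - 15 / 100 * \<delta> - \<delta>\<^sup>2 / 100"
      by (simp add: \<omega>_def field_simps power2_eq_square)
    moreover have "(1 - 21 / 500 * \<delta>) * (1 - \<delta> / 10) = 1 - 142 / 1000 * \<delta> + 21 / 5000 * \<delta>\<^sup>2"
      by (simp add: field_simps power2_eq_square)
    moreover have "0 \<le> \<delta>\<^sup>2" by simp
    ultimately show ?thesis using \<delta> by linarith
  qed
  then have "(1 + \<omega>) * (1 - \<delta> / 5) * (X / 2 * gg) \<le> (1 - 21 / 500 * \<delta>) * (1 - \<delta> / 10) * (X / 2 * gg)"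
    using Xg by (rule mult_right_mono)
  then have "(1 - 21 / 500 * \<delta>) * (\<rho>\<^sup>2 * XZ) \<le> (1 - 21 / 500 * \<delta>) * ((1 - \<delta> / 10) * (X / 2 * gg))"
    using 3 by (simp only: mult.assoc)
  moreover have "0 < 1 - 21 / 500 * \<delta>" using \<delta> by simp
  ultimately have "\<rho>\<^sup>2 * XZ \<le> (1 - \<delta> / 10) * (X / 2 * gg)" by (simp only: mult_le_cancel_left_pos)
  then show ?thesis by (simp only: mult.assoc)
qed

definition ms :: real where "ms = real (card (arcs G \<inter> NN \<times> AA))"

lemma ms_eq: "ms = m - gg - zz / 2"
proof -
  let ?P1 = "arcs G \<inter> NN \<times> AA" and ?P2 = "arcs G \<inter> AA \<times> NN"
    and ?P3 = "arcs G \<inter> Z \<times> (NN \<union> AA)" and ?P4 = "arcs G \<inter> (NN \<union> AA) \<times> Z" and ?P5 = "arcs G \<inter> Z \<times> Z"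
  have no: "(v, w) \<notin> arcs G" if "v \<in> AA \<and> w \<in> AA \<or> v \<in> NN \<and> w \<in> NN" for v w
    using that indA indN by (auto simp: arcs_def)
  have "arcs G = (?P1 \<union> ?P2) \<union> ((?P3 \<union> ?P4) \<union> ?P5)"
    using arcs_subset[of G] no unfolding V by blast
  then have "card (arcs G) = card ((?P1 \<union> ?P2) \<union> ((?P3 \<union> ?P4) \<union> ?P5))" by simp
  also have "\<dots> = (card ?P1 + card ?P2) + ((card ?P3 + card ?P4) + card ?P5)"
  proof -
    have "?P1 \<inter> ?P2 = {}" "?P3 \<inter> ?P4 = {}" "(?P3 \<union> ?P4) \<inter> ?P5 = {}" "(?P1 \<union> ?P2) \<inter> ((?P3 \<union> ?P4) \<union> ?P5) = {}"
      using disj by auto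
    then show ?thesis using finA by (simp add: card_Un_disjoint)
  qed
  finally have "card (arcs G) = 2 * card ?P1 + 2 * card ?P3 + card ?P5"
    using card_arcs_swap[of G AA NN] card_arcs_swap[of G "NN \<union> AA" Z] by simp
  then have "real (card (arcs G)) = 2 * real (card ?P1) + 2 * real (card ?P3) + real (card ?P5)" by simp
  then show ?thesis using card_arcs' by (simp add: ms_def gg_def zz_def)
qed

text \<open>Removing the rows and columns of Z costs at most twice \<open>\<rho> * XZ\<close>. On
  the bipartite remainder Cauchy-Schwarz over its edges and the mean inequality for XN and XA give
  the usual bound by the number of edges.\<close>

lemma bipartite_part: "(\<rho> * (X - 2 * XZ))\<^sup>2 \<le> ms * (X - XZ)\<^sup>2"
proof -
  have e: "arc_weight P (\<Union>G) = arc_weight P (NN \<union> AA) + arc_weight P Z" for P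
  proof -
    have "\<Union>G = (NN \<union> AA) \<union> Z" using V by auto
    moreover have "(NN \<union> AA) \<inter> Z = {}" using disj by auto
    ultimately show ?thesis using arc_weight_Un by simp
  qed
  have ZV: "Z \<subseteq> \<Union>G" using V by auto
  have "\<rho> * X = arc_weight (\<Union>G) (\<Union>G)" using arc_weight_row[of "\<Union>G"] by simp
  also have "\<dots> = arc_weight (NN \<union> AA) (NN \<union> AA) + arc_weight Z (NN \<union> AA) + arc_weight (\<Union>G) Z"
    using e[of "\<Union>G"] e[of "NN \<union> AA"] arc_weight_sym[of "\<Union>G" "NN \<union> AA"] arc_weight_sym[of "NN \<union> AA" Z] by simp
  also have "arc_weight (\<Union>G) Z = \<rho> * XZ" using arc_weight_sym[of "\<Union>G" Z] arc_weight_row[OF ZV] by simp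
  also have "arc_weight Z (NN \<union> AA) \<le> \<rho> * XZ" using e[of Z] arc_weight_row[OF ZV] arc_weight_nonneg[of Z Z] by linarith
  also have "arc_weight (NN \<union> AA) (NN \<union> AA) = 2 * arc_weight NN AA"
  proof -
    have d: "NN \<inter> AA = {}" using disj by auto
    have "arc_weight NN NN = 0" "arc_weight AA AA = 0" using arc_weight_indep indA indN by auto
    then show ?thesis using arc_weight_Un[OF d] arc_weight_Un_left[OF d] arc_weight_sym[of AA NN] by simp
  qed
  finally have 1: "\<rho> * (X - 2 * XZ) \<le> 2 * arc_weight NN AA" by (simp add: algebra_simps)
  have z: "2 * XZ \<le> X"
  proof -
    have "\<delta>1 * X \<le> 1 / 100 * X" using \<delta>1' X_pos by (intro mult_right_mono) auto
    then show ?thesis using XZ_le X_pos by linarith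
  qed
  then have "(\<rho> * (X - 2 * XZ))\<^sup>2 \<le> (2 * arc_weight NN AA)\<^sup>2" using 1 rho0 by (intro power_mono) auto
  also have "(arc_weight NN AA)\<^sup>2 \<le> ms * (XN * XA)"
  proof -
    have "(arc_weight NN AA)\<^sup>2 \<le> ms * (\<Sum>p\<in>arcs G \<inter> NN \<times> AA. (x (fst p) * x (snd p))\<^sup>2)"
      unfolding arc_weight_def ms_def case_prod_beta by (rule sum_sq_le_card)
    also have "\<dots> \<le> ms * (\<Sum>p\<in>NN \<times> AA. (x (fst p) * x (snd p))\<^sup>2)"
      using fins by (intro mult_left_mono sum_mono2) (auto simp: ms_def)
    also have "(\<Sum>p\<in>NN \<times> AA. (x (fst p) * x (snd p))\<^sup>2) = XN * XA"
      by (simp add: sum_product sum.cartesian_product power_mult_distrib case_prod_beta)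
    finally show ?thesis .
  qed
  then have "(2 * arc_weight NN AA)\<^sup>2 \<le> ms * (4 * (XN * XA))" by (simp add: power_mult_distrib)
  also have "\<dots> \<le> ms * (XN + XA)\<^sup>2"
  proof (rule mult_left_mono)
    show "4 * (XN * XA) \<le> (XN + XA)\<^sup>2"
      using zero_le_power2[of "XN - XA"] unfolding power2_sum power2_diff by linarith
  qed (simp add: ms_def)
  also have "XN + XA = X - XZ" using X_split by simp
  finally show ?thesis .
qed

text \<open>Adding the estimates yields
  \<open>\<rho>\<^sup>2 \<le> m - \<delta> / 20 * gg - zz / 2\<close>. With \<open>rho_sq\<close> no
  edge can touch Z, and a vertex of the graph is never isolated.\<close>

lemma split_conclusion: "Z = {}" "\<rho>\<^sup>2 \<le> m"
proof -
  define Y where "Y = X - XZ"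
  have \<delta>X: "\<delta>1 * X \<le> 1 / 100 * X" using \<delta>1' X_pos by (intro mult_right_mono) auto
  have Y0: "0 < Y" using XZ_le \<delta>X X_pos unfolding Y_def by linarith
  have "\<rho>\<^sup>2 * (Y - XZ)\<^sup>2 \<le> ms * Y\<^sup>2" using bipartite_part by (simp add: Y_def power_mult_distrib)
  moreover have "Y\<^sup>2 - 2 * XZ * Y \<le> (Y - XZ)\<^sup>2" by (simp add: power2_diff)
  then have "\<rho>\<^sup>2 * (Y\<^sup>2 - 2 * XZ * Y) \<le> \<rho>\<^sup>2 * (Y - XZ)\<^sup>2" by (intro mult_left_mono) auto
  ultimately have "(\<rho>\<^sup>2 * (Y - 2 * XZ)) * Y \<le> (ms * Y) * Y" by (simp add: algebra_simps power2_eq_square)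
  then have 1: "\<rho>\<^sup>2 * (Y - 2 * XZ) \<le> ms * Y" using Y0 by simp
  have 2: "\<rho>\<^sup>2 * (2 * XZ) \<le> (1 - \<delta> / 20) * gg * Y"
  proof -
    have "\<rho>\<^sup>2 * (2 * XZ) \<le> (1 - \<delta> / 10) * X * gg" using XZ_main by simp
    also have "\<dots> \<le> (1 - \<delta> / 20) * Y * gg"
    proof (rule mult_right_mono)
      have "(1 - \<delta> / 20) * ((1 - \<delta>1) * X) \<le> (1 - \<delta> / 20) * Y"
        using XZ_le \<delta> by (intro mult_left_mono) (auto simp: Y_def algebra_simps)
      moreover have "(1 - \<delta> / 10) * X \<le> (1 - \<delta> / 20) * (1 - \<delta>1) * X"
      proof (rule mult_right_mono)
        have "(1 - \<delta> / 20) * (1 - \<delta>1) = 1 - \<delta> / 20 - \<delta>1 + \<delta> / 20 * \<delta>1" by (simp add: field_simps)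
        moreover have "0 \<le> \<delta> / 20 * \<delta>1" using \<delta> \<delta>1 by simp
        ultimately show "1 - \<delta> / 10 \<le> (1 - \<delta> / 20) * (1 - \<delta>1)" using \<delta>1' \<delta> by linarith
      qed (use X_pos in simp)
      ultimately show "(1 - \<delta> / 10) * X \<le> (1 - \<delta> / 20) * Y" by (simp only: mult.assoc)
    qed (use gg_zz in simp)
    finally show ?thesis by (simp add: mult_ac)
  qed
  have "\<rho>\<^sup>2 * Y \<le> (ms + (1 - \<delta> / 20) * gg) * Y" using 1 2 by (simp add: algebra_simps)
  then have "\<rho>\<^sup>2 \<le> ms + (1 - \<delta> / 20) * gg" using Y0 by simp
  then have fin: "\<rho>\<^sup>2 \<le> m - \<delta> / 20 * gg - zz / 2" using ms_eq by (simp add: algebra_simps)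
  have g0: "0 \<le> \<delta> / 20 * gg" using \<delta> gg_zz by simp
  then show "\<rho>\<^sup>2 \<le> m" using fin gg_zz by linarith
  have "\<delta> / 20 * gg \<le> 0" "zz \<le> 0" using fin g0 gg_zz rho_sq by linarith+
  then have "gg = 0" "zz = 0" using gg_zz \<delta> by (auto simp: mult_le_0_iff)
  then have "arcs G \<inter> Z \<times> \<Union>G = {}" using gg_zz(1) finA by simp
  moreover have "\<exists>w. (v, w) \<in> arcs G \<inter> Z \<times> \<Union>G" if "v \<in> Z" for v
  proof -
    have "v \<in> \<Union>G" using that V by auto
    then obtain w where "w \<in> nbr G v" using Union_ex_nbr[OF G] by metis
    then have "(v, w) \<in> arcs G \<inter> Z \<times> \<Union>G" using that nbr_subset[of G v] by (auto simp: in_arcs_iff in_nbr_iff)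
    then show ?thesis by blast
  qed
  ultimately show "Z = {}" by blast
qed

end

section \<open>The dichotomy\<close>

context perron_graph
begin

lemma card_arcs_Times:
  assumes "finite P"
  shows "real (card (arcs G \<inter> P \<times> P')) = (\<Sum>v\<in>P. real (card (nbr G v \<inter> P')))"
proof -
  have "arcs G \<inter> P \<times> P' = Sigma P (\<lambda>v. nbr G v \<inter> P')" by (auto simp: arcs_def nbr_def)
  then show ?thesis using assms finN by simp
qed

lemma card_arcs_le: "T \<subseteq> arcs G \<Longrightarrow> real (card T) \<le> 2 * m"
  using card_mono[OF finA, of T] card_arcs' by linarith

lemma card_arcs_disj_le:
  assumes "P \<inter> P' = {}"
  shows "real (card (arcs G \<inter> P \<times> P')) \<le> m"
proof -
  have "card (arcs G \<inter> P \<times> P' \<union> arcs G \<inter> P' \<times> P) = card (arcs G \<inter> P \<times> P') + card (arcs G \<inter> P' \<times> P)"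
    using finA assms by (intro card_Un_disjoint) auto
  moreover have "real (card (arcs G \<inter> P \<times> P' \<union> arcs G \<inter> P' \<times> P)) \<le> 2 * m" by (rule card_arcs_le) auto
  ultimately show ?thesis using card_arcs_swap[of G P P'] by linarith
qed

lemma card_common_nbrs:
  assumes fW: "finite W" and fS: "finite S" and c: "\<And>i. i \<in> S \<Longrightarrow> real (card (W - nbr G i)) \<le> c"
  shows "real (card W) - real (card S) * c \<le> real (card {w\<in>W. \<forall>i\<in>S. w \<in> nbr G i})"
proof -
  have "W \<subseteq> {w\<in>W. \<forall>i\<in>S. w \<in> nbr G i} \<union> (\<Union>i\<in>S. W - nbr G i)" by auto
  then have "card W \<le> card ({w\<in>W. \<forall>i\<in>S. w \<in> nbr G i} \<union> (\<Union>i\<in>S. W - nbr G i))"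
    using fW fS by (intro card_mono) auto
  also have "\<dots> \<le> card {w\<in>W. \<forall>i\<in>S. w \<in> nbr G i} + card (\<Union>i\<in>S. W - nbr G i)" by (rule card_Un_le)
  also have "card (\<Union>i\<in>S. W - nbr G i) \<le> (\<Sum>i\<in>S. card (W - nbr G i))" using fS by (rule card_UN_le)
  finally have "card W \<le> card {w\<in>W. \<forall>i\<in>S. w \<in> nbr G i} + (\<Sum>i\<in>S. card (W - nbr G i))" by simp
  then have "real (card W) \<le> real (card {w\<in>W. \<forall>i\<in>S. w \<in> nbr G i} + (\<Sum>i\<in>S. card (W - nbr G i)))"
    by (rule of_nat_mono)
  also have "\<dots> = real (card {w\<in>W. \<forall>i\<in>S. w \<in> nbr G i}) + (\<Sum>i\<in>S. real (card (W - nbr G i)))" by simp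
  also have "(\<Sum>i\<in>S. real (card (W - nbr G i))) \<le> real (card S) * c" using c by (intro sum_bounded_above) auto
  finally show ?thesis by linarith
qed

end

context Kfree_perron_graph
begin

text \<open>Any k vertices of I containing v and w together miss at most k * c of W, so they keep k
  common neighbours, and the edge vw would complete the forbidden configuration.\<close>

lemma no_edge_in_dense_side:
  assumes fI: "finite I" "k \<le> card I" and fW: "finite W"
    and c: "\<And>i. i \<in> I \<Longrightarrow> real (card (W - nbr G i)) \<le> c"
    and W: "real k + real k * c \<le> real (card W)" and vw: "v \<in> I" "w \<in> I"
  shows "{v, w} \<notin> G"
proof
  assume e: "{v, w} \<in> G"
  have ne: "v \<noteq> w" using e no_loop[OF G] by auto
  have "card (I - {v, w}) = card I - 2" using vw ne fI by (simp add: card_Diff_subset)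
  then have "k - 2 \<le> card (I - {v, w})" using fI by simp
  then obtain R where R: "R \<subseteq> I - {v, w}" "card R = k - 2" "finite R"
    by (rule obtain_subset_with_card_n)
  define S where "S = R \<union> {v, w}"
  have "R \<inter> {v, w} = {}" using R by auto
  then have S: "card S = k" "finite S" "S \<subseteq> I" unfolding S_def using R ne k2 vw by (auto simp: card_Un_disjoint)
  let ?T = "{t\<in>W. \<forall>i\<in>S. t \<in> nbr G i}"
  have "real (card W) - real (card S) * c \<le> real (card ?T)"
    by (rule card_common_nbrs[OF fW S(2)]) (use c S in auto)
  then have "real k \<le> real (card ?T)" using W S(1) by simp
  then have T: "k \<le> card ?T" by simp
  have kS: "k \<le> card S" using S(1) by simp
  show False
    by (rule Kplus_freeD[OF Kfree G k2 S(2) kS T, of v w]) (use e in \<open>auto simp: S_def nbr_def\<close>)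
qed

text \<open>By \<open>dsum\<close>, edges from N to A1 mostly start at vertices that see almost all
  of A1. Vertices seeing almost all of A1 form NN, those seeing almost all of NN form AA, and the
  rest is the exceptional set handed to \<open>split_graph\<close>.\<close>

lemma unbounded_case:
  fixes A1 :: "nat set" and \<delta> \<epsilon> :: real
  defines "N \<equiv> nbr G u" and "s \<equiv> real (card A1)"
  assumes \<delta>: "0 < \<delta>" "real k * \<delta> \<le> 1 / 100" and \<epsilon>: "0 < \<epsilon>" "\<epsilon> \<le> \<delta> ^ 3 / 10 ^ 6"
    and A1: "finite A1" "A1 \<inter> N = {}" "real k \<le> \<delta> * s" and xA1: "\<And>b. b \<in> A1 \<Longrightarrow> 1 - 2 * \<epsilon> \<le> x b"
    and E: "(1 - \<epsilon> / \<delta>) * m \<le> real (card (arcs G \<inter> N \<times> A1))"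
    and dsum: "(\<Sum>a\<in>N. real (card (nbr G a \<inter> A1)) * (s - real (card (nbr G a \<inter> A1)))) \<le> 20 * \<epsilon> * s * m"
    and WW: "real (card (arcs G \<inter> (- N) \<times> (- N))) \<le> \<epsilon> * m"
    and mr: "(1 - \<epsilon>) * \<rho>\<^sup>2 \<le> m" and big: "8 * real k / \<delta> \<le> \<rho>"
  shows "\<exists>AA NN. \<Union>G = AA \<union> NN \<and> AA \<inter> NN = {} \<and> (\<forall>v\<in>AA. \<forall>w\<in>AA. {v, w} \<notin> G)
     \<and> (\<forall>v\<in>NN. \<forall>w\<in>NN. {v, w} \<notin> G) \<and> \<rho>\<^sup>2 \<le> m"
proof -
  define d where "d a = real (card (nbr G a \<inter> A1))" for a
  \<comment> \<open>Edge defects have relative size \<epsilon>; dividing by a threshold \<delta>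
    turns them into proportions of order \<beta>. The cube in the bound on \<epsilon> leaves \<beta>
    far below the square of \<delta>, as the absorption for the exceptional set requires.\<close>
  define \<beta> where "\<beta> = \<epsilon> / \<delta>"
  have \<delta>200: "\<delta> \<le> 1 / 200"
  proof -
    have "2 * \<delta> \<le> real k * \<delta>" using k2 \<delta> by (intro mult_right_mono) auto
    then show ?thesis using \<delta> by linarith
  qed
  have \<epsilon>\<beta>: "\<epsilon> = \<beta> * \<delta>" using \<delta> by (simp add: \<beta>_def)
  have \<beta>0: "0 < \<beta>" using \<delta> \<epsilon> by (simp add: \<beta>_def)
  have \<beta>2: "\<beta> \<le> \<delta>\<^sup>2 / 10 ^ 6"
  proof -
    have "\<beta> \<le> (\<delta> ^ 3 / 10 ^ 6) / \<delta>" unfolding \<beta>_def using \<epsilon> \<delta> by (intro divide_right_mono) auto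
    also have "\<dots> = \<delta>\<^sup>2 / 10 ^ 6" using \<delta> by (simp add: power3_eq_cube power2_eq_square)
    finally show ?thesis .
  qed
  have "\<delta>\<^sup>2 \<le> \<delta> * (1 / 200)" unfolding power2_eq_square using \<delta> \<delta>200 by (intro mult_left_mono) auto
  then have \<beta>1: "\<beta> \<le> \<delta> / 200000000" using \<beta>2 by simp
  have \<epsilon>1: "\<epsilon> \<le> \<beta>"
    unfolding \<epsilon>\<beta> using \<beta>0 \<delta>200 by (simp add: mult_left_le)
  have s0: "0 < s"
  proof (rule ccontr)
    assume "\<not> 0 < s"
    then have "\<delta> * s \<le> 0" using \<delta> by (simp add: mult_le_0_iff)
    then show False using A1(3) k2 by simp
  qed
  have rp: "0 < \<rho>\<^sup>2" using rho0 by simp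
  have m0: "0 < m"
  proof -
    have "0 < (1 - \<epsilon>) * \<rho>\<^sup>2" using \<epsilon>1 \<beta>1 \<delta>200 rp by (intro mult_pos_pos) auto
    then show ?thesis using mr by linarith
  qed
  have NV: "N \<subseteq> \<Union>G" unfolding N_def by (rule nbr_subset)
  have fN: "finite N" unfolding N_def by (rule finN)
  have A1V: "A1 \<subseteq> \<Union>G"
  proof
    fix b assume "b \<in> A1"
    then have "0 < x b" using xA1[of b] \<epsilon>1 \<beta>1 \<delta>200 by linarith
    then show "b \<in> \<Union>G" using x_outside by force
  qed
  have ds: "d a \<le> s" "0 \<le> d a" for a
    unfolding d_def s_def using A1(1) by (auto intro: card_mono)
  have sd: "s - d a = real (card (A1 - nbr G a))" for a
    unfolding s_def d_def using card_Int_Diff[OF A1(1), of "nbr G a"] by (simp add: Int_commute)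
  define NN where "NN = {v\<in>\<Union>G. (1 - \<delta>) * s \<le> d v}"
  define n where "n = real (card NN)"
  have fNN: "finite NN" by (rule finite_subset[OF _ finV]) (auto simp: NN_def)
  have "(\<Sum>a\<in>N - NN. d a) * (\<delta> * s) \<le> 20 * \<epsilon> * s * m"
  proof -
    have "(\<Sum>a\<in>N - NN. d a) * (\<delta> * s) = (\<Sum>a\<in>N - NN. d a * (\<delta> * s))" by (simp add: sum_distrib_right)
    also have "\<dots> \<le> (\<Sum>a\<in>N - NN. d a * (s - d a))"
    proof (rule sum_mono)
      fix a assume "a \<in> N - NN"
      then have "d a < (1 - \<delta>) * s" using NV by (auto simp: NN_def)
      then have "\<delta> * s \<le> s - d a" by (simp add: algebra_simps)
      then show "d a * (\<delta> * s) \<le> d a * (s - d a)" using ds by (intro mult_left_mono)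
    qed
    also have "\<dots> \<le> (\<Sum>a\<in>N. d a * (s - d a))" using fN ds by (intro sum_mono2) auto
    finally show ?thesis using dsum by (simp add: d_def)
  qed
  then have "((\<Sum>a\<in>N - NN. d a) * \<delta>) * s \<le> (20 * \<epsilon> * m) * s" by (simp add: mult_ac)
  then have "(\<Sum>a\<in>N - NN. d a) * \<delta> \<le> 20 * \<epsilon> * m" using s0 by (simp only: mult_le_cancel_right_pos)
  then have "(\<Sum>a\<in>N - NN. d a) * \<delta> \<le> (20 * \<beta> * m) * \<delta>" unfolding \<epsilon>\<beta> by (simp add: mult_ac)
  then have out: "(\<Sum>a\<in>N - NN. d a) \<le> 20 * \<beta> * m" using \<delta> by (simp only: mult_le_cancel_right_pos)
  have "real (card (arcs G \<inter> N \<times> A1)) = (\<Sum>a\<in>N. d a)" unfolding d_def by (rule card_arcs_Times[OF fN])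
  moreover have "(\<Sum>a\<in>N. d a) = (\<Sum>a\<in>N \<inter> NN. d a) + (\<Sum>a\<in>N - NN. d a)" using fN by (rule sum.Int_Diff)
  moreover have "(1 - \<epsilon> / \<delta>) * m = m - \<beta> * m" by (simp add: \<beta>_def algebra_simps)
  ultimately have inn: "m - 21 * (\<beta> * m) \<le> (\<Sum>a\<in>N \<inter> NN. d a)" using E out by linarith
  have \<beta>m: "0 \<le> \<beta> * m" using \<beta>0 m0 by simp
  have "(\<Sum>a\<in>N \<inter> NN. d a) \<le> (\<Sum>a\<in>NN. s)"
  proof -
    have "(\<Sum>a\<in>N \<inter> NN. d a) \<le> (\<Sum>a\<in>NN. d a)" using fNN ds by (intro sum_mono2) auto
    also have "\<dots> \<le> (\<Sum>a\<in>NN. s)" using ds by (intro sum_mono)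
    finally show ?thesis .
  qed
  then have ns0: "m - 21 * (\<beta> * m) \<le> n * s" using inn by (simp add: n_def)
  have ns: "(1 - \<delta>) * \<rho>\<^sup>2 \<le> n * s"
  proof -
    have "(1 - \<delta>) * \<rho>\<^sup>2 \<le> (1 - 21 * \<beta>) * (1 - \<epsilon>) * \<rho>\<^sup>2"
    proof (rule mult_right_mono)
      have "(1 - 21 * \<beta>) * (1 - \<epsilon>) = 1 - 21 * \<beta> - \<epsilon> + 21 * (\<beta> * \<epsilon>)" by (simp add: algebra_simps)
      moreover have "0 \<le> \<beta> * \<epsilon>" using \<beta>0 \<epsilon> by simp
      ultimately show "1 - \<delta> \<le> (1 - 21 * \<beta>) * (1 - \<epsilon>)" using \<epsilon>1 \<beta>1 \<delta> by linarith
    qed (use rp in simp)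
    also have "\<dots> = (1 - 21 * \<beta>) * ((1 - \<epsilon>) * \<rho>\<^sup>2)" by simp
    also have "\<dots> \<le> (1 - 21 * \<beta>) * m" using mr \<beta>1 \<delta>200 by (intro mult_left_mono) auto
    also have "\<dots> = m - 21 * (\<beta> * m)" by (simp add: algebra_simps)
    finally show ?thesis using ns0 by linarith
  qed
  have m_ns: "m \<le> (1 + \<delta>) * (n * s)"
  proof -
    have "m * 1 \<le> m * ((1 + \<delta>) * (1 - 21 * \<beta>))"
    proof (rule mult_left_mono)
      have "(1 + \<delta>) * (1 - 21 * \<beta>) = 1 + \<delta> - 21 * \<beta> - 21 * (\<delta> * \<beta>)" by (simp add: algebra_simps)
      moreover have "\<delta> * \<beta> \<le> 1 * \<beta>" using \<delta>200 \<beta>0 by (intro mult_right_mono) auto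
      ultimately show "1 \<le> (1 + \<delta>) * (1 - 21 * \<beta>)" using \<beta>1 \<delta> by linarith
    qed (use m0 in simp)
    also have "\<dots> = (1 + \<delta>) * (m - 21 * (\<beta> * m))" by (simp add: algebra_simps)
    also have "\<dots> \<le> (1 + \<delta>) * (n * s)" using ns0 \<delta> by (intro mult_left_mono) auto
    finally show ?thesis by simp
  qed
  have s4: "s \<le> 4 * \<rho>"
  proof -
    have "s * (\<rho> / 2) \<le> (\<Sum>b\<in>A1. real (card (nbr G b)))"
      unfolding s_def
    proof (rule sum_bounded_below)
      fix b assume "b \<in> A1"
      then have "1 / 2 \<le> x b" using xA1[of b] \<epsilon>1 \<beta>1 \<delta>200 by linarith
      then have "\<rho> * (1 / 2) \<le> \<rho> * x b" using rho0 by (intro mult_left_mono) auto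
      then show "\<rho> / 2 \<le> real (card (nbr G b))" using rho_x_le_deg[of b] by linarith
    qed
    also have "\<dots> = real (card (arcs G \<inter> A1 \<times> UNIV))" using card_arcs_Times[OF A1(1), of UNIV] by simp
    also have "\<dots> \<le> 2 * m" by (rule card_arcs_le) auto
    also have "\<dots> \<le> (4 * \<rho>) * (\<rho> / 2)" using rho_sq by (simp add: power2_eq_square)
    finally show ?thesis using rho0 by simp
  qed
  have n_k: "real k \<le> \<delta> * n"
  proof -
    have "\<rho> / 2 * \<rho> \<le> (1 - \<delta>) * \<rho>\<^sup>2"
    proof -
      have "1 / 2 * \<rho>\<^sup>2 \<le> (1 - \<delta>) * \<rho>\<^sup>2" using \<delta>200 by (intro mult_right_mono) auto
      then show ?thesis by (simp add: power2_eq_square)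
    qed
    also have "\<dots> \<le> n * s" by (rule ns)
    also have "\<dots> \<le> n * (4 * \<rho>)" using s4 by (intro mult_left_mono) (auto simp: n_def)
    finally have "\<rho> / 2 \<le> n * 4" using rho0 by (simp add: mult.assoc[symmetric])
    then have "8 * real k / \<delta> \<le> 8 * n" using big by linarith
    then show ?thesis using \<delta> by (simp add: field_simps)
  qed
  have n0: "0 < n"
  proof (rule ccontr)
    assume "\<not> 0 < n"
    then have "n = 0" by (simp add: n_def)
    then show False using n_k k2 by simp
  qed
  have miss1: "(\<Sum>a\<in>N \<inter> NN. s - d a) \<le> 25 * \<epsilon> * m"
  proof -
    have "(\<Sum>a\<in>N \<inter> NN. s - d a) * ((1 - \<delta>) * s) = (\<Sum>a\<in>N \<inter> NN. (s - d a) * ((1 - \<delta>) * s))"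
      by (simp add: sum_distrib_right)
    also have "\<dots> \<le> (\<Sum>a\<in>N \<inter> NN. (s - d a) * d a)"
      using ds by (intro sum_mono mult_left_mono) (auto simp: NN_def)
    also have "\<dots> = (\<Sum>a\<in>N \<inter> NN. d a * (s - d a))" by (simp add: mult.commute)
    also have "\<dots> \<le> (\<Sum>a\<in>N. d a * (s - d a))" using fN ds by (intro sum_mono2) auto
    also have "\<dots> \<le> 20 * \<epsilon> * s * m" using dsum by (simp add: d_def)
    also have "\<dots> \<le> 25 * \<epsilon> * m * ((1 - \<delta>) * s)"
    proof -
      have "20 * (\<epsilon> * m * s) \<le> (25 * (1 - \<delta>)) * (\<epsilon> * m * s)" using \<delta>200 \<epsilon> m0 s0 by (intro mult_right_mono) auto
      then show ?thesis by (simp add: mult_ac)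
    qed
    finally have 1: "(\<Sum>a\<in>N \<inter> NN. s - d a) * ((1 - \<delta>) * s) \<le> 25 * \<epsilon> * m * ((1 - \<delta>) * s)" .
    have "0 < (1 - \<delta>) * s" using \<delta>200 s0 by (intro mult_pos_pos) auto
    then show ?thesis using 1 by (simp only: mult_le_cancel_right_pos)
  qed
  \<comment> \<open>Vertices of NN outside N send arcs to most of A1, and these arcs avoid N at both
    ends, so \<open>WW\<close> limits them.\<close>
  have miss2: "(\<Sum>a\<in>NN - N. s - d a) \<le> \<epsilon> * m"
  proof -
    have "real (card (NN - N)) * ((1 - \<delta>) * s) \<le> (\<Sum>a\<in>NN - N. d a)"
      by (rule sum_bounded_below) (auto simp: NN_def)
    also have "\<dots> = real (card (arcs G \<inter> (NN - N) \<times> A1))"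
      unfolding d_def using fNN by (intro card_arcs_Times[symmetric]) auto
    also have "\<dots> \<le> real (card (arcs G \<inter> (- N) \<times> (- N)))"
      using finA A1(2) by (intro of_nat_mono card_mono) auto
    finally have 1: "real (card (NN - N)) * ((1 - \<delta>) * s) \<le> \<epsilon> * m" using WW by linarith
    have "(\<Sum>a\<in>NN - N. s - d a) \<le> real (card (NN - N)) * (\<delta> * s)"
      by (rule sum_bounded_above) (auto simp: NN_def algebra_simps)
    also have "\<dots> \<le> real (card (NN - N)) * ((1 - \<delta>) * s)"
      using \<delta>200 s0 by (intro mult_left_mono mult_right_mono) auto
    finally show ?thesis using 1 by linarith
  qed
  have miss: "(\<Sum>a\<in>NN. s - d a) \<le> 60 * \<epsilon> * (n * s)"
  proof -
    have "(\<Sum>a\<in>NN. s - d a) = (\<Sum>a\<in>N \<inter> NN. s - d a) + (\<Sum>a\<in>NN - N. s - d a)"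
      using sum.Int_Diff[OF fNN, of "\<lambda>a. s - d a" N] by (simp add: Int_commute)
    moreover have "0 \<le> \<epsilon> * m" using \<epsilon> m0 by simp
    ultimately have "(\<Sum>a\<in>NN. s - d a) \<le> 30 * \<epsilon> * m" using miss1 miss2 by linarith
    also have "\<dots> \<le> 30 * \<epsilon> * ((1 + \<delta>) * (n * s))" using m_ns \<epsilon> by (intro mult_left_mono) auto
    also have "\<dots> \<le> 30 * \<epsilon> * (2 * (n * s))" using \<epsilon> \<delta>200 n0 s0 by (intro mult_left_mono mult_right_mono) auto
    finally show ?thesis by simp
  qed
  define AA where "AA = {v\<in>\<Union>G. (1 - \<delta>) * n \<le> real (card (nbr G v \<inter> NN))}"
  have fAA: "finite AA" by (rule finite_subset[OF _ finV]) (auto simp: AA_def)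
  have missNN: "n - real (card (nbr G v \<inter> NN)) = real (card (NN - nbr G v))" for v
    unfolding n_def using card_Int_Diff[OF fNN, of "nbr G v"] by (simp add: Int_commute)
  \<comment> \<open>Nonadjacent pairs between A1 and NN are counted from the other side: they are
    few, so almost all of A1 lies in AA.\<close>
  have bad: "real (card (A1 - AA)) \<le> 60 * \<beta> * s"
  proof -
    have "(\<Sum>b\<in>A1. real (card (NN - nbr G b))) = (\<Sum>b\<in>A1. \<Sum>a\<in>NN. if a \<in> nbr G b then 0 else 1)"
      using fNN by (intro sum.cong) (auto simp: sum.If_cases Diff_eq)
    also have "\<dots> = (\<Sum>a\<in>NN. \<Sum>b\<in>A1. if a \<in> nbr G b then 0 else 1)" by (rule sum.swap)
    also have "\<dots> = (\<Sum>a\<in>NN. s - d a)"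
    proof (intro sum.cong refl)
      fix a
      have "(\<Sum>b\<in>A1. if a \<in> nbr G b then 0 else 1) = (\<Sum>b\<in>A1. if b \<in> nbr G a then 0 else (1::real))"
        by (intro sum.cong) (auto simp: nbr_sym[of a G])
      then show "(\<Sum>b\<in>A1. if a \<in> nbr G b then 0 else 1) = s - d a"
        using A1(1) by (simp add: sum.If_cases sd Diff_eq)
    qed
    finally have dc: "(\<Sum>b\<in>A1. real (card (NN - nbr G b))) = (\<Sum>a\<in>NN. s - d a)" .
    have "real (card (A1 - AA)) * (\<delta> * n) \<le> (\<Sum>b\<in>A1 - AA. real (card (NN - nbr G b)))"
    proof (rule sum_bounded_below)
      fix b assume "b \<in> A1 - AA"
      then have "real (card (nbr G b \<inter> NN)) < (1 - \<delta>) * n" using A1V by (auto simp: AA_def)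
      then show "\<delta> * n \<le> real (card (NN - nbr G b))" using missNN[of b] by (simp add: algebra_simps)
    qed
    also have "\<dots> \<le> (\<Sum>b\<in>A1. real (card (NN - nbr G b)))" using A1(1) by (intro sum_mono2) auto
    also have "\<dots> \<le> 60 * \<epsilon> * (n * s)" unfolding dc by (rule miss)
    also have "\<dots> = (60 * \<beta> * s) * (\<delta> * n)" unfolding \<epsilon>\<beta> by (simp add: mult_ac)
    finally have 1: "real (card (A1 - AA)) * (\<delta> * n) \<le> (60 * \<beta> * s) * (\<delta> * n)" .
    have "0 < \<delta> * n" using \<delta> n0 by simp
    then show ?thesis using 1 by (simp only: mult_le_cancel_right_pos)
  qed
  define A1' where "A1' = A1 \<inter> AA"
  have \<beta>s: "60 * \<beta> * s \<le> \<delta> / 2 * s" using \<beta>1 s0 \<delta> by (intro mult_right_mono) auto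
  have A1split: "s = real (card A1') + real (card (A1 - AA))"
    unfolding s_def A1'_def using card_Int_Diff[OF A1(1), of AA] by simp
  have cA1: "(1 - \<delta> / 2) * s \<le> real (card A1')" using A1split bad \<beta>s by (simp add: algebra_simps)
  have ks: "real k * 100 \<le> s"
  proof -
    have "\<delta> * s \<le> 1 / 200 * s" using \<delta>200 s0 by (intro mult_right_mono) auto
    then show ?thesis using A1(3) by linarith
  qed
  have kn: "real k * 100 \<le> n"
  proof -
    have "\<delta> * n \<le> 1 / 200 * n" using \<delta>200 n0 by (intro mult_right_mono) auto
    then show ?thesis using n_k by linarith
  qed
  have kds: "real k * (\<delta> * s) \<le> 1 / 100 * s" "real k * (\<delta> * n) \<le> 1 / 100 * n"
    using mult_right_mono[OF \<delta>(2), of s] mult_right_mono[OF \<delta>(2), of n] s0 n0 by (auto simp: mult_ac)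
  have kNN: "k \<le> card NN" using kn by (simp add: n_def)
  have kAA: "k \<le> card AA"
  proof -
    have "1 / 2 * s \<le> (1 - \<delta> / 2) * s" using \<delta>200 s0 by (intro mult_right_mono) auto
    then have "real k \<le> real (card A1')" using ks cA1 s0 by linarith
    moreover have "card A1' \<le> card AA" unfolding A1'_def using fAA by (intro card_mono) auto
    ultimately show ?thesis by simp
  qed
  have dNN: "real (card (A1 - nbr G a)) \<le> \<delta> * s" if "a \<in> NN" for a
    using that sd[of a] by (simp add: NN_def algebra_simps)
  have dAA: "real (card (NN - nbr G b)) \<le> \<delta> * n" if "b \<in> AA" for b
    using that missNN[of b] by (simp add: AA_def algebra_simps)
  have indN: "{v, w} \<notin> G" if "v \<in> NN" "w \<in> NN" for v w
    by (rule no_edge_in_dense_side[OF fNN kNN A1(1) dNN _ that], assumption) (use kds(1) ks s0 in \<open>unfold s_def, linarith\<close>)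
  have indA: "{v, w} \<notin> G" if "v \<in> AA" "w \<in> AA" for v w
    by (rule no_edge_in_dense_side[OF fAA kAA fNN dAA _ that], assumption) (use kds(2) kn n0 in \<open>unfold n_def, linarith\<close>)
  \<comment> \<open>A neighbour b in AA together with more than n / 50 neighbours in NN would allow
    v to join the side AA: \<open>k \<le> n / 100\<close> and
    \<open>k * \<delta> \<le> 1 / 100\<close> leave k common neighbours, which forbids the edge
    vb.\<close>
  have bothN: "real (card (nbr G v \<inter> NN)) \<le> n / 50" if ne: "nbr G v \<inter> AA \<noteq> {}" for v
  proof (rule ccontr)
    assume neg: "\<not> ?thesis"
    obtain b where b: "b \<in> AA" "{v, b} \<in> G" using ne by (auto simp: nbr_def)
    have "{v, b} \<notin> G"
    proof (rule no_edge_in_dense_side[of "insert v AA" "nbr G v \<inter> NN" "\<delta> * n"])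
      show "k \<le> card (insert v AA)" using kAA fAA by (simp add: card_insert_if)
      show "real (card (nbr G v \<inter> NN - nbr G i)) \<le> \<delta> * n" if "i \<in> insert v AA" for i
      proof (cases "i = v")
        case True
        then have "nbr G v \<inter> NN - nbr G i = {}" by auto
        then have "card (nbr G v \<inter> NN - nbr G i) = 0" by (simp only: card.empty)
        then show ?thesis using \<delta> n0 by simp
      next
        case False
        have "card (nbr G v \<inter> NN - nbr G i) \<le> card (NN - nbr G i)" using fNN by (intro card_mono) auto
        moreover have "i \<in> AA" using that False by simp
        ultimately show ?thesis using dAA[of i] by linarith
      qed
      show "real k + real k * (\<delta> * n) \<le> real (card (nbr G v \<inter> NN))" using neg kds kn n0 by linarith
    qed (use fAA fNN b in auto)
    then show False using b by simp
  qed
  have bothA: "real (card (nbr G v \<inter> A1)) \<le> s / 50" if ne: "nbr G v \<inter> NN \<noteq> {}" for v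
  proof (rule ccontr)
    assume neg: "\<not> ?thesis"
    obtain b where b: "b \<in> NN" "{v, b} \<in> G" using ne by (auto simp: nbr_def)
    have "{v, b} \<notin> G"
    proof (rule no_edge_in_dense_side[of "insert v NN" "nbr G v \<inter> A1" "\<delta> * s"])
      show "k \<le> card (insert v NN)" using kNN fNN by (simp add: card_insert_if)
      show "real (card (nbr G v \<inter> A1 - nbr G i)) \<le> \<delta> * s" if "i \<in> insert v NN" for i
      proof (cases "i = v")
        case True
        then have "nbr G v \<inter> A1 - nbr G i = {}" by auto
        then have "card (nbr G v \<inter> A1 - nbr G i) = 0" by (simp only: card.empty)
        then show ?thesis using \<delta> s0 by simp
      next
        case False
        have "card (nbr G v \<inter> A1 - nbr G i) \<le> card (A1 - nbr G i)" using A1(1) by (intro card_mono) auto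
        moreover have "i \<in> NN" using that False by simp
        ultimately show ?thesis using dNN[of i] by linarith
      qed
      show "real k + real k * (\<delta> * s) \<le> real (card (nbr G v \<inter> A1))" using neg kds ks s0 by linarith
    qed (use fNN A1 b in auto)
    then show False using b by simp
  qed
  \<comment> \<open>A common vertex would have its neighbours in A1 confined to the small set A1 -
    AA, since AA is independent.\<close>
  have disj: "AA \<inter> NN = {}"
  proof (rule ccontr)
    assume "AA \<inter> NN \<noteq> {}"
    then obtain v where v: "v \<in> AA" "v \<in> NN" by auto
    have "nbr G v \<inter> A1 \<subseteq> A1 - AA" using indA[OF v(1)] by (auto simp: nbr_def)
    then have "card (nbr G v \<inter> A1) \<le> card (A1 - AA)" using A1(1) by (intro card_mono) auto
    then have "(1 - \<delta>) * s \<le> \<delta> / 2 * s" using v(2) bad \<beta>s by (simp add: NN_def d_def)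
    then have "1 - \<delta> \<le> \<delta> / 2" using s0 by (simp only: mult_le_cancel_right_pos)
    then show False using \<delta>200 by linarith
  qed
  define Z where "Z = \<Union>G - (AA \<union> NN)"
  have V: "\<Union>G = AA \<union> NN \<union> Z" by (auto simp: Z_def AA_def NN_def)
  have cAA: "real (card AA) \<le> (1 + 4 * \<delta>) * s"
  proof -
    have "real (card AA) * ((1 - \<delta>) * n) \<le> (\<Sum>v\<in>AA. real (card (nbr G v \<inter> NN)))"
      by (rule sum_bounded_below) (auto simp: AA_def)
    also have "\<dots> = real (card (arcs G \<inter> AA \<times> NN))" by (rule card_arcs_Times[OF fAA, symmetric])
    also have "\<dots> \<le> m" by (rule card_arcs_disj_le[OF disj])
    also have "\<dots> \<le> (1 + \<delta>) * (n * s)" by (rule m_ns)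
    also have "\<dots> \<le> ((1 + 4 * \<delta>) * (1 - \<delta>)) * (n * s)"
    proof (rule mult_right_mono)
      have "(1 + 4 * \<delta>) * (1 - \<delta>) = 1 + 3 * \<delta> - 4 * (\<delta> * \<delta>)" by (simp add: algebra_simps)
      moreover have "\<delta> * \<delta> \<le> \<delta> * (1 / 200)" using \<delta> \<delta>200 by (intro mult_left_mono) auto
      ultimately show "1 + \<delta> \<le> (1 + 4 * \<delta>) * (1 - \<delta>)" using \<delta> by linarith
    qed (use n0 s0 in simp)
    finally have 1: "real (card AA) * ((1 - \<delta>) * n) \<le> (1 + 4 * \<delta>) * s * ((1 - \<delta>) * n)" by (simp add: mult_ac)
    have "0 < (1 - \<delta>) * n" using \<delta>200 n0 by (intro mult_pos_pos) auto
    then show ?thesis using 1 by (simp only: mult_le_cancel_right_pos)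
  qed
  have ns_m: "n * s \<le> 21 / 10 * m"
  proof -
    have "n * ((1 - \<delta>) * s) \<le> (\<Sum>a\<in>NN. d a)" unfolding n_def by (rule sum_bounded_below) (auto simp: NN_def)
    also have "\<dots> = real (card (arcs G \<inter> NN \<times> A1))" unfolding d_def by (rule card_arcs_Times[OF fNN, symmetric])
    also have "\<dots> \<le> 2 * m" by (rule card_arcs_le) auto
    finally have "(1 - \<delta>) * (n * s) \<le> 2 * m" by (simp add: mult_ac)
    moreover have "20 / 21 * (n * s) \<le> (1 - \<delta>) * (n * s)" using \<delta>200 n0 s0 by (intro mult_right_mono) auto
    ultimately show ?thesis by linarith
  qed
  have NA: "m - 147 * (\<beta> * m) \<le> real (card (arcs G \<inter> NN \<times> AA))"
  proof -
    have "(\<Sum>a\<in>N \<inter> NN. d a - 60 * \<beta> * s) \<le> (\<Sum>a\<in>N \<inter> NN. real (card (nbr G a \<inter> AA)))"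
    proof (rule sum_mono)
      fix a
      have "card (nbr G a \<inter> A1) \<le> card (nbr G a \<inter> AA \<union> (A1 - AA))"
        using finN A1(1) by (intro card_mono) auto
      also have "\<dots> \<le> card (nbr G a \<inter> AA) + card (A1 - AA)" by (rule card_Un_le)
      finally have "d a \<le> real (card (nbr G a \<inter> AA)) + real (card (A1 - AA))" by (simp add: d_def)
      then show "d a - 60 * \<beta> * s \<le> real (card (nbr G a \<inter> AA))" using bad by linarith
    qed
    also have "\<dots> \<le> (\<Sum>a\<in>NN. real (card (nbr G a \<inter> AA)))" using fNN by (intro sum_mono2) auto
    also have "\<dots> = real (card (arcs G \<inter> NN \<times> AA))" by (rule card_arcs_Times[OF fNN, symmetric])
    finally have 1: "(\<Sum>a\<in>N \<inter> NN. d a) - real (card (N \<inter> NN)) * (60 * \<beta> * s) \<le> real (card (arcs G \<inter> NN \<times> AA))"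
      by (simp add: sum_subtractf)
    have "real (card (N \<inter> NN)) \<le> n" unfolding n_def using fNN by (intro of_nat_mono card_mono) auto
    then have "real (card (N \<inter> NN)) * (60 * \<beta> * s) \<le> n * (60 * \<beta> * s)" using \<beta>0 s0 by (intro mult_right_mono) auto
    also have "\<dots> = 60 * \<beta> * (n * s)" by simp
    also have "\<dots> \<le> 60 * \<beta> * (21 / 10 * m)" using ns_m \<beta>0 by (intro mult_left_mono) auto
    finally show ?thesis using 1 inn by (simp add: algebra_simps)
  qed
  have few: "real (card (arcs G \<inter> Z \<times> \<Union>G)) \<le> 300 * \<beta> * m"
  proof -
    let ?P = "arcs G \<inter> NN \<times> AA" and ?P' = "arcs G \<inter> AA \<times> NN" and ?Q = "arcs G \<inter> Z \<times> \<Union>G"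
    have "card (?P \<union> ?P' \<union> ?Q) = card ?P + card ?P' + card ?Q"
    proof -
      have "?P \<inter> ?P' = {}" "(?P \<union> ?P') \<inter> ?Q = {}" using disj by (auto simp: Z_def)
      then show ?thesis using finA by (simp add: card_Un_disjoint)
    qed
    moreover have "real (card (?P \<union> ?P' \<union> ?Q)) \<le> 2 * m" by (rule card_arcs_le) auto
    ultimately have "2 * real (card ?P) + real (card ?Q) \<le> 2 * m" using card_arcs_swap[of G NN AA] by simp
    then have "real (card ?Q) \<le> 294 * (\<beta> * m)" using NA by linarith
    then show ?thesis using \<beta>m by (simp add: mult_ac)
  qed
  have sg: "split_graph G x \<rho> u AA NN Z A1' \<delta> s n (300 * \<beta>)"
  proof unfold_locales
    show "\<Union>G = AA \<union> NN \<union> Z" by (rule V)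
    show "AA \<inter> NN = {}" by (rule disj)
    show "Z \<inter> (AA \<union> NN) = {}" by (auto simp: Z_def)
    show "A1' \<subseteq> AA" by (auto simp: A1'_def)
    show "\<delta> \<le> 1 / 100" using \<delta>200 by simp
    show "n = real (card NN)" by (rule n_def)
    show "(1 - 2 * \<delta>) * s / \<rho> \<le> x a" if "a \<in> NN" for a
    proof -
      have "(1 - 2 * \<delta>) * s \<le> (1 - \<delta>) * s * (1 - 2 * \<epsilon>)"
      proof -
        have "(1 - 2 * \<delta>) * s \<le> ((1 - \<delta>) * (1 - 2 * \<epsilon>)) * s"
        proof (rule mult_right_mono)
          have "(1 - \<delta>) * (1 - 2 * \<epsilon>) = 1 - \<delta> - 2 * \<epsilon> + 2 * (\<delta> * \<epsilon>)" by (simp add: algebra_simps)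
          moreover have "0 \<le> \<delta> * \<epsilon>" using \<delta> \<epsilon> by simp
          ultimately show "1 - 2 * \<delta> \<le> (1 - \<delta>) * (1 - 2 * \<epsilon>)" using \<epsilon>1 \<beta>1 \<delta> by linarith
        qed (use s0 in simp)
        then show ?thesis by (simp add: mult_ac)
      qed
      also have "\<dots> \<le> d a * (1 - 2 * \<epsilon>)"
        using that \<epsilon>1 \<beta>1 \<delta>200 by (intro mult_right_mono) (auto simp: NN_def)
      also have "\<dots> \<le> (\<Sum>b\<in>nbr G a \<inter> A1. x b)" unfolding d_def using xA1 by (intro sum_bounded_below) auto
      also have "\<dots> \<le> \<rho> * x a" unfolding eig using finN x0 by (intro sum_mono2) auto
      finally show ?thesis using rho0 by (simp add: field_simps)
    qed
    show "1 - \<delta> \<le> (x b)\<^sup>2" if "b \<in> A1'" for b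
    proof -
      have "1 - \<delta> \<le> 1 - 4 * \<epsilon>" using \<epsilon>1 \<beta>1 \<delta> by linarith
      also have "\<dots> \<le> (1 - 2 * \<epsilon>)\<^sup>2" by (simp add: power2_diff)
      also have "\<dots> \<le> (x b)\<^sup>2" using xA1[of b] that \<epsilon>1 \<beta>1 \<delta>200 by (intro power_mono) (auto simp: A1'_def)
      finally show ?thesis .
    qed
    show "real (card (nbr G v \<inter> NN)) \<le> (1 - \<delta>) * n" if "v \<in> Z" for v
      using that by (auto simp: Z_def AA_def)
    show "\<delta> / 2 * s \<le> real (card (A1' - nbr G v))" if "v \<in> Z" for v
    proof -
      have "d v < (1 - \<delta>) * s" using that by (auto simp: Z_def NN_def)
      then have 1: "\<delta> * s \<le> real (card (A1 - nbr G v))" using sd[of v] by (simp add: algebra_simps)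
      have "card (A1 - nbr G v) \<le> card ((A1' - nbr G v) \<union> (A1 - AA))"
        using A1(1) by (intro card_mono) (auto simp: A1'_def)
      also have "\<dots> \<le> card (A1' - nbr G v) + card (A1 - AA)" by (rule card_Un_le)
      finally have "real (card (A1 - nbr G v)) \<le> real (card (A1' - nbr G v)) + real (card (A1 - AA))" by simp
      then show ?thesis using 1 bad \<beta>s by (simp add: algebra_simps)
    qed
    show "real (card (nbr G v \<inter> A1')) \<le> s / 50" if "nbr G v \<inter> NN \<noteq> {}" for v
    proof -
      have "card (nbr G v \<inter> A1') \<le> card (nbr G v \<inter> A1)" using A1(1) by (intro card_mono) (auto simp: A1'_def)
      then show ?thesis using bothA[OF that] by linarith
    qed
    show "300 * \<beta> \<le> \<delta>\<^sup>2 / 500" using \<beta>2 \<beta>0 by simp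
  qed (use \<delta> s0 indA indN cAA cA1 ns bothN few \<beta>0 in auto)
  interpret sg: split_graph G x \<rho> u AA NN Z A1' \<delta> s n "300 * \<beta>" by (rule sg)
  have "\<Union>G = AA \<union> NN" using V sg.split_conclusion(1) by simp
  moreover have "\<forall>v\<in>AA. \<forall>w\<in>AA. {v, w} \<notin> G" "\<forall>v\<in>NN. \<forall>w\<in>NN. {v, w} \<notin> G"
    using indA indN by auto
  ultimately show ?thesis
    using disj sg.split_conclusion(2) by (intro exI[of _ AA] exI[of _ NN] conjI)
qed

text \<open>Up to few arcs, a small loss at u forces an arc to join a neighbour of u to a vertex of
  entry near 1. Such vertices lie outside (A1) or inside (A2) the neighbourhood of u. If all of
  them, or A1 alone, are few, they form the small cover; otherwise \<open>unbounded_case\<close>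
  applies to A1.\<close>

lemma dichotomy:
  fixes \<delta> \<epsilon> \<epsilon>0 :: real
  assumes \<delta>: "0 < \<delta>" "real k * \<delta> \<le> 1 / 100" and \<epsilon>: "0 < \<epsilon>" "\<epsilon> \<le> \<delta> ^ 3 / 10 ^ 6"
    and \<epsilon>0: "0 \<le> \<epsilon>0" "\<epsilon>0 \<le> \<epsilon> ^ 4"
    and exc: "\<And>w. excess w \<le> \<epsilon>0 * m"
    and heavy: "real (card (arcs G \<inter> {v\<in>nbr G u. \<epsilon> \<le> x v} \<times> {v\<in>nbr G u. \<epsilon> \<le> x v})) \<le> \<epsilon>0 * m"
    and big: "8 * real k / \<delta> \<le> \<rho>" "4 / \<epsilon> \<le> \<rho>"
  shows "(\<exists>A0. finite A0 \<and> real (card A0) < real k / \<delta>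
        \<and> real (card (arcs G \<inter> (- A0) \<times> (- A0))) \<le> 23 * real k * \<epsilon> * m)
    \<or> (\<exists>AA NN. \<Union>G = AA \<union> NN \<and> AA \<inter> NN = {} \<and> (\<forall>v\<in>AA. \<forall>w\<in>AA. {v, w} \<notin> G)
     \<and> (\<forall>v\<in>NN. \<forall>w\<in>NN. {v, w} \<notin> G) \<and> \<rho>\<^sup>2 \<le> m)"
proof -
  let ?H = "\<exists>A0. finite A0 \<and> real (card A0) < real k / \<delta>
        \<and> real (card (arcs G \<inter> (- A0) \<times> (- A0))) \<le> 23 * real k * \<epsilon> * m"
  define N where "N = nbr G u"
  define Ah where "Ah = {v. 1 - 2 * \<epsilon> \<le> x v}"
  define A1 where "A1 = Ah - N"
  define A2 where "A2 = Ah \<inter> N"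
  define N0 where "N0 = {v\<in>N. x v < \<epsilon>}"
  define N1 where "N1 = {v\<in>N. \<epsilon> \<le> x v}"
  have k1: "2 \<le> real k" using k2 by simp
  have \<delta>1: "\<delta> \<le> 1 / 200"
  proof -
    have "2 * \<delta> \<le> real k * \<delta>" using k1 \<delta> by (intro mult_right_mono) auto
    then show ?thesis using \<delta> by linarith
  qed
  have \<epsilon>1: "\<epsilon> \<le> 1 / 10 ^ 6"
  proof -
    have "\<delta> ^ 3 \<le> 1" using \<delta> \<delta>1 by (intro power_le_one) auto
    then show ?thesis using \<epsilon> by simp
  qed
  have e4: "\<epsilon>0 \<le> \<epsilon>" "2 * \<epsilon>0 / \<epsilon> \<le> \<epsilon>"
  proof -
    have "\<epsilon> ^ 4 \<le> \<epsilon> ^ 1" using \<epsilon> \<epsilon>1 by (intro power_decreasing) auto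
    then show "\<epsilon>0 \<le> \<epsilon>" using \<epsilon>0 by simp
    have "2 * \<epsilon>0 / \<epsilon> \<le> 2 * \<epsilon> ^ 4 / \<epsilon>" using \<epsilon>0 \<epsilon> by (intro divide_right_mono) auto
    also have "\<dots> = 2 * \<epsilon> ^ 2 * \<epsilon>" using \<epsilon> by (simp add: eval_nat_numeral)
    also have "\<dots> \<le> 1 * \<epsilon>"
    proof (rule mult_right_mono)
      have "\<epsilon>\<^sup>2 \<le> \<epsilon> ^ 1" using \<epsilon> \<epsilon>1 by (intro power_decreasing) auto
      then show "2 * \<epsilon>\<^sup>2 \<le> 1" using \<epsilon>1 by simp
    qed (use \<epsilon> in simp)
    finally show "2 * \<epsilon>0 / \<epsilon> \<le> \<epsilon>" by simp
  qed
  have m_rho: "(1 - \<epsilon>) * \<rho>\<^sup>2 \<le> m"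
  proof -
    have "\<rho>\<^sup>2 \<le> m + \<epsilon>0 * m" using rho_sq_le exc[of u] excess_nonneg[of u] by linarith
    also have "\<dots> \<le> m + \<epsilon> * m" using e4 by (intro add_left_mono mult_right_mono) auto
    finally have "(1 - \<epsilon>) * \<rho>\<^sup>2 \<le> (1 - \<epsilon>) * (m + \<epsilon> * m)" using \<epsilon>1 by (intro mult_left_mono) auto
    also have "\<dots> = m - \<epsilon>\<^sup>2 * m" by (simp add: algebra_simps power2_eq_square)
    also have "\<dots> \<le> m" by simp
    finally show ?thesis .
  qed
  have m_half: "\<rho>\<^sup>2 / 2 \<le> m"
  proof -
    have "1 / 2 * \<rho>\<^sup>2 \<le> (1 - \<epsilon>) * \<rho>\<^sup>2" using \<epsilon>1 by (intro mult_right_mono) auto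
    then show ?thesis using m_rho by linarith
  qed
  have rp: "0 < \<rho>\<^sup>2" using rho0 by simp
  have m0: "0 < m" using m_half rp by linarith
  have em0: "0 < \<epsilon> * m" using \<epsilon> m0 by simp
  have AhV: "Ah \<subseteq> \<Union>G"
  proof
    fix v assume "v \<in> Ah"
    then have "0 < x v" using \<epsilon>1 by (simp add: Ah_def)
    then show "v \<in> \<Union>G" using x_outside by force
  qed
  have fAh: "finite Ah" using AhV finV finite_subset by metis
  have fA: "finite A1" "finite A2" using fAh by (auto simp: A1_def A2_def)
  have fN: "finite N" "finite N0" "finite N1" using finN by (auto simp: N_def N0_def N1_def)
  have NN: "N = N0 \<union> N1" "N0 \<inter> N1 = {}" by (auto simp: N0_def N1_def)
  have uAh: "u \<in> Ah" using xu \<epsilon> by (simp add: Ah_def)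
  have cN1: "real (card N1) \<le> \<rho> / \<epsilon>" unfolding N1_def N_def using \<epsilon> by (intro card_heavy_nbrs) auto
  have bud: "c * real (card T) \<le> 5 * \<epsilon> * m"
    if "T \<subseteq> arcs G" "\<And>p. p \<in> T \<Longrightarrow> c \<le> loss w p" "w \<in> Ah" for T c w
  proof -
    have "c * real (card T) \<le> 2 * m * (1 - x w) + excess w" using that by (intro budget_high) auto
    also have "2 * m * (1 - x w) \<le> 2 * m * (2 * \<epsilon>)" using that(3) m0 by (intro mult_left_mono) (auto simp: Ah_def)
    also have "excess w \<le> \<epsilon> * m" using exc[of w] mult_right_mono[OF e4(1), of m] m0 by linarith
    finally show ?thesis by (simp add: mult_ac)
  qed
  \<comment> \<open>Besides noticeable loss, arcs between two heavy neighbours are discarded: their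
    loss can be small although neither end is close to 1.\<close>
  define bad where "bad = {p\<in>arcs G. \<epsilon> \<le> loss u p} \<union> arcs G \<inter> N1 \<times> N1"
  have fbad: "finite bad" using finA by (simp add: bad_def)
  have cbad: "real (card bad) \<le> \<epsilon> * m"
  proof -
    have "\<epsilon> * real (card {p\<in>arcs G. \<epsilon> \<le> loss u p}) \<le> excess u" by (rule budget_u) auto
    then have "\<epsilon> * real (card {p\<in>arcs G. \<epsilon> \<le> loss u p}) \<le> \<epsilon>0 * m" using exc[of u] by linarith
    then have 1: "real (card {p\<in>arcs G. \<epsilon> \<le> loss u p}) \<le> \<epsilon>0 / \<epsilon> * m" using \<epsilon> by (simp add: field_simps)
    have "\<epsilon>0 * m \<le> \<epsilon>0 / \<epsilon> * m"
    proof (rule mult_right_mono)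
      have "\<epsilon> * \<epsilon>0 \<le> 1 * \<epsilon>0" using \<epsilon>1 \<epsilon>0 by (intro mult_right_mono) auto
      then show "\<epsilon>0 \<le> \<epsilon>0 / \<epsilon>" using \<epsilon> by (simp add: field_simps)
    qed (use m0 in simp)
    then have 2: "real (card (arcs G \<inter> N1 \<times> N1)) \<le> \<epsilon>0 / \<epsilon> * m" using heavy by (simp add: N1_def N_def)
    have "card bad \<le> card {p\<in>arcs G. \<epsilon> \<le> loss u p} + card (arcs G \<inter> N1 \<times> N1)"
      unfolding bad_def by (rule card_Un_le)
    then have "real (card bad) \<le> (2 * \<epsilon>0 / \<epsilon>) * m" using 1 2 by (simp add: field_simps)
    also have "\<dots> \<le> \<epsilon> * m" using e4 m0 by (intro mult_right_mono) auto
    finally show ?thesis .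
  qed
  have cover: "arcs G \<subseteq> bad \<union> arcs G \<inter> N \<times> A1 \<union> arcs G \<inter> A1 \<times> N \<union> arcs G \<inter> A2 \<times> N0 \<union> arcs G \<inter> N0 \<times> A2"
  proof (rule subsetI)
    fix p assume p: "p \<in> arcs G"
    obtain v z where vz: "p = (v, z)" by (cases p)
    show "p \<in> bad \<union> arcs G \<inter> N \<times> A1 \<union> arcs G \<inter> A1 \<times> N \<union> arcs G \<inter> A2 \<times> N0 \<union> arcs G \<inter> N0 \<times> A2"
    proof (cases "\<epsilon> \<le> loss u p")
      case True then show ?thesis using p by (simp add: bad_def)
    next
      case False
      then have l: "loss u p < \<epsilon>" by simp
      consider "v \<in> N" "z \<in> N" | "v \<in> N" "z \<notin> N" | "v \<notin> N" "z \<in> N" | "v \<notin> N" "z \<notin> N" by blast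
      then show ?thesis
      proof cases
        case 1
        then have s: "1 - \<epsilon> < x v + x z" using l by (simp add: vz loss_def N_def)
        show ?thesis
        proof (cases "\<epsilon> \<le> x v \<and> \<epsilon> \<le> x z")
          case True
          then show ?thesis using p 1 by (simp add: bad_def vz N1_def)
        next
          case False
          then consider "x v < \<epsilon>" | "x z < \<epsilon>" by linarith
          then show ?thesis
          proof cases
            case c1: 1
            then have "z \<in> A2" "v \<in> N0" using \<open>v \<in> N\<close> \<open>z \<in> N\<close> s by (auto simp: A2_def Ah_def N0_def)
            then show ?thesis using p vz by simp
          next
            case c2: 2
            then have "v \<in> A2" "z \<in> N0" using \<open>v \<in> N\<close> \<open>z \<in> N\<close> s by (auto simp: A2_def Ah_def N0_def)
            then show ?thesis using p vz by simp
          qed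
        qed
      next
        case 2
        then have "1 - \<epsilon> < x z" using l by (simp add: vz loss_def N_def)
        then have "z \<in> A1" using 2 \<epsilon> by (simp add: A1_def Ah_def)
        then show ?thesis using p vz 2 by simp
      next
        case 3
        then have "1 - \<epsilon> < x v" using l by (simp add: vz loss_def N_def)
        then have "v \<in> A1" using 3 \<epsilon> by (simp add: A1_def Ah_def)
        then show ?thesis using p vz 3 by simp
      next
        case 4
        then have "loss u p = 1" by (simp add: vz loss_def N_def)
        then show ?thesis using l \<epsilon>1 by simp
      qed
    qed
  qed
  show ?thesis
  proof (cases "real (card Ah) < real k / \<delta>")
    case True
    have "arcs G \<inter> (- Ah) \<times> (- Ah) \<subseteq> bad" using cover by (auto simp: A1_def A2_def)
    then have "card (arcs G \<inter> (- Ah) \<times> (- Ah)) \<le> card bad" using fbad by (rule card_mono[rotated])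
    then have "real (card (arcs G \<inter> (- Ah) \<times> (- Ah))) \<le> 1 * (\<epsilon> * m)" using cbad by linarith
    also have "\<dots> \<le> 23 * real k * (\<epsilon> * m)" using k1 em0 by (intro mult_right_mono) auto
    finally have "real (card (arcs G \<inter> (- Ah) \<times> (- Ah))) \<le> 23 * real k * \<epsilon> * m" by (simp add: mult_ac)
    then show ?thesis using True fAh by blast
  next
    case False
    have kAh: "k \<le> card Ah"
    proof -
      have "real k * 1 \<le> real k / \<delta>" using \<delta> \<delta>1 k1 by (simp add: field_simps mult_left_le)
      then show ?thesis using False by simp
    qed
    \<comment> \<open>If A2 is nonempty, u has a neighbour b0 of entry near 1. Put both into a set S
      of k near-1 vertices. The budget at each w in S shows that few arcs from A2 end in light
      neighbours outside the neighbourhood of w; as A2 has at most 2\<rho> vertices, more arcs would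
      force k common neighbours of S.\<close>
    have Eb: "real (card (arcs G \<inter> A2 \<times> N0)) \<le> 11 * real k * (\<epsilon> * m)"
    proof (rule ccontr)
      assume neg: "\<not> ?thesis"
      have "A2 \<noteq> {}"
      proof
        assume "A2 = {}"
        then have "real (card (arcs G \<inter> A2 \<times> N0)) = 0" by simp
        moreover have "0 \<le> 11 * real k * (\<epsilon> * m)" by (rule mult_nonneg_nonneg) (simp, rule less_imp_le[OF em0])
        ultimately show False using neg by linarith
      qed
      then obtain b0 where b0: "b0 \<in> A2" by auto
      have ub0: "{u, b0} \<in> G" using b0 by (simp add: A2_def N_def nbr_def)
      have ne: "u \<noteq> b0" using ub0 no_loop[OF G] by auto
      have b0Ah: "b0 \<in> Ah" using b0 by (simp add: A2_def)
      have "card (Ah - {u, b0}) = card Ah - 2" using uAh b0Ah ne fAh by (simp add: card_Diff_subset)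
      then have "k - 2 \<le> card (Ah - {u, b0})" using kAh by simp
      then obtain R where R: "R \<subseteq> Ah - {u, b0}" "card R = k - 2" "finite R"
        by (rule obtain_subset_with_card_n)
      define S where "S = R \<union> {u, b0}"
      have "R \<inter> {u, b0} = {}" using R by auto
      then have S: "card S = k" "finite S" "S \<subseteq> Ah"
        unfolding S_def using R ne k2 uAh b0Ah by (auto simp: card_Un_disjoint)
      define W where "W = {a\<in>N0. \<forall>w\<in>S. a \<in> nbr G w}"
      have fW: "finite W" using fN by (simp add: W_def)
      define T where "T w = arcs G \<inter> A2 \<times> (N0 - nbr G w)" for w
      have T: "real (card (T w)) \<le> 10 * (\<epsilon> * m)" if "w \<in> S" for w
      proof -
        have "1 / 2 * real (card (T w)) \<le> 5 * \<epsilon> * m"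
        proof (rule bud[of _ _ w])
          fix p assume "p \<in> T w"
          then have "snd p \<notin> nbr G w" "x (snd p) < \<epsilon>" by (auto simp: T_def N0_def)
          then show "1 / 2 \<le> loss w p" using loss_ge_snd[of p w] \<epsilon>1 by simp
        qed (use that S in \<open>auto simp: T_def\<close>)
        then show ?thesis by simp
      qed
      have "arcs G \<inter> A2 \<times> N0 \<subseteq> A2 \<times> W \<union> (\<Union>w\<in>S. T w)" by (auto simp: W_def T_def)
      then have "card (arcs G \<inter> A2 \<times> N0) \<le> card (A2 \<times> W \<union> (\<Union>w\<in>S. T w))"
        using fA fW S finA by (intro card_mono) (auto simp: T_def)
      also have "\<dots> \<le> card (A2 \<times> W) + card (\<Union>w\<in>S. T w)" by (rule card_Un_le)
      also have "card (\<Union>w\<in>S. T w) \<le> (\<Sum>w\<in>S. card (T w))" using S by (intro card_UN_le)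
      finally have "card (arcs G \<inter> A2 \<times> N0) \<le> card A2 * card W + (\<Sum>w\<in>S. card (T w))"
        by (simp add: card_cartesian_product)
      then have "real (card (arcs G \<inter> A2 \<times> N0)) \<le> real (card A2 * card W + (\<Sum>w\<in>S. card (T w)))"
        by (rule of_nat_mono)
      also have "\<dots> = real (card A2) * real (card W) + (\<Sum>w\<in>S. real (card (T w)))" by simp
      also have "(\<Sum>w\<in>S. real (card (T w))) \<le> real (card S) * (10 * (\<epsilon> * m))" using T by (rule sum_bounded_above)
      also have "real (card A2) * real (card W) \<le> (2 * \<rho>) * real (card W)"
      proof (rule mult_right_mono)
        have "card A2 \<le> card {v\<in>nbr G u. 1 / 2 \<le> x v}"
          using finN \<epsilon>1 by (intro card_mono) (auto simp: A2_def Ah_def N_def)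
        moreover have "real (card {v\<in>nbr G u. 1 / 2 \<le> x v}) \<le> \<rho> / (1 / 2)" by (rule card_heavy_nbrs) simp
        ultimately show "real (card A2) \<le> 2 * \<rho>" by simp
      qed simp
      finally have "real k * (\<epsilon> * m) \<le> 2 * \<rho> * real (card W)" using neg S(1) by (simp add: algebra_simps)
      moreover have "2 * \<rho> \<le> \<epsilon> * m"
      proof -
        have "4 \<le> \<epsilon> * \<rho>" using big(2) \<epsilon> by (simp add: field_simps)
        then have "4 * \<rho> \<le> \<epsilon> * \<rho> * \<rho>" using rho0 by (intro mult_right_mono) auto
        then have "2 * \<rho> \<le> \<epsilon> * (\<rho>\<^sup>2 / 2)" by (simp add: power2_eq_square)
        also have "\<dots> \<le> \<epsilon> * m" using m_half \<epsilon> by (intro mult_left_mono) auto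
        finally show ?thesis .
      qed
      then have "real k * (2 * \<rho>) \<le> real k * (\<epsilon> * m)" by (intro mult_left_mono) auto
      ultimately have "real k * (2 * \<rho>) \<le> real (card W) * (2 * \<rho>)" by (simp add: mult_ac)
      then have kW: "k \<le> card W" using rho0 by simp
      have kS: "k \<le> card S" using S by simp
      show False
        by (rule Kplus_freeD[OF Kfree G k2 S(2) kS kW, of u b0]) (use ub0 in \<open>auto simp: S_def W_def nbr_def\<close>)
    qed
    then have Eb': "real (card (arcs G \<inter> N0 \<times> A2)) \<le> 11 * real k * (\<epsilon> * m)"
      using card_arcs_swap[of G N0 A2] by simp
    show ?thesis
    proof (cases "real (card A1) < real k / \<delta>")
      case True
      have "arcs G \<inter> (- A1) \<times> (- A1) \<subseteq> bad \<union> (arcs G \<inter> A2 \<times> N0 \<union> arcs G \<inter> N0 \<times> A2)" using cover by auto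
      then have "card (arcs G \<inter> (- A1) \<times> (- A1)) \<le> card (bad \<union> (arcs G \<inter> A2 \<times> N0 \<union> arcs G \<inter> N0 \<times> A2))"
        using fbad finA by (intro card_mono) auto
      also have "\<dots> \<le> card bad + card (arcs G \<inter> A2 \<times> N0 \<union> arcs G \<inter> N0 \<times> A2)" by (rule card_Un_le)
      also have "card (arcs G \<inter> A2 \<times> N0 \<union> arcs G \<inter> N0 \<times> A2) \<le> card (arcs G \<inter> A2 \<times> N0) + card (arcs G \<inter> N0 \<times> A2)"
        by (rule card_Un_le)
      finally have "real (card (arcs G \<inter> (- A1) \<times> (- A1))) \<le> \<epsilon> * m + 22 * (real k * (\<epsilon> * m))"
        using cbad Eb Eb' by linarith
      also have "\<dots> \<le> 23 * (real k * (\<epsilon> * m))" using mult_right_mono[of 1 "real k" "\<epsilon> * m"] k1 em0 by linarith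
      finally have "real (card (arcs G \<inter> (- A1) \<times> (- A1))) \<le> 23 * real k * \<epsilon> * m" by (simp add: mult_ac)
      then show ?thesis using True fA by blast
    next
      case A1big: False
      define s where "s = real (card A1)"
      have ks: "real k \<le> \<delta> * s" using A1big \<delta> by (simp add: s_def field_simps)
      have s0: "0 < s"
      proof (rule ccontr)
        assume "\<not> 0 < s"
        then have "\<delta> * s \<le> 0" using \<delta> by (simp add: mult_le_0_iff)
        then show False using ks k1 by simp
      qed
      have E: "(1 - \<epsilon> / \<delta>) * m \<le> real (card (arcs G \<inter> N \<times> A1))"
      proof -
        let ?P = "arcs G \<inter> N \<times> A1" and ?P' = "arcs G \<inter> A1 \<times> N" and ?Q = "arcs G \<inter> A2 \<times> N0" and ?Q' = "arcs G \<inter> N0 \<times> A2"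
        have "card (arcs G) \<le> card (bad \<union> ?P \<union> ?P' \<union> ?Q \<union> ?Q')"
          by (rule card_mono[OF _ cover]) (use fbad finA in auto)
        also have "\<dots> \<le> card bad + card ?P + card ?P' + card ?Q + card ?Q'"
          by (meson add_le_mono card_Un_le le_refl order_trans)
        finally have "2 * m \<le> real (card bad) + 2 * real (card ?P) + 2 * real (card ?Q)"
          using card_arcs' card_arcs_swap[of G A1 N] card_arcs_swap[of G N0 A2] by linarith
        then have 1: "m - 12 * (real k * (\<epsilon> * m)) \<le> real (card ?P)"
          using cbad Eb mult_right_mono[of 1 "real k" "\<epsilon> * m"] k1 em0 by linarith
        have "12 * (real k * (\<epsilon> * m)) \<le> \<epsilon> / \<delta> * m"
        proof -
          have "real k \<le> 1 / 100 / \<delta>" using \<delta> by (simp add: field_simps)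
          then have "12 * real k \<le> 1 / \<delta>" using \<delta> by (simp add: field_simps)
          then have "12 * real k * (\<epsilon> * m) \<le> 1 / \<delta> * (\<epsilon> * m)" using em0 by (intro mult_right_mono) auto
          then show ?thesis by simp
        qed
        then show ?thesis using 1 by (simp add: algebra_simps)
      qed
      have WW: "real (card (arcs G \<inter> (- N) \<times> (- N))) \<le> \<epsilon>0 * m"
      proof -
        have "1 * real (card (arcs G \<inter> (- N) \<times> (- N))) \<le> excess u"
          by (rule budget_u) (auto simp: loss_def N_def)
        then show ?thesis using exc[of u] by linarith
      qed
      \<comment> \<open>The factor s minus the degree counts the w in A1 that miss a. Exchanging the
        sums leaves, for each w, the arcs from non-neighbours of w into A1, which the budget at w
        controls.\<close>
      have dsum: "(\<Sum>a\<in>N. real (card (nbr G a \<inter> A1)) * (s - real (card (nbr G a \<inter> A1)))) \<le> 20 * \<epsilon> * s * m"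
      proof -
        let ?d = "\<lambda>a. real (card (nbr G a \<inter> A1))"
        have sd: "s - ?d a = real (card (A1 - nbr G a))" for a
          unfolding s_def using card_Int_Diff[OF fA(1), of "nbr G a"] by (simp add: Int_commute)
        have swap: "(\<Sum>a\<in>P. ?d a * (s - ?d a)) = (\<Sum>w\<in>A1. real (card (arcs G \<inter> (P - nbr G w) \<times> A1)))"
          if fP: "finite P" for P
        proof -
          have "(\<Sum>a\<in>P. ?d a * (s - ?d a)) = (\<Sum>a\<in>P. \<Sum>w\<in>A1. if a \<in> nbr G w then 0 else ?d a)"
          proof (intro sum.cong refl)
            fix a
            have "(\<Sum>w\<in>A1. if a \<in> nbr G w then 0 else ?d a) = (\<Sum>w\<in>A1. if w \<in> nbr G a then 0 else ?d a)"
              by (intro sum.cong) (auto simp: nbr_sym[of a G])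
            also have "\<dots> = ?d a * real (card (A1 - nbr G a))"
              using fA by (simp add: sum.If_cases Diff_eq mult.commute)
            finally show "?d a * (s - ?d a) = (\<Sum>w\<in>A1. if a \<in> nbr G w then 0 else ?d a)"
              unfolding sd by (rule sym)
          qed
          also have "\<dots> = (\<Sum>w\<in>A1. \<Sum>a\<in>P. if a \<in> nbr G w then 0 else ?d a)" by (rule sum.swap)
          also have "\<dots> = (\<Sum>w\<in>A1. real (card (arcs G \<inter> (P - nbr G w) \<times> A1)))"
          proof (intro sum.cong refl)
            fix w
            have "(\<Sum>a\<in>P. if a \<in> nbr G w then 0 else ?d a) = (\<Sum>a\<in>P - nbr G w. ?d a)"
              using fP by (simp add: sum.If_cases Diff_eq)
            also have "\<dots> = real (card (arcs G \<inter> (P - nbr G w) \<times> A1))"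
              using fP by (intro card_arcs_Times[symmetric]) auto
            finally show "(\<Sum>a\<in>P. if a \<in> nbr G w then 0 else ?d a) = real (card (arcs G \<inter> (P - nbr G w) \<times> A1))" .
          qed
          finally show ?thesis .
        qed
        have p0: "(\<Sum>a\<in>N0. ?d a * (s - ?d a)) \<le> s * (10 * (\<epsilon> * m))"
          unfolding swap[OF fN(2)]
        proof (subst s_def, rule sum_bounded_above)
          fix w assume w: "w \<in> A1"
          have "1 / 2 * real (card (arcs G \<inter> (N0 - nbr G w) \<times> A1)) \<le> 5 * \<epsilon> * m"
          proof (rule bud[of _ _ w])
            fix p assume "p \<in> arcs G \<inter> (N0 - nbr G w) \<times> A1"
            then have "fst p \<notin> nbr G w" "x (fst p) < \<epsilon>" by (auto simp: N0_def)
            then show "1 / 2 \<le> loss w p" using \<epsilon>1 by (simp add: loss_def)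
          qed (use w in \<open>auto simp: A1_def\<close>)
          then show "real (card (arcs G \<inter> (N0 - nbr G w) \<times> A1)) \<le> 10 * (\<epsilon> * m)" by simp
        qed
        have p1: "(\<Sum>a\<in>N1. ?d a * (s - ?d a)) \<le> s * (6 * (\<epsilon> * m))"
        \<comment> \<open>Heavy neighbours need two regimes. For large s an arc missing w at both
          ends loses 1, and the rest is charged to arcs inside A1; the factor of order \<rho> /
          \<epsilon> is paid for by the fourth power in the bound on \<epsilon>0. For small s the
          trivial estimate suffices.\<close>
        proof (cases "\<epsilon>\<^sup>2 * \<rho> \<le> s")
          case True
          have "(\<Sum>a\<in>N1. ?d a * (s - ?d a)) \<le> (\<Sum>w\<in>A1. 5 * \<epsilon> * m + real (card N1) * real (card (nbr G w \<inter> A1)))"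
            unfolding swap[OF fN(3)]
          proof (rule sum_mono)
            fix w assume w: "w \<in> A1"
            let ?T = "arcs G \<inter> (N1 - nbr G w) \<times> (A1 - nbr G w)"
            have "1 * real (card ?T) \<le> 5 * \<epsilon> * m"
              by (rule bud[of _ _ w]) (use w in \<open>auto simp: loss_def A1_def\<close>)
            moreover have "card (arcs G \<inter> (N1 - nbr G w) \<times> A1) \<le> card (?T \<union> N1 \<times> (nbr G w \<inter> A1))"
              using finA fN fA by (intro card_mono) auto
            then have "card (arcs G \<inter> (N1 - nbr G w) \<times> A1) \<le> card ?T + card N1 * card (nbr G w \<inter> A1)"
              using card_Un_le[of ?T "N1 \<times> (nbr G w \<inter> A1)"] by (simp add: card_cartesian_product)
            then have "real (card (arcs G \<inter> (N1 - nbr G w) \<times> A1)) \<le> real (card ?T + card N1 * card (nbr G w \<inter> A1))"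
              by (rule of_nat_mono)
            ultimately show "real (card (arcs G \<inter> (N1 - nbr G w) \<times> A1)) \<le> 5 * \<epsilon> * m + real (card N1) * real (card (nbr G w \<inter> A1))"
              by simp
          qed
          also have "\<dots> = s * (5 * (\<epsilon> * m)) + real (card N1) * real (card (arcs G \<inter> A1 \<times> A1))"
            unfolding card_arcs_Times[OF fA(1)] by (simp add: sum.distrib sum_distrib_left s_def)
          also have "real (card N1) * real (card (arcs G \<inter> A1 \<times> A1)) \<le> (\<rho> / \<epsilon>) * (\<epsilon>0 * m)"
          proof (rule mult_mono)
            have "card (arcs G \<inter> A1 \<times> A1) \<le> card (arcs G \<inter> (- N) \<times> (- N))"
              using finA by (intro card_mono) (auto simp: A1_def)
            then show "real (card (arcs G \<inter> A1 \<times> A1)) \<le> \<epsilon>0 * m" using WW by linarith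
          qed (use cN1 rho0 \<epsilon> in auto)
          also have "\<dots> \<le> s * (\<epsilon> * m)"
          proof -
            have "\<rho> / \<epsilon> * \<epsilon>0 \<le> \<rho> / \<epsilon> * \<epsilon> ^ 4" using \<epsilon>0 rho0 \<epsilon> by (intro mult_left_mono) auto
            also have "\<dots> = (\<epsilon>\<^sup>2 * \<rho>) * \<epsilon>" using \<epsilon> by (simp add: eval_nat_numeral)
            also have "\<dots> \<le> s * \<epsilon>" using True \<epsilon> by (intro mult_right_mono) auto
            finally have "(\<rho> / \<epsilon> * \<epsilon>0) * m \<le> (s * \<epsilon>) * m" using m0 by (intro mult_right_mono) auto
            then show ?thesis by (simp add: mult_ac)
          qed
          finally show ?thesis by (simp add: algebra_simps)
        next
          case False
          have "(\<Sum>a\<in>N1. ?d a * (s - ?d a)) \<le> real (card N1) * (s * s)"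
          proof (rule sum_bounded_above)
            fix a
            have "?d a \<le> s" unfolding s_def using fA by (intro of_nat_mono card_mono) auto
            then show "?d a * (s - ?d a) \<le> s * s" using s0 by (intro mult_mono) auto
          qed
          also have "\<dots> \<le> (\<rho> / \<epsilon>) * (s * (\<epsilon>\<^sup>2 * \<rho>))"
            using cN1 False s0 rho0 \<epsilon> by (intro mult_mono) auto
          also have "\<dots> = s * \<epsilon> * \<rho>\<^sup>2" using \<epsilon> by (simp add: power2_eq_square)
          also have "\<dots> \<le> s * \<epsilon> * (2 * m)" using m_half s0 \<epsilon> by (intro mult_left_mono) auto
          also have "\<dots> \<le> s * (6 * (\<epsilon> * m))" using s0 em0 by simp
          finally show ?thesis .
        qed
        have "(\<Sum>a\<in>N. ?d a * (s - ?d a)) = (\<Sum>a\<in>N0. ?d a * (s - ?d a)) + (\<Sum>a\<in>N1. ?d a * (s - ?d a))"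
          unfolding NN(1) using fN NN(2) by (intro sum.union_disjoint) auto
        also have "\<dots> \<le> 16 * (s * (\<epsilon> * m))" using p0 p1 by (simp add: algebra_simps)
        also have "\<dots> \<le> 20 * (s * (\<epsilon> * m))" using s0 em0 by (intro mult_right_mono) auto
        finally show ?thesis by (simp add: mult_ac)
      qed
      have WW': "real (card (arcs G \<inter> (- N) \<times> (- N))) \<le> \<epsilon> * m"
        using WW mult_right_mono[OF e4(1), of m] m0 by linarith
      have "\<exists>AA NN. \<Union>G = AA \<union> NN \<and> AA \<inter> NN = {} \<and> (\<forall>v\<in>AA. \<forall>w\<in>AA. {v, w} \<notin> G)
        \<and> (\<forall>v\<in>NN. \<forall>w\<in>NN. {v, w} \<notin> G) \<and> \<rho>\<^sup>2 \<le> m"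
        by (rule unbounded_case[of \<delta> \<epsilon> A1])
           (use \<delta> \<epsilon> fA ks E dsum WW' m_rho big in \<open>auto simp: N_def s_def A1_def Ah_def\<close>)
      then show ?thesis by blast
    qed
  qed
qed

end

section \<open>Structure of extremal graphs\<close>

text \<open>Parameters are fixed so that each depends only on earlier ones: \<delta>, \<epsilon>,
  \<epsilon>0, the densities c1 and c2, the counts q1 and q2, and last \<Lambda>. This is possible
  because the counts needed in the excess bounds do not depend on \<rho>.\<close>

lemma dichotomy_large:
  fixes k :: nat
  assumes k: "2 \<le> k"
  obtains \<Lambda> where "\<And>G x \<rho> u. Kfree_perron_graph G x \<rho> u k \<Longrightarrow> \<Lambda> \<le> \<rho> \<Longrightarrow>
    (\<exists>A0. finite A0 \<and> real (card A0) < 100 * (real k)\<^sup>2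
        \<and> 3200 * (real k)\<^sup>2 * real (card (arcs G \<inter> (- A0) \<times> (- A0))) \<le> real (card G))
    \<or> (\<exists>AA NN. \<Union>G = AA \<union> NN \<and> AA \<inter> NN = {} \<and> (\<forall>v\<in>AA. \<forall>w\<in>AA. {v, w} \<notin> G)
     \<and> (\<forall>v\<in>NN. \<forall>w\<in>NN. {v, w} \<notin> G) \<and> \<rho>\<^sup>2 \<le> real (card G))"
proof -
  \<comment> \<open>This makes \<open>k / \<delta> = 100 * k\<^sup>2\<close> the bound on the cover,
    and \<open>k ^ 3 * \<epsilon>\<close> an absolute constant small enough for the arcs left
    uncovered.\<close>
  define \<delta> where "\<delta> = 1 / (100 * real k)"
  define \<epsilon> where "\<epsilon> = \<delta> ^ 3 / 10 ^ 6"
  define \<epsilon>0 where "\<epsilon>0 = \<epsilon> ^ 4"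
  define c1 where "c1 = \<epsilon>0 / 32"
  define c2 where "c2 = \<epsilon>0 * \<epsilon>\<^sup>2 / 8"
  have k0: "0 < real k" using k by simp
  have \<delta>: "0 < \<delta>" "real k * \<delta> \<le> 1 / 100" using k0 by (auto simp: \<delta>_def)
  have \<epsilon>: "0 < \<epsilon>" using \<delta> by (simp add: \<epsilon>_def)
  have \<epsilon>0: "0 < \<epsilon>0" using \<epsilon> by (simp add: \<epsilon>0_def)
  have c: "0 < c1" "0 < c2" using \<epsilon> \<epsilon>0 by (auto simp: c1_def c2_def)
  obtain q1 where q1: "2 * real k / c1 \<le> real q1" using real_arch_simple by blast
  obtain q2 where q2: "2 * real k / c2 \<le> real q2" using real_arch_simple by blast
  define \<Lambda> where "\<Lambda> = 1 + real k * 2 ^ (q1 + 1) / c1 + 32 * real q1 / \<epsilon>0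
     + \<epsilon> * (real k * 2 ^ (q2 + 1)) / c2 + 8 * real q2 / (\<epsilon> * \<epsilon>0) + 8 * real k / \<delta> + 4 / \<epsilon>"
  have t: "0 \<le> real k * 2 ^ (q1 + 1) / c1" "0 \<le> 32 * real q1 / \<epsilon>0"
     "0 \<le> \<epsilon> * (real k * 2 ^ (q2 + 1)) / c2" "0 \<le> 8 * real q2 / (\<epsilon> * \<epsilon>0)" "0 \<le> 8 * real k / \<delta>" "0 \<le> 4 / \<epsilon>"
    using c \<epsilon> \<epsilon>0 \<delta> by (auto intro!: divide_nonneg_pos mult_nonneg_nonneg)
  show ?thesis
  proof (rule that[of \<Lambda>])
    fix G x \<rho> u
    assume "Kfree_perron_graph G x \<rho> u k" and \<Lambda>: "\<Lambda> \<le> \<rho>"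
    then interpret Kfree_perron_graph G x \<rho> u k by simp
    have r: "real k * 2 ^ (q1 + 1) / c1 \<le> \<rho>" "32 * real q1 / \<epsilon>0 \<le> \<rho>"
      "\<epsilon> * (real k * 2 ^ (q2 + 1)) / c2 \<le> \<rho>" "8 * real q2 / (\<epsilon> * \<epsilon>0) \<le> \<rho>"
      "8 * real k / \<delta> \<le> \<rho>" "4 / \<epsilon> \<le> \<rho>"
      using \<Lambda> t unfolding \<Lambda>_def by linarith+
    have exc: "excess w \<le> \<epsilon>0 / 4 * \<rho>\<^sup>2" for w
    proof -
      have "excess w \<le> 4 * c1 * \<rho>\<^sup>2 + 4 * real q1 * \<rho>"
      proof (rule excess_le[OF c(1)])
        show "2 * real k \<le> real q1 * c1" using q1 c by (simp add: field_simps)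
        have "real k * 2 ^ (q1 + 1) \<le> c1 * \<rho>" using r(1) c by (simp add: field_simps)
        also have "\<dots> \<le> c1 * (2 * \<rho>)" using c rho0 by simp
        finally show "real k * 2 ^ (q1 + 1) \<le> c1 * (2 * \<rho>)" .
      qed
      moreover have "4 * real q1 * \<rho> \<le> \<epsilon>0 / 8 * \<rho>\<^sup>2"
      proof -
        have "4 * real q1 \<le> \<epsilon>0 / 8 * \<rho>" using r(2) \<epsilon>0 by (simp add: field_simps)
        then have "4 * real q1 * \<rho> \<le> \<epsilon>0 / 8 * \<rho> * \<rho>" using rho0 by (intro mult_right_mono) auto
        then show ?thesis by (simp add: power2_eq_square)
      qed
      moreover have "4 * c1 * \<rho>\<^sup>2 = \<epsilon>0 / 8 * \<rho>\<^sup>2" by (simp add: c1_def)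
      ultimately show ?thesis by linarith
    qed
    have \<epsilon>01: "\<epsilon>0 \<le> 1"
    proof -
      have "\<delta> \<le> 1" using \<delta> k0 k by (simp add: \<delta>_def field_simps)
      then have "\<delta> ^ 3 \<le> 1" using \<delta> by (intro power_le_one) auto
      then have "\<epsilon> \<le> 1" by (simp add: \<epsilon>_def)
      then show ?thesis unfolding \<epsilon>0_def using \<epsilon> by (intro power_le_one) auto
    qed
    have m_half: "\<rho>\<^sup>2 / 2 \<le> m"
    proof -
      have "\<epsilon>0 / 4 * \<rho>\<^sup>2 \<le> 1 / 4 * \<rho>\<^sup>2" using \<epsilon>01 by (intro mult_right_mono) auto
      then show ?thesis using rho_sq_le exc[of u] by linarith
    qed
    have half: "\<epsilon>0 / 4 * \<rho>\<^sup>2 \<le> \<epsilon>0 / 2 * m"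
    proof -
      have "\<epsilon>0 / 2 * (\<rho>\<^sup>2 / 2) \<le> \<epsilon>0 / 2 * m" using m_half \<epsilon>0 by (intro mult_left_mono) auto
      then show ?thesis by simp
    qed
    have m0: "0 \<le> \<epsilon>0 * m" using \<epsilon>0 by simp
    have exc': "excess w \<le> \<epsilon>0 * m" for w using exc[of w] half m0 by linarith
    have heavy: "real (card (arcs G \<inter> {v\<in>nbr G u. \<epsilon> \<le> x v} \<times> {v\<in>nbr G u. \<epsilon> \<le> x v})) \<le> \<epsilon>0 * m"
    proof -
      have "real (card (arcs G \<inter> {v\<in>nbr G u. \<epsilon> \<le> x v} \<times> {v\<in>nbr G u. \<epsilon> \<le> x v}))
          \<le> c2 * (\<rho> / \<epsilon>)\<^sup>2 + real q2 * (\<rho> / \<epsilon>)"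
      proof (rule heavy_nbr_arcs_le[OF \<epsilon> c(2)])
        show "2 * real k \<le> real q2 * c2" using q2 c by (simp add: field_simps)
        show "real k * 2 ^ (q2 + 1) \<le> c2 * (\<rho> / \<epsilon>)" using r(3) c \<epsilon> by (simp add: field_simps)
      qed
      moreover have "c2 * (\<rho> / \<epsilon>)\<^sup>2 = \<epsilon>0 / 8 * \<rho>\<^sup>2" using \<epsilon> by (simp add: c2_def power_divide)
      moreover have "real q2 * (\<rho> / \<epsilon>) \<le> \<epsilon>0 / 8 * \<rho>\<^sup>2"
      proof -
        have "real q2 / \<epsilon> \<le> \<epsilon>0 / 8 * \<rho>" using r(4) \<epsilon> \<epsilon>0 by (simp add: field_simps)
        then have "real q2 / \<epsilon> * \<rho> \<le> \<epsilon>0 / 8 * \<rho> * \<rho>" using rho0 by (intro mult_right_mono) auto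
        then show ?thesis by (simp add: power2_eq_square)
      qed
      ultimately show ?thesis using half m0 by linarith
    qed
    have kd: "real k / \<delta> = 100 * (real k)\<^sup>2" by (simp add: \<delta>_def power2_eq_square)
    have small: "3200 * (real k)\<^sup>2 * (23 * real k * \<epsilon> * m) \<le> m"
    proof -
      have "3200 * (real k)\<^sup>2 * (23 * real k * \<epsilon>) = 73600 * (real k) ^ 3 * \<epsilon>"
        by (simp add: power2_eq_square power3_eq_cube)
      also have "\<dots> = 73600 / 10 ^ 12"
        using k0 by (simp add: \<epsilon>_def \<delta>_def power_divide power_mult_distrib)
      also have "\<dots> \<le> 1" by simp
      finally have "3200 * (real k)\<^sup>2 * (23 * real k * \<epsilon>) * m \<le> 1 * m" by (intro mult_right_mono) auto
      then show ?thesis by (simp add: mult_ac)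
    qed
    have "(\<exists>A0. finite A0 \<and> real (card A0) < real k / \<delta>
        \<and> real (card (arcs G \<inter> (- A0) \<times> (- A0))) \<le> 23 * real k * \<epsilon> * m)
      \<or> (\<exists>AA NN. \<Union>G = AA \<union> NN \<and> AA \<inter> NN = {} \<and> (\<forall>v\<in>AA. \<forall>w\<in>AA. {v, w} \<notin> G)
       \<and> (\<forall>v\<in>NN. \<forall>w\<in>NN. {v, w} \<notin> G) \<and> \<rho>\<^sup>2 \<le> m)" (is "?H \<or> ?U")
      by (rule dichotomy[OF \<delta> \<epsilon> _ _ _ exc' heavy r(5) r(6)])
         (use \<epsilon>0 in \<open>simp_all only: \<epsilon>_def[symmetric] \<epsilon>0_def[symmetric] less_imp_le order_refl\<close>)
    then show "(\<exists>A0. finite A0 \<and> real (card A0) < 100 * (real k)\<^sup>2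
        \<and> 3200 * (real k)\<^sup>2 * real (card (arcs G \<inter> (- A0) \<times> (- A0))) \<le> m) \<or> ?U"
    proof (rule disj_forward)
      assume ?H
      then obtain A0 where A0: "finite A0" "real (card A0) < real k / \<delta>"
        "real (card (arcs G \<inter> (- A0) \<times> (- A0))) \<le> 23 * real k * \<epsilon> * m" by blast
      have "3200 * (real k)\<^sup>2 * real (card (arcs G \<inter> (- A0) \<times> (- A0))) \<le> 3200 * (real k)\<^sup>2 * (23 * real k * \<epsilon> * m)"
        using A0(3) by (intro mult_left_mono) auto
      then have "3200 * (real k)\<^sup>2 * real (card (arcs G \<inter> (- A0) \<times> (- A0))) \<le> m" using small by linarith
      then show "\<exists>A0. finite A0 \<and> real (card A0) < 100 * (real k)\<^sup>2
        \<and> 3200 * (real k)\<^sup>2 * real (card (arcs G \<inter> (- A0) \<times> (- A0))) \<le> m"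
        using A0 kd by auto
    qed
  qed
qed

section \<open>Equality in the bipartite bound\<close>

context perron_graph
begin

text \<open>The neighbourhood of u is independent, so the excess at u vanishes and no arc has
  positive loss at u. An arc inside W would lose 1, and an arc ending in z of W loses 1 - x z, so x
  z = 1.\<close>

lemma complete_bipartite:
  assumes V: "\<Union>G = I \<union> J" "I \<inter> J = {}"
    and ind: "\<forall>v\<in>I. \<forall>w\<in>I. {v, w} \<notin> G" "\<forall>v\<in>J. \<forall>w\<in>J. {v, w} \<notin> G"
    and le: "\<rho>\<^sup>2 \<le> m"
  defines "N \<equiv> nbr G u" and "W \<equiv> \<Union>G - nbr G u"
  shows "\<forall>v\<in>N. \<forall>w\<in>N. {v, w} \<notin> G" "\<forall>v\<in>W. \<forall>w\<in>W. {v, w} \<notin> G" "\<forall>v\<in>N. \<forall>w\<in>W. {v, w} \<in> G" "u \<in> W" "N \<noteq> {}"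
proof -
  have indN: "\<forall>v\<in>N. \<forall>w\<in>N. {v, w} \<notin> G"
  proof (cases "u \<in> I")
    case True
    then have "N \<subseteq> J" using ind(1) V nbr_subset[of G u] by (auto simp: N_def nbr_def)
    then show ?thesis using ind(2) by blast
  next
    case False
    then have "u \<in> J" using V u_in_V by auto
    then have "N \<subseteq> I" using ind(2) V nbr_subset[of G u] by (auto simp: N_def nbr_def)
    then show ?thesis using ind(1) by blast
  qed
  have loss0: "loss z p \<le> 0" if z: "x z = 1" and nz: "nbr G z \<subseteq> N" and p: "p \<in> arcs G" for z p
  proof -
    have "arcs G \<inter> nbr G z \<times> nbr G z = {}" using indN nz by (fastforce simp: arcs_def)
    then have "excess z = 0" unfolding excess_def by simp
    moreover have "loss z p * real (card {p}) \<le> 2 * m - 2 * \<rho>\<^sup>2 * x z + excess z"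
      by (rule budget) (use p in auto)
    ultimately show ?thesis using z rho_sq by simp
  qed
  have lu: "loss u p \<le> 0" if "p \<in> arcs G" for p using loss0[OF xu _ that] by (simp add: N_def)
  show "\<forall>v\<in>N. \<forall>w\<in>N. {v, w} \<notin> G" by (rule indN)
  show indW: "\<forall>v\<in>W. \<forall>w\<in>W. {v, w} \<notin> G"
  proof (intro ballI notI)
    fix v w assume vw: "v \<in> W" "w \<in> W" "{v, w} \<in> G"
    then have "loss u (v, w) \<le> 0" by (intro lu) (simp add: arcs_def)
    then show False using vw by (simp add: loss_def W_def)
  qed
  show "u \<in> W" using u_in_V not_in_nbr_self[OF G] by (simp add: W_def)
  show "N \<noteq> {}" using Union_ex_nbr[OF G u_in_V] by (auto simp: N_def)
  show "\<forall>v\<in>N. \<forall>w\<in>W. {v, w} \<in> G"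
  proof (intro ballI)
    fix a z assume a: "a \<in> N" and z: "z \<in> W"
    have zV: "z \<in> \<Union>G" using z by (simp add: W_def)
    have nz: "nbr G z \<subseteq> N"
    proof
      fix v assume v: "v \<in> nbr G z"
      show "v \<in> N"
      proof (rule ccontr)
        assume "v \<notin> N"
        then have "v \<in> W" using v nbr_subset[of G z] by (auto simp: W_def N_def)
        then show False using indW z v by (auto simp: nbr_def)
      qed
    qed
    obtain v where v: "v \<in> nbr G z" using Union_ex_nbr[OF G zV] by metis
    have "v \<in> nbr G u" using v nz by (auto simp: N_def)
    moreover have "z \<notin> nbr G u" using z by (simp add: W_def)
    moreover have "loss u (v, z) \<le> 0" using v by (intro lu) (simp add: arcs_def nbr_def insert_commute)
    ultimately have "1 \<le> x z" by (simp add: loss_def)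
    \<comment> \<open>Now z can replace u as base point: the arc (a, u) has no positive loss at z,
      and u is not adjacent to z, so a is.\<close>
    then have xz: "x z = 1" using x1[of z] by simp
    have "(a, u) \<in> arcs G" using a by (simp add: arcs_def N_def nbr_def insert_commute)
    then have "loss z (a, u) \<le> 0" by (rule loss0[OF xz nz])
    moreover have "u \<notin> nbr G z" using nz not_in_nbr_self[OF G] by (auto simp: N_def)
    ultimately have "a \<in> nbr G z" by (auto simp: loss_def split: if_splits)
    then show "{a, z} \<in> G" by (simp add: nbr_def insert_commute)
  qed
qed

end

section \<open>The two cases for an extremal graph\<close>

definition extremal_structure :: "'a set set \<Rightarrow> real \<Rightarrow> nat set set \<Rightarrow> bool" where
  "extremal_structure EF \<mu> G \<longleftrightarrow> (\<exists>A C. A \<union> C = \<Union>G \<and> A \<inter> C = {}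
    \<and> (\<exists>M\<in>M_fam EF. verts M \<noteq> {} \<and> ratio M = \<mu> \<and> isomorphic (induced (of_edges G) A) M)
    \<and> (\<forall>e\<in>G. \<not> e \<subseteq> C) \<and> card {v\<in>C. \<not> (\<forall>a\<in>A. {v, a} \<in> G)} \<le> 1)"

lemma isomorphic_refl: "isomorphic H H"
  unfolding isomorphic_def by (intro exI[of _ id]) auto

lemma verts_induced: "verts (induced H A) = A"
  by (simp add: induced_def verts_def)

lemma edgs_induced: "edgs (induced (of_edges G) A) = {e\<in>G. e \<subseteq> A}"
  by (simp add: induced_def edgs_def of_edges_def)

lemma sqrt_shift_upper:
  fixes n c :: real
  assumes "0 < n" "0 \<le> c"
  shows "sqrt (n + c) \<le> sqrt n + c / sqrt n"
proof (rule real_le_lsqrt)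
  have s: "0 < sqrt n" "sqrt n * sqrt n = n" using assms by auto
  show "0 \<le> sqrt n + c / sqrt n" using assms by simp
  have "(sqrt n + c / sqrt n)\<^sup>2 = n + 2 * c + (c / sqrt n)\<^sup>2"
    using s by (simp add: power2_sum)
  then show "n + c \<le> (sqrt n + c / sqrt n)\<^sup>2" using assms zero_le_power2[of "c / sqrt n"] by linarith
qed

lemma sqrt_shift_lower:
  fixes n c :: real
  assumes "0 < n" "0 \<le> c" "c \<le> n"
  shows "sqrt n - c / sqrt n \<le> sqrt (n - c)"
proof (rule real_le_rsqrt)
  have s: "0 < sqrt n" "sqrt n * sqrt n = n" using assms by auto
  have "(sqrt n - c / sqrt n)\<^sup>2 = n - 2 * c + c\<^sup>2 / n"
    using s assms by (simp add: power2_diff power_divide)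
  moreover have "c\<^sup>2 / n \<le> c" using assms by (simp add: power2_eq_square divide_le_eq mult_left_mono)
  ultimately show "(sqrt n - c / sqrt n)\<^sup>2 \<le> n - c" by linarith
qed

text \<open>Either side may serve as A. The larger one is taken as C, because its size is at least
  the square root of n and hence at least v(F), as membership of the core in \<open>M_fam\<close>
  requires.\<close>

lemma spex_complete_bipartite_case:
  assumes EF: "is_edge_set EF" and spex: "spex EF n G" and pg: "perron_graph G x (lam G) u"
    and V: "\<Union>G = I \<union> J" "I \<inter> J = {}"
    and ind: "\<forall>v\<in>I. \<forall>w\<in>I. {v, w} \<notin> G" "\<forall>v\<in>J. \<forall>w\<in>J. {v, w} \<notin> G"
    and le: "(lam G)\<^sup>2 \<le> real n" and n: "(card (\<Union>EF))\<^sup>2 \<le> n"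
  shows "extremal_structure EF 0 G"
proof -
  interpret perron_graph G x "lam G" u by (rule pg)
  have cG: "card G = n" and free: "F_free EF G" using spex by (auto simp: spex_def)
  define N where "N = nbr G u"
  define W where "W = \<Union>G - nbr G u"
  have le': "(lam G)\<^sup>2 \<le> real (card G)" using le cG by simp
  note cb = complete_bipartite[OF V ind le', folded N_def W_def]
  have fin: "finite N" "finite W" using finN finV by (auto simp: N_def W_def)
  have NV: "N \<subseteq> \<Union>G" unfolding N_def by (rule nbr_subset)
  have key: "extremal_structure EF 0 G"
    if AC: "A \<union> C = \<Union>G" "A \<inter> C = {}" "A \<noteq> {}" and indA: "\<forall>v\<in>A. \<forall>w\<in>A. {v, w} \<notin> G"
      and indC: "\<forall>v\<in>C. \<forall>w\<in>C. {v, w} \<notin> G" and all: "\<forall>v\<in>A. \<forall>w\<in>C. {v, w} \<in> G"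
      and cC: "card (\<Union>EF) \<le> card C" for A C
  proof -
    have M: "induced (of_edges G) A \<in> M_fam EF"
      by (rule induced_in_M_fam[OF EF G free _ _ cC]) (use AC all in auto)
    have none: "e \<notin> G" if "e \<subseteq> A \<or> e \<subseteq> C" for e
    proof
      assume "e \<in> G"
      then obtain v w where "e = {v, w}" using edge_cases[OF G] by metis
      then show False using \<open>e \<in> G\<close> that indA indC by auto
    qed
    have "edgs (induced (of_edges G) A) = {}" unfolding edgs_induced using none by auto
    then have "ratio (induced (of_edges G) A) = 0" by (simp add: ratio_def)
    moreover have "{v\<in>C. \<not> (\<forall>a\<in>A. {v, a} \<in> G)} = {}"
    proof -
      have "{v, a} \<in> G" if "v \<in> C" "a \<in> A" for v a using all that by (metis insert_commute)
      then show ?thesis by blast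
    qed
    then have "card {v\<in>C. \<not> (\<forall>a\<in>A. {v, a} \<in> G)} \<le> 1" by (simp only: card.empty)
    moreover have "verts (induced (of_edges G) A) \<noteq> {}" using AC(3) by (simp only: verts_induced) simp
    moreover have "\<forall>e\<in>G. \<not> e \<subseteq> C" using none by blast
    ultimately show ?thesis unfolding extremal_structure_def
      using AC(1,2) M isomorphic_refl[of "induced (of_edges G) A"] by blast
  qed
  have "n \<le> card N * card W"
  proof -
    have "G \<subseteq> (\<lambda>(a, b). {a, b}) ` (N \<times> W)"
    proof
      fix e assume e: "e \<in> G"
      then obtain v w where vw: "e = {v, w}" using edge_cases[OF G] by metis
      have "v \<in> N \<union> W" "w \<in> N \<union> W" using e vw by (auto simp: N_def W_def)
      then consider "v \<in> N" "w \<in> W" | "v \<in> W" "w \<in> N" using cb(1,2) e vw by auto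
      then show "e \<in> (\<lambda>(a, b). {a, b}) ` (N \<times> W)"
        using vw by cases (force simp: insert_commute)+
    qed
    then have "card G \<le> card (N \<times> W)" using fin by (meson card_image_le card_mono finite_SigmaI finite_imageI order_trans)
    then show ?thesis using cG by (simp add: card_cartesian_product)
  qed
  show ?thesis
  proof (cases "card N \<le> card W")
    case True
    then have "card N * card W \<le> (card W)\<^sup>2" by (simp add: power2_eq_square)
    then have "(card (\<Union>EF))\<^sup>2 \<le> (card W)\<^sup>2" using n \<open>n \<le> _\<close> by linarith
    then have "card (\<Union>EF) \<le> card W" by (simp add: power2_nat_le_eq_le)
    then show ?thesis by (intro key[of N W]) (use cb NV in \<open>auto simp: W_def N_def\<close>)
  next
    case False
    then have "card N * card W \<le> (card N)\<^sup>2" by (simp add: power2_eq_square)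
    then have "(card (\<Union>EF))\<^sup>2 \<le> (card N)\<^sup>2" using n \<open>n \<le> _\<close> by linarith
    then have "card (\<Union>EF) \<le> card N" by (simp add: power2_nat_le_eq_le)
    moreover have "\<forall>v\<in>W. \<forall>w\<in>N. {v, w} \<in> G" using cb(3) by (metis insert_commute)
    moreover have "W \<union> N = \<Union>G" "W \<inter> N = {}" "W \<noteq> {}" using cb(4) NV by (auto simp: W_def N_def)
    ultimately show ?thesis using cb(1,2) by (intro key[of W N])
  qed
qed

text \<open>The upper bound with the actual core and the lower bound with the optimal M0 meet up to
  (C1 + C2) / sqrt(n), which first identifies the ratio; the competitor built from the actual core
  then fixes the edges leaving it.\<close>

lemma spex_core_case:
  assumes EF: "is_edge_set EF" and spex: "spex EF n G" and cg: "core_graph G x (lam G) u k0 A"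
    and M0: "M0 \<in> M_fam EF" "verts M0 \<noteq> {}"
    and max: "\<And>M. M \<in> M_fam EF \<Longrightarrow> verts M \<noteq> {} \<Longrightarrow> ratio M \<le> ratio M0"
    and T1: "4 * k0 * real (card (\<Union>EF)) \<le> lam G"
    and T2: "(k0\<^sup>2 + 3) * k0\<^sup>2 * (2 * (330 * k0 ^ 3) + 2 * (10 * k0\<^sup>2)\<^sup>2) < lam G"
    and T3: "k0\<^sup>2 + k0 \<le> real n"
  defines "C1 \<equiv> 3500 * k0 ^ 5" and "C2 \<equiv> real (card (edgs M0) + card (verts M0))"
  assumes T4: "(C1 + C2) * (k0 * real (card (verts M0))) < sqrt (real n)" and T5: "C2 \<le> real n"
  shows "\<bar>lam G - sqrt (real n) - ratio M0\<bar> \<le> (C1 + C2) / sqrt (real n)" "extremal_structure EF (ratio M0) G"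
proof -
  interpret core_graph G x "lam G" u k0 A by (rule cg)
  have cG: "card G = n" and free: "F_free EF G" using spex by (auto simp: spex_def)
  define M where "M = induced (of_edges G) A"
  have vM: "verts M = A" and eM: "edgs M = {e\<in>G. e \<subseteq> A}"
    unfolding M_def by (rule verts_induced, rule edgs_induced)
  have cB: "card (\<Union>EF) \<le> card B" using card_B_ge[OF T1] by simp
  have M: "M \<in> M_fam EF" unfolding M_def
    by (rule induced_in_M_fam[OF EF G free A_sub _ cB]) (auto simp: B_def R_def nbr_def insert_commute)
  have A0: "A \<noteq> {}" using u_in_A by auto
  have rM: "ratio M = real eA / real (card A)" by (simp add: ratio_def vM eM eA_def)
  have gM0: "is_graph M0" using M0 by (simp add: M_fam_def)
  have s0: "0 < card (verts M0)" using M0 gM0 by (simp add: is_graph_def card_gt_0_iff)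
  have n0: "0 < real n"
  proof -
    have "1 \<le> k0\<^sup>2 + k0" using k01 by (simp add: add_increasing)
    then show ?thesis using T3 by linarith
  qed
  have sn: "0 < sqrt (real n)" using n0 by simp
  have C0: "0 \<le> C1" "0 \<le> C2" using k01 by (auto simp: C1_def C2_def)
  have up: "lam G \<le> sqrt (real n) + C1 / sqrt (real n) + ratio M"
    using rho_upper sqrt_shift_upper[OF n0 C0(1)] by (simp add: cG C1_def rM)
  have low: "ratio M0 + sqrt (real n) - C2 / sqrt (real n) \<le> lam G"
  proof -
    have "card (edgs M0) + card (verts M0) \<le> n" using T5 by (simp add: C2_def)
    from spex_lam_lower(1)[OF EF M0(1) spex M0(2) this]
    have "ratio M0 + sqrt (real n - C2) \<le> lam G" by (simp add: C2_def diff_diff_eq)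
    then show ?thesis using sqrt_shift_lower[OF n0 C0(2) T5] by linarith
  qed
  have rle: "ratio M \<le> ratio M0" using max[OF M] A0 by (simp add: vM)
  have req: "ratio M = ratio M0"
  proof (rule ccontr)
    assume "ratio M \<noteq> ratio M0"
    then have less: "ratio M < ratio M0" using rle by simp
    let ?s = "card A" and ?sM = "card (verts M0)" and ?eM = "card (edgs M0)"
    have s: "0 < ?s" using cardA1 by simp
    have "real eA * real ?sM < real ?eM * real ?s"
      using less s s0 unfolding rM by (simp add: ratio_def field_simps)
    then have "real (eA * ?sM) < real (?eM * ?s)" by simp
    then have "eA * ?sM + 1 \<le> ?eM * ?s" by (simp only: of_nat_less_iff)
    then have "real (eA * ?sM + 1) \<le> real (?eM * ?s)" by (rule of_nat_mono)
    then have "real eA * real ?sM + 1 \<le> real ?eM * real ?s" by simp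
    \<comment> \<open>Two different fractions differ by at least the reciprocal of the product of
      their denominators, which T4 makes too much for the gap between the bounds.\<close>
    then have "1 / (real ?s * real ?sM) \<le> ratio M0 - ratio M"
      unfolding rM using s s0 by (simp add: ratio_def field_simps)
    also have "\<dots> \<le> (C1 + C2) / sqrt (real n)" using up low by (simp add: add_divide_distrib)
    finally have "sqrt (real n) \<le> (C1 + C2) * (real ?s * real ?sM)" using s s0 sn by (simp add: field_simps)
    also have "\<dots> \<le> (C1 + C2) * (k0 * real ?sM)" using C0 cardA by (intro mult_left_mono mult_right_mono) auto
    finally show False using T4 by linarith
  qed
  have "0 \<le> C1 / sqrt (real n)" "0 \<le> C2 / sqrt (real n)" using C0 sn by simp_all
  then show "\<bar>lam G - sqrt (real n) - ratio M0\<bar> \<le> (C1 + C2) / sqrt (real n)"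
    using up low req by (simp add: add_divide_distrib abs_le_iff)
  define t where "t = (n - eA) div card A"
  define r where "r = (n - eA) mod card A"
  have s: "0 < card A" using cardA1 by simp
  have rs: "r < card A" using s by (simp add: r_def)
  have eAn: "eA + card A \<le> n"
  proof -
    have "real (eA + card A) \<le> real n" using eA_le cardA T3 by simp
    then show ?thesis by (simp only: of_nat_le_iff)
  qed
  have nn: "n = eA + card A * t + r" using eAn by (simp add: t_def r_def)
  have t0: "0 < t" using eAn s by (simp add: t_def div_greater_zero_iff)
  obtain T where T: "T \<subseteq> A" "card T = r" using obtain_subset_with_card_n[of r A] rs by (metis less_imp_le)
  define \<sigma> where "\<sigma> = (\<Sum>a\<in>A. x a)"
  define \<tau> where "\<tau> = (\<Sum>a\<in>T. x a)"
  \<comment> \<open>The outer trial values \<sigma> / lam G and \<tau> / lam G are those that the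
    eigenvector equation prescribes for vertices attached to A and to T.\<close>
  have "quad (edgs M) x + 2 * real t * (\<sigma> / lam G) * (\<Sum>a\<in>verts M. x a) + 2 * (\<tau> / lam G) * (\<Sum>a\<in>T. x a)
    \<le> lam G * ((\<Sum>a\<in>verts M. (x a)\<^sup>2) + real t * (\<sigma> / lam G)\<^sup>2 + (\<tau> / lam G)\<^sup>2)"
    by (rule spex_join_bound[OF EF M spex _ _ t0]) (use nn T A0 in \<open>auto simp: vM eM eA_def\<close>)
  then have "quad {e\<in>G. e \<subseteq> A} x + 2 * real t * (\<sigma> / lam G) * \<sigma> + 2 * (\<tau> / lam G) * \<tau>
    \<le> lam G * (XA + real t * (\<sigma> / lam G)\<^sup>2 + (\<tau> / lam G)\<^sup>2)"
    by (simp only: vM eM \<sigma>_def[symmetric] \<tau>_def[symmetric] XA_def[symmetric])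
  also have "\<dots> = lam G * XA + real t * \<sigma>\<^sup>2 / lam G + \<tau>\<^sup>2 / lam G"
    using rho0 by (simp add: field_simps power2_eq_square)
  also have "2 * real t * (\<sigma> / lam G) * \<sigma> = 2 * (real t * \<sigma>\<^sup>2 / lam G)" by (simp add: power2_eq_square)
  also have "2 * (\<tau> / lam G) * \<tau> = 2 * (\<tau>\<^sup>2 / lam G)" by (simp add: power2_eq_square)
  finally have sum: "quad {e\<in>G. e \<subseteq> A} x + 2 * (real t * \<sigma>\<^sup>2 / lam G) + 2 * (\<tau>\<^sup>2 / lam G)
    \<le> lam G * XA + real t * \<sigma>\<^sup>2 / lam G + \<tau>\<^sup>2 / lam G" .
  have "b + c \<le> d - a" if "a + 2 * b + 2 * c \<le> d + b + c" for a b c d :: real using that by linarith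
  from this[OF sum] have "real t * \<sigma>\<^sup>2 / lam G + \<tau>\<^sup>2 / lam G \<le> lam G * XA - quad {e\<in>G. e \<subseteq> A} x" .
  then have "lam G * (real t * \<sigma>\<^sup>2 / lam G + \<tau>\<^sup>2 / lam G) \<le> lam G * (lam G * XA - quad {e\<in>G. e \<subseteq> A} x)"
    using rho0 by (intro mult_left_mono) auto
  then have join: "real t * \<sigma>\<^sup>2 + \<tau>\<^sup>2 \<le> lam G * (lam G * XA - quad {e\<in>G. e \<subseteq> A} x)"
    using rho0 by (simp add: distrib_left)
  have cnt: "card G = eA + card A * t + r" using nn cG by simp
  have ex: "hR = 0 \<and> card Q \<le> 1"
    by (rule core_exact[OF cnt rs T]) (use join T2 in \<open>auto simp: \<sigma>_def \<tau>_def\<close>)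
  have touch: "e \<inter> A \<noteq> {}" if "e \<in> G" for e
  proof -
    have "finite {e\<in>G. e \<inter> A = {}}" using G by (simp add: is_edge_set_def)
    then have "{e\<in>G. e \<inter> A = {}} = {}" using ex by (simp add: hR_def)
    then show ?thesis using that by blast
  qed
  have sub: "{v\<in>R. \<not> (\<forall>a\<in>A. {v, a} \<in> G)} \<subseteq> Q"
  proof
    fix v assume v: "v \<in> {v\<in>R. \<not> (\<forall>a\<in>A. {v, a} \<in> G)}"
    then have vV: "v \<in> \<Union>G" "v \<notin> A" by (auto simp: R_def)
    obtain w where w: "w \<in> nbr G v" using Union_ex_nbr[OF G vV(1)] by metis
    then have "w \<in> A" using touch[of "{v, w}"] vV by (auto simp: nbr_def)
    then show "v \<in> Q" using v w by (auto simp: Q_def nbr_def)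
  qed
  have "card {v\<in>R. \<not> (\<forall>a\<in>A. {v, a} \<in> G)} \<le> 1"
    using card_mono[OF finR(3) sub] ex by linarith
  moreover have "\<forall>e\<in>G. \<not> e \<subseteq> R" using touch by (fastforce simp: R_def)
  moreover have "A \<union> R = \<Union>G" "A \<inter> R = {}" using A_sub by (auto simp: R_def)
  moreover have "verts M \<noteq> {} \<and> ratio M = ratio M0 \<and> isomorphic (induced (of_edges G) A) M"
    using A0 req isomorphic_refl by (simp add: vM M_def[symmetric])
  ultimately show "extremal_structure EF (ratio M0) G"
    unfolding extremal_structure_def using M by blast
qed

theorem theorem1p9:
  fixes EF :: "'a set set"
  assumes "is_edge_set EF" and "almost_bipartite EF" and "\<not> is_star EF"
  shows "\<exists>\<mu>. (\<exists>M\<in>M_fam EF. verts M \<noteq> {} \<and> ratio M = \<mu>)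
          \<and> (\<forall>M\<in>M_fam EF. verts M \<noteq> {} \<longrightarrow> ratio M \<le> \<mu>)
          \<and> (\<exists>K N. \<forall>m\<ge>N. \<forall>G. spex EF m G \<longrightarrow>
               \<bar>lam G - sqrt (real m) - \<mu>\<bar> \<le> K / sqrt (real m)
             \<and> (\<exists>A C. A \<union> C = \<Union>G \<and> A \<inter> C = {}
                  \<and> (\<exists>M\<in>M_fam EF. verts M \<noteq> {} \<and> ratio M = \<mu> \<and> isomorphic (induced (of_edges G) A) M)
                  \<and> (\<forall>e\<in>G. \<not> e \<subseteq> C)
                  \<and> card {v\<in>C. \<not> (\<forall>a\<in>A. {v, a} \<in> G)} \<le> 1))"
proof -
  obtain \<mu> M0 where M0: "M0 \<in> M_fam EF" "verts M0 \<noteq> {}" "ratio M0 = \<mu>"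
    and max: "\<And>M. M \<in> M_fam EF \<Longrightarrow> verts M \<noteq> {} \<Longrightarrow> ratio M \<le> \<mu>"
    by (rule max_ratio_exists[OF assms], rule that)
  define k where "k = card (\<Union>EF)"
  have k2: "2 \<le> k"
  proof -
    have "EF \<noteq> {}" using assms(3) by (auto simp: is_star_def)
    then obtain e where e: "e \<in> EF" by auto
    then have "card e \<le> k" unfolding k_def
      using finite_Union_edges[OF assms(1)] by (intro card_mono) auto
    then show ?thesis using e assms(1) by (simp add: is_edge_set_def)
  qed
  obtain \<Lambda> where dich: "\<And>G x \<rho> u. Kfree_perron_graph G x \<rho> u k \<Longrightarrow> \<Lambda> \<le> \<rho> \<Longrightarrow>
    (\<exists>A0. finite A0 \<and> real (card A0) < 100 * (real k)\<^sup>2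
        \<and> 3200 * (real k)\<^sup>2 * real (card (arcs G \<inter> (- A0) \<times> (- A0))) \<le> real (card G))
    \<or> (\<exists>AA NN. \<Union>G = AA \<union> NN \<and> AA \<inter> NN = {} \<and> (\<forall>v\<in>AA. \<forall>w\<in>AA. {v, w} \<notin> G)
     \<and> (\<forall>v\<in>NN. \<forall>w\<in>NN. {v, w} \<notin> G) \<and> \<rho>\<^sup>2 \<le> real (card G))"
    by (rule dichotomy_large[OF k2], rule that)
  define k0 where "k0 = 100 * (real k)\<^sup>2"
  define C1 where "C1 = 3500 * k0 ^ 5"
  define C2 where "C2 = real (card (edgs M0) + card (verts M0))"
  define T where "T = (k0\<^sup>2 + 3) * k0\<^sup>2 * (2 * (330 * k0 ^ 3) + 2 * (10 * k0\<^sup>2)\<^sup>2)"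
  \<comment> \<open>One threshold dominating all requirements, each added as a nonnegative term. For
    \<mu> = 0 the term \<open>C2 / \<mu>\<close> is 0 by the convention on division; it is used only
    when \<mu> is positive.\<close>
  define L where "L = \<bar>\<Lambda>\<bar> + 6000 * k0 ^ 5 + 32 * k0 + 4 * k0 * real k + T + (k0\<^sup>2 + k0)
     + (C1 + C2) * (k0 * real (card (verts M0))) + C2 + real k + C2 / \<mu> + 1"
  obtain N :: nat where N: "L\<^sup>2 \<le> real N" using real_arch_simple by blast
  have k01: "1 \<le> k0"
  proof -
    have "1 \<le> (real k)\<^sup>2" using k2 by (intro one_le_power) simp
    then show ?thesis by (simp add: k0_def)
  qed
  have \<mu>0: "0 \<le> \<mu>" using M0(3) by (auto simp: ratio_def)
  have C0: "0 \<le> C1" "0 \<le> C2" "0 \<le> T" using k01 by (auto simp: C1_def C2_def T_def)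
  have pos: "0 \<le> 6000 * k0 ^ 5" "0 \<le> 32 * k0" "0 \<le> 4 * k0 * real k" "0 \<le> k0\<^sup>2 + k0"
    "0 \<le> (C1 + C2) * (k0 * real (card (verts M0)))" "0 \<le> C2 / \<mu>"
    using k01 C0 \<mu>0 by auto
  have main: "\<bar>lam G - sqrt (real m) - \<mu>\<bar> \<le> (C1 + C2) / sqrt (real m) \<and> extremal_structure EF \<mu> G"
    if m: "N \<le> m" and spex: "spex EF m G" for m G
  proof -
    have G: "is_edge_set G" and cG: "card G = m" and free: "F_free EF G" using spex by (auto simp: spex_def)
    have L0: "1 \<le> L" using pos C0 unfolding L_def by linarith
    have Lm: "L\<^sup>2 \<le> real m" using N m by linarith
    have Ls: "L \<le> sqrt (real m)" using Lm by (rule real_le_rsqrt)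
    have Lm': "L \<le> real m"
    proof -
      have "L * 1 \<le> L * L" using L0 by (intro mult_left_mono) auto
      then show ?thesis using Lm by (simp add: power2_eq_square)
    qed
    have m1: "1 \<le> m" using Lm' L0 by linarith
    \<comment> \<open>The star with m edges, as the join of one vertex and an independent set, is
      the competitor.\<close>
    have lam_ge: "sqrt (real m) \<le> lam G"
    proof (rule spex_lam_lower(2)[OF assms(1) single_vertex_M_fam[OF assms(1,3), of 0] spex])
    qed (use m1 in \<open>auto simp: verts_def edgs_def\<close>)
    have lam_L: "L \<le> lam G" using Ls lam_ge by linarith
    have neG: "G \<noteq> {}" using cG m1 by auto
    obtain x u where xu: "\<And>v. 0 \<le> x v" "\<And>v. x v \<le> 1" "u \<in> \<Union>G" "x u = 1"
      "\<And>v. lam G * x v = (\<Sum>w\<in>nbr G v. x w)"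
      by (rule lam_perron_vector[OF G neG], rule that)
    have sq: "real m \<le> (lam G)\<^sup>2"
    proof -
      have "(sqrt (real m))\<^sup>2 \<le> (lam G)\<^sup>2" using lam_ge by (intro power_mono) auto
      then show ?thesis by simp
    qed
    have pg: "perron_graph G x (lam G) u"
      by unfold_locales (use G xu sq cG lam_L L0 in auto)
    then interpret perron_graph G x "lam G" u .
    have kg: "Kfree_perron_graph G x (lam G) u k"
      by unfold_locales (use Kplus_free_of_F_free[OF assms(1,2) G free] k2 in \<open>auto simp: k_def\<close>)
    have "\<Lambda> \<le> lam G" using lam_L pos C0 unfolding L_def by linarith
    from dich[OF kg this] consider
      (H) A0 where "finite A0" "real (card A0) < 100 * (real k)\<^sup>2"
        "3200 * (real k)\<^sup>2 * real (card (arcs G \<inter> (- A0) \<times> (- A0))) \<le> real (card G)"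
      | (U) AA NN where "\<Union>G = AA \<union> NN" "AA \<inter> NN = {}" "\<forall>v\<in>AA. \<forall>w\<in>AA. {v, w} \<notin> G"
        "\<forall>v\<in>NN. \<forall>w\<in>NN. {v, w} \<notin> G" "(lam G)\<^sup>2 \<le> real (card G)"
      by blast
    then show ?thesis
    proof cases
      case H
      define A where "A = {v. 1 / 4 \<le> x v}"
      have "A \<subseteq> A0" unfolding A_def
      proof (rule core_subset_cover[OF H(1) _ k01])
        show "real (card A0) \<le> k0" using H(2) by (simp add: k0_def)
        show "32 * k0 * real (card (arcs G \<inter> (- A0) \<times> (- A0))) \<le> real (card G)" using H(3) by (simp add: k0_def)
        show "32 * k0 \<le> lam G" using lam_L pos C0 unfolding L_def by linarith
      qed
      then have "card A \<le> card A0" using H(1) by (rule card_mono[rotated])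
      then have cA: "real (card A) \<le> k0" using H(2) by (simp add: k0_def)
      have cg: "core_graph G x (lam G) u k0 A"
      proof unfold_locales
        show "6000 * k0 ^ 5 \<le> lam G" using lam_L pos C0 unfolding L_def by linarith
      qed (use A_def cA k01 in auto)
      have max': "\<And>M. M \<in> M_fam EF \<Longrightarrow> verts M \<noteq> {} \<Longrightarrow> ratio M \<le> ratio M0" using max M0(3) by simp
      have t1: "4 * k0 * real (card (\<Union>EF)) \<le> lam G"
        using lam_L pos C0 unfolding L_def k_def[symmetric] by linarith
      have t2: "(k0\<^sup>2 + 3) * k0\<^sup>2 * (2 * (330 * k0 ^ 3) + 2 * (10 * k0\<^sup>2)\<^sup>2) < lam G"
        using lam_L pos C0 unfolding L_def T_def[symmetric] by linarith
      have t3: "k0\<^sup>2 + k0 \<le> real m" using Lm' pos C0 unfolding L_def by linarith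
      have t4: "(C1 + C2) * (k0 * real (card (verts M0))) < sqrt (real m)"
        using Ls pos C0 unfolding L_def by linarith
      have t5: "C2 \<le> real m" using Lm' pos C0 unfolding L_def by linarith
      have "\<bar>lam G - sqrt (real m) - ratio M0\<bar> \<le> (C1 + C2) / sqrt (real m)" "extremal_structure EF (ratio M0) G"
        using spex_core_case[OF assms(1) spex cg M0(1,2) max' t1 t2 t3 t4[unfolded C1_def C2_def] t5[unfolded C2_def]]
        unfolding C1_def C2_def by blast+
      then show ?thesis using M0(3) by simp
    next
      case U
      have lam_eq: "lam G = sqrt (real m)"
      proof -
        have "(lam G)\<^sup>2 = real m" using U(5) sq cG by simp
        then show ?thesis using rho0 by (metis less_imp_le real_sqrt_unique)
      qed
      have sm: "0 < sqrt (real m)" using m1 by simp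
      \<comment> \<open>The radius is exactly sqrt(m) here, so a positive \<mu> would contradict the
        lower bound from M0 once sqrt(m) exceeds \<open>C2 / \<mu>\<close>.\<close>
      have "\<mu> = 0"
      proof (rule ccontr)
        assume "\<mu> \<noteq> 0"
        then have \<mu>p: "0 < \<mu>" using \<mu>0 by simp
        have C2m: "C2 \<le> real m" using Lm' pos C0 unfolding L_def by linarith
        then have "card (edgs M0) + card (verts M0) \<le> m" by (simp add: C2_def)
        from spex_lam_lower(1)[OF assms(1) M0(1) spex M0(2) this]
        have "\<mu> + sqrt (real m - C2) \<le> lam G" by (simp add: C2_def diff_diff_eq M0(3))
        moreover have "sqrt (real m) - C2 / sqrt (real m) \<le> sqrt (real m - C2)"
          using m1 C0 C2m by (intro sqrt_shift_lower) auto
        ultimately have "\<mu> \<le> C2 / sqrt (real m)" using lam_eq by linarith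
        then have "sqrt (real m) \<le> C2 / \<mu>" using \<mu>p sm by (simp add: field_simps)
        moreover have "C2 / \<mu> + 1 \<le> sqrt (real m)" using Ls pos C0 unfolding L_def by linarith
        ultimately show False by linarith
      qed
      moreover have "extremal_structure EF 0 G"
      proof (rule spex_complete_bipartite_case[OF assms(1) spex pg U(1,2,3,4)])
        show "(lam G)\<^sup>2 \<le> real m" using U(5) cG by simp
        have "real k \<le> sqrt (real m)" using Ls pos C0 unfolding L_def by linarith
        then have "(real k)\<^sup>2 \<le> (sqrt (real m))\<^sup>2" by (intro power_mono) auto
        then have "real (k\<^sup>2) \<le> real m" by simp
        then show "(card (\<Union>EF))\<^sup>2 \<le> m" unfolding k_def by (simp only: of_nat_le_iff)
      qed
      moreover have "0 \<le> (C1 + C2) / sqrt (real m)" using C0 sm by simp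
      ultimately show ?thesis using lam_eq by simp
    qed
  qed
  show ?thesis
  proof (rule exI[of _ \<mu>], intro conjI)
    show "\<exists>M\<in>M_fam EF. verts M \<noteq> {} \<and> ratio M = \<mu>" using M0 by blast
    show "\<forall>M\<in>M_fam EF. verts M \<noteq> {} \<longrightarrow> ratio M \<le> \<mu>" using max by blast
    show "\<exists>K N. \<forall>m\<ge>N. \<forall>G. spex EF m G \<longrightarrow>
               \<bar>lam G - sqrt (real m) - \<mu>\<bar> \<le> K / sqrt (real m)
             \<and> (\<exists>A C. A \<union> C = \<Union>G \<and> A \<inter> C = {}
                  \<and> (\<exists>M\<in>M_fam EF. verts M \<noteq> {} \<and> ratio M = \<mu> \<and> isomorphic (induced (of_edges G) A) M)
                  \<and> (\<forall>e\<in>G. \<not> e \<subseteq> C)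
                  \<and> card {v\<in>C. \<not> (\<forall>a\<in>A. {v, a} \<in> G)} \<le> 1)"
      by (intro exI[of _ "C1 + C2"] exI[of _ N] allI impI) (rule main[unfolded extremal_structure_def])
  qed
qed

end
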